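(* Let $D$, $\Delta$, $m=m(n)$ and $\chi$ be as described in the context, and let $G$ be a uniformly random $(n,m,D)$-graph. Then: (1) Any (fixed) connected graph that is neither a tree nor a unicycle is asymptotically almost surely not a subgraph of $G$; that is, for each such graph $F$, the probability that $G$ contains a subgraph isomorphic to $F$ tends to $0$ as $n\to\infty$. (2) Denote by $C_j$ a cycle of length $j$, by $G[C_j]$ the number of subgraphs of $G$ isomorphic to $C_j$, and let $k\ge 3$ be a fixed integer. Then $G[C_3],\ldots,G[C_k]$ are asymptotically independent Poisson random variables of means $$\frac{1}{2j}\left(\frac{1}{2m/n}\,\frac{\chi^2\Delta''(\chi)}{\Delta(\chi)}\right)^j\qquad\text{for each } 3\le j\le k.$$
   Context: A graph $G=(V(G),E(G))$ has a finite set of labeled vertices and a set of edges, each an unordered pair of distinct vertices (no loops, no multiple edges). An $(n,m)$-graph is a graph with $n$ vertices, labeled from $1$ to $n$, and $m$ edges. $S$ is a subgraph of $G$ if $V(S)\subset V(G)$ and $E(S)\subset E(G)$ (not necessarily induced). A unicycle is a connected graph containing exactly one cycle (equivalently, a connected graph with as many edges as vertices). $D$ is a set of nonnegative integers containing at least two elements, with $\gcd(d-\min(D)\mid d\in D)=1$ ($\max(D)=+\infty$ if $D$ is infinite). An $(n,m,D)$-graph is an $(n,m)$-graph all of whose vertices have degree in $D$. It is assumed that $m=m(n)$ goes to infinity with $n$ in such a way that $2m/n$ has a limit in the open interval $]\min(D),\max(D)[$. Put $\Delta(x)=\sum_{d\in D}\frac{x^d}{d!}$, and let $\chi=\chi_{m/n}$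 be the unique positive solution of $\frac{\chi\Delta'(\chi)}{\Delta(\chi)}=\frac{2m}{n}$; under these assumptions $\chi$ has a finite positive limit as $n\to\infty$. "Asymptotically independent Poisson random variables of means $\lambda_3,\dots,\lambda_k$" (where the $\lambda_j$ depend on $n$ through $m/n$ and $\chi$ and converge as $n\to\infty$) means that for all fixed nonnegative integers $t_3,\dots,t_k$, $\mathbb{P}(G[C_j]=t_j \text{ for all } 3\le j\le k)-\prod_{j=3}^k \frac{\lambda_j^{t_j}}{t_j!}e^{-\lambda_j}\to 0$ as $n\to\infty$. *)

theory Defs
  imports "HOL-Probability.Probability"
begin

type_synonym 'a graph = "'a set \<times> 'a set set"

abbreviation verts :: "'a graph \<Rightarrow> 'a set" where
  "verts \<equiv> fst"

abbreviation edges :: "'a graph \<Rightarrow> 'a set set" where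
  "edges \<equiv> snd"

definition simple_graph :: "'a graph \<Rightarrow> bool" where
  "simple_graph G \<longleftrightarrow> finite (verts G) \<and> (\<forall>e\<in>edges G. e \<subseteq> verts G \<and> card e = 2)"

definition subgraph :: "'a graph \<Rightarrow> 'a graph \<Rightarrow> bool" where
  "subgraph S G \<longleftrightarrow> simple_graph S \<and> verts S \<subseteq> verts G \<and> edges S \<subseteq> edges G"

definition graph_iso :: "'a graph \<Rightarrow> 'b graph \<Rightarrow> bool" where
  "graph_iso F H \<longleftrightarrow>
     (\<exists>f. bij_betw f (verts F) (verts H) \<and> edges H = (\<lambda>e. f ` e) ` edges F)"

definition subgraph_count :: "'a graph \<Rightarrow> 'b graph \<Rightarrow> nat" where
  "subgraph_count F G = card {S. subgraph S G \<and> graph_iso F S}"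

text \<open>The formula for the edges is the intended one only for \<open>j \<ge> 3\<close>.\<close>
definition cycle_graph :: "nat \<Rightarrow> nat graph" where
  "cycle_graph j = ({0..<j}, {{i, Suc i mod j} | i. i < j})"

definition is_cycle :: "'a graph \<Rightarrow> bool" where
  "is_cycle S \<longleftrightarrow> (\<exists>j\<ge>3. graph_iso (cycle_graph j) S)"

definition connected_graph :: "'a graph \<Rightarrow> bool" where
  "connected_graph G \<longleftrightarrow> verts G \<noteq> {} \<and>
     (\<forall>u\<in>verts G. \<forall>v\<in>verts G. (u, v) \<in> {(x, y). {x, y} \<in> edges G}\<^sup>*)"

definition is_tree :: "'a graph \<Rightarrow> bool" where
  "is_tree G \<longleftrightarrow> simple_graph G \<and> connected_graph G \<and> \<not> (\<exists>S. subgraph S G \<and> is_cycle S)"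

definition is_unicycle :: "'a graph \<Rightarrow> bool" where
  "is_unicycle G \<longleftrightarrow> simple_graph G \<and> connected_graph G \<and> (\<exists>!S. subgraph S G \<and> is_cycle S)"

definition vertex_degree :: "'a graph \<Rightarrow> 'a \<Rightarrow> nat" where
  "vertex_degree G v = card {e \<in> edges G. v \<in> e}"

definition nmD_graphs :: "nat \<Rightarrow> nat \<Rightarrow> nat set \<Rightarrow> nat graph set" where
  "nmD_graphs n m D = {G. simple_graph G \<and> verts G = {1..n} \<and> card (edges G) = m \<and>
     (\<forall>v\<in>verts G. vertex_degree G v \<in> D)}"

text \<open>\<^const>\<open>pmf_of_set\<close> is unspecified on the empty set, so this is meaningful only when an
  \<open>(n, m, D)\<close>-graph exists.\<close>
definition random_nmD_graph :: "nat \<Rightarrow> nat \<Rightarrow> nat set \<Rightarrow> nat graph pmf" where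
  "random_nmD_graph n m D = pmf_of_set (nmD_graphs n m D)"

definition Delta :: "nat set \<Rightarrow> real \<Rightarrow> real" where
  "Delta D x = (\<Sum>\<^sub>\<infinity>d\<in>D. x ^ d / fact d)"

text \<open>The argument \<open>r\<close> stands for \<open>2m/n\<close>; the solution exists and is unique when \<open>r\<close> lies strictly
  between the minimum and the maximum (possibly infinite) of \<open>D\<close>.\<close>
definition chi :: "nat set \<Rightarrow> real \<Rightarrow> real" where
  "chi D r = (THE x. x > 0 \<and> x * deriv (Delta D) x / Delta D x = r)"

definition cycle_mean :: "nat set \<Rightarrow> real \<Rightarrow> nat \<Rightarrow> real" where
  "cycle_mean D r j =
     1 / (2 * real j) *
       (1 / r * ((chi D r)\<^sup>2 * deriv (deriv (Delta D)) (chi D r) / Delta D (chi D r))) ^ j"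

text \<open>The means \<open>lam n j\<close> may vary with \<open>n\<close>, so the joint law is compared with the product of
  Poisson laws along the sequence instead of with a fixed limit law.\<close>
definition asymp_indep_poisson ::
  "(nat \<Rightarrow> 'a pmf) \<Rightarrow> 'i set \<Rightarrow> ('i \<Rightarrow> 'a \<Rightarrow> nat) \<Rightarrow> (nat \<Rightarrow> 'i \<Rightarrow> real) \<Rightarrow> bool" where
  "asymp_indep_poisson M J X lam \<longleftrightarrow>
     (\<forall>t :: 'i \<Rightarrow> nat.
        (\<lambda>n. measure_pmf.prob (M n) {G. \<forall>j\<in>J. X j G = t j}
             - (\<Prod>j\<in>J. lam n j ^ t j / fact (t j) * exp (- lam n j))) \<longlonglongrightarrow> 0)"

end

theory Submission
  imports Defs "HOL-Complex_Analysis.Complex_Analysis"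
begin

text \<open>
  An \<open>(n, m)\<close>-graph is read as one of its \<open>m! 2^m\<close> words: functions assigning a vertex to each
  of the two ends of each of \<open>m\<close> edge slots. A uniform word whose letter counts lie in \<open>D\<close>, conditioned
  to have neither loops nor double edges (cycles of length one and two), is then a uniform
  \<open>(n, m, D)\<close>-graph. The number of words that extend a prescribed partial word is a factorial times a coefficient
  of a product of derivatives of \<open>\<Delta>\<close>, which Cauchy's formula on the circle of radius \<open>\<chi>\<close> compares with the
  coefficient of \<open>\<Delta>^n\<close>. Hence vertex-disjoint families of cycles have the factorial moments of
  independent Poisson variables of means \<open>\<nu>^j / (2j)\<close>, \<open>j \<ge> 1\<close>. The other families, and the connected graphs with at
  least two cycles, force a set of slots with fewer letters than slots, which has vanishing expected number.
  Bonferroni's inequalities turn the moments into the joint law, and dividing by the probability of having no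
  cycles of length one or two gives the law of the simple graph.
\<close>

section \<open>Exponential generating functions with restricted degrees\<close>

text \<open>Words are used because the number of words with given letter counts is a multinomial
  coefficient: degrees in \<open>D\<close> turn into the series \<Delta> and no degree sequence has
  to be fixed. Simplicity is not a condition on degrees, so it is recovered as an event, the absence
  of cycles of length one or two, whose probability tends to a positive constant. The mean arises as
  follows. A disjoint family with \<open>J\<close> slots in all has about (2m)^J placements and n^J
  choices of letters. Each letter is used twice, which turns \<open>J\<close> factors \<Delta> into
  second derivatives and multiplies the coefficient by about \<kappa>^J up to normalisation by the
  radius, while the 2J prescribed positions cost (2m)^(2J). As 2m/n tends to \<mu>, this gives
  (\<kappa>/\<mu>)^J; roots and orientations account for the 2j of each cycle. Only ratios of
  coefficients matter, so common constants cancel. The gcd condition ensures that on a circle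
  \<Delta> has maximal modulus only at the positive real point, so that the integral is concentrated
  there.\<close>

definition egf :: "nat set \<Rightarrow> nat \<Rightarrow> complex fps" where
  "egf D a = Abs_fps (\<lambda>e. if e + a \<in> D then 1 / fact e else 0)"

text \<open>\<open>egf D a\<close> and \<open>Dl D a\<close> are the \<open>a\<close>-th derivative
  of \<Delta>, once as a formal series and once as an entire function. The function is polymorphic
  so that its real values at the saddle point and its complex values on the circle share one set of
  lemmas.\<close>

definition Dl :: "nat set \<Rightarrow> nat \<Rightarrow> 'a::{banach,real_normed_field} \<Rightarrow> 'a" where
  "Dl D a x = (\<Sum>e. (if e + a \<in> D then 1 / fact e else 0) * x ^ e)"

lemma Dl_summable_norm:
  fixes x :: "'a::{banach,real_normed_field}"
  shows "summable (\<lambda>e. norm ((if e + a \<in> D then 1 / fact e else 0) * x ^ e))"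
proof (rule summable_comparison_test'[where N = 0])
  show "summable (\<lambda>e. norm x ^ e / fact e)"
    using summable_exp[of "norm x"] by (simp add: field_simps)
  show "norm (norm ((if e + a \<in> D then 1 / fact e else 0) * x ^ e)) \<le> norm x ^ e / fact e"
    for e by (auto simp: norm_mult norm_divide norm_power)
qed

lemma Dl_summable:
  fixes x :: "'a::{banach,real_normed_field}"
  shows "summable (\<lambda>e. (if e + a \<in> D then 1 / fact e else 0) * x ^ e)"
  using Dl_summable_norm by (rule summable_norm_cancel)

lemma Dl_has_field_derivative:
  fixes x :: "'a::{banach,real_normed_field}"
  shows "(Dl D a has_field_derivative Dl D (Suc a) x) (at x)"
proof -
  have "((\<lambda>x. \<Sum>e. (if e + a \<in> D then 1 / fact e else 0) * x ^ e) has_field_derivative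
     (\<Sum>e. diffs (\<lambda>e. if e + a \<in> D then 1 / fact e else 0) e * x ^ e)) (at x)"
    by (rule termdiffs_strong_converges_everywhere) (rule Dl_summable)
  moreover have "diffs (\<lambda>e. if e + a \<in> D then 1 / fact e else 0 :: 'a) =
      (\<lambda>e. if e + Suc a \<in> D then 1 / fact e else 0)"
    by (auto simp: diffs_def fun_eq_iff simp del: of_nat_Suc)
  ultimately show ?thesis by (simp add: Dl_def[abs_def])
qed

lemma isCont_Dl: "isCont (Dl D a) (x::'a::{banach,real_normed_field})"
  using Dl_has_field_derivative by (rule DERIV_isCont)

lemma tendsto_Dl:
  "(f \<longlongrightarrow> (x::'a::{banach,real_normed_field})) F \<Longrightarrow> ((\<lambda>t. Dl D a (f t)) \<longlongrightarrow> Dl D a x) F"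
  using isCont_tendsto_compose[OF isCont_Dl] .

lemma continuous_on_Dl [continuous_intros]:
  "continuous_on S f \<Longrightarrow> continuous_on S (\<lambda>t. Dl D a (f t :: 'a::{banach,real_normed_field}))"
  by (rule continuous_on_compose2[where t=UNIV and g="Dl D a"])
     (auto intro!: continuous_at_imp_continuous_on isCont_Dl)

lemma Dl_of_real: "Dl D a (of_real x :: 'a::{banach,real_normed_field}) = of_real (Dl D a x)"
proof -
  have "of_real (Dl D a x) = (\<Sum>e. of_real ((if e + a \<in> D then 1 / fact e else 0) * x ^ e) :: 'a)"
    unfolding Dl_def by (rule suminf_of_real) (rule Dl_summable)
  also have "\<dots> = Dl D a (of_real x)"
    unfolding Dl_def by (rule arg_cong[where f=suminf]) (auto simp: fun_eq_iff)
  finally show ?thesis by simp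
qed

lemma norm_Dl_le: "norm (Dl D a (z::'a::{banach,real_normed_field})) \<le> Dl D a (norm z)"
proof -
  have "norm (Dl D a z) \<le> (\<Sum>e. norm ((if e + a \<in> D then 1 / fact e else 0) * z ^ e))"
    unfolding Dl_def by (rule summable_norm) (rule Dl_summable_norm)
  also have "\<dots> = Dl D a (norm z)"
    unfolding Dl_def by (rule arg_cong[where f=suminf]) (auto simp: fun_eq_iff norm_mult norm_power norm_divide)
  finally show ?thesis .
qed

lemma Dl_nonneg: "x \<ge> 0 \<Longrightarrow> Dl D a (x::real) \<ge> 0"
  unfolding Dl_def by (rule suminf_nonneg[OF Dl_summable]) auto

lemma Dl_pos: 
  assumes "D \<noteq> {}" "x > (0::real)"
  shows "Dl D 0 x > 0"
proof -
  obtain d where "d \<in> D" using assms by auto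
  thus ?thesis unfolding Dl_def
    by (intro suminf_pos2[OF Dl_summable, where i=d]) (use assms in auto)
qed

lemma Delta_eq_Dl: "Delta D x = Dl D 0 x"
proof -
  have "(\<lambda>e. norm ((if e + 0 \<in> D then 1 / fact e else 0) * x ^ e)) summable_on UNIV"
    using Dl_summable_norm[of 0 D x] by (intro norm_summable_imp_summable_on) (simp add: if_distrib cong: if_cong)
  hence s: "(\<lambda>e. ((if e + 0 \<in> D then 1 / fact e else 0) * x ^ e)) summable_on UNIV"
    by (rule abs_summable_summable)
  have "infsum (\<lambda>e. ((if e + 0 \<in> D then 1 / fact e else 0) * x ^ e)) UNIV = Dl D 0 x"
    unfolding Dl_def by (rule sums_unique) (rule has_sum_imp_sums, rule has_sum_infsum, rule s)
  moreover have "Delta D x = infsum (\<lambda>e. ((if e + 0 \<in> D then 1 / fact e else 0) * x ^ e)) UNIV"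
    unfolding Delta_def by (rule infsum_cong_neutral) auto
  ultimately show ?thesis by simp
qed

lemma deriv_Delta: "deriv (Delta D) = Dl D 1"
proof
  fix x :: real
  have "Delta D = Dl D 0" by (auto simp: Delta_eq_Dl)
  thus "deriv (Delta D) x = Dl D 1 x"
    using DERIV_imp_deriv[OF Dl_has_field_derivative[of D 0 x]] by simp
qed

lemma deriv_deriv_Delta: "deriv (deriv (Delta D)) = Dl D 2"
  unfolding deriv_Delta
  by (rule ext) (use DERIV_imp_deriv[OF Dl_has_field_derivative[of D 1]] in \<open>simp add: numeral_2_eq_2\<close>)

section \<open>Coefficients as integrals over a circle\<close>

lemma conv_radius_egf [simp]: "fps_conv_radius (egf D a) = \<infinity>"
  unfolding fps_conv_radius_def egf_def
  by (rule conv_radius_inftyI'') (simp add: Dl_summable)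

lemma eval_egf: "eval_fps (egf D a) z = Dl D a z"
  by (simp add: eval_fps_def egf_def Dl_def)

lemma eval_fps_prod:
  fixes f :: "'b \<Rightarrow> complex fps"
  assumes "finite I" "\<And>i. i \<in> I \<Longrightarrow> fps_conv_radius (f i) = \<infinity>"
  shows "fps_conv_radius (\<Prod>i\<in>I. f i) = \<infinity> \<and> eval_fps (\<Prod>i\<in>I. f i) z = (\<Prod>i\<in>I. eval_fps (f i) z)"
  using assms
proof (induction I)
  case (insert i I)
  have "fps_conv_radius (f i * prod f I) \<ge> min (fps_conv_radius (f i)) (fps_conv_radius (prod f I))"
    by (rule fps_conv_radius_mult)
  thus ?case using insert by (simp add: eval_fps_mult)
qed auto

lemma integral_cis_int:
  fixes k :: int
  shows "(LINT t:{-pi..pi}|lborel. cis (k * t)) = (if k = 0 then 2 * pi else 0)"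
proof (cases "k = 0")
  case True thus ?thesis by (simp add: set_integral_const set_lebesgue_integral_def scaleR_conv_of_real)
next
  case False
  define F where "F = (\<lambda>t::real. cis (k * t) / (\<i> * k))"
  have "(F has_vector_derivative cis (k * t)) (at t within {-pi..pi})" for t :: real
    unfolding F_def cis_conv_exp using False
    by (auto intro!: derivative_eq_intros has_vector_derivative_real_field simp: field_simps)
  hence "(LBINT t. indicator {-pi..pi} t *\<^sub>R cis (k * t)) = F pi - F (-pi)"
    by (intro integral_FTC_Icc) (auto intro!: continuous_intros)
  also have "F pi = F (-pi)"
    using sin_npi_int[of k] by (auto simp: F_def cis.ctr complex_eq_iff mult.commute)
  finally show ?thesis using False by (simp add: set_lebesgue_integral_def)
qed

text \<open>Series and integral may be exchanged because the norms of the terms are constant on the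
  circle and summable; orthogonality of the characters then leaves the term of index
  \<open>N\<close>.\<close>

lemma fps_nth_eq_integral:
  fixes f :: "complex fps" and x :: real
  assumes rad: "fps_conv_radius f = \<infinity>" and x: "x > 0"
  shows "fps_nth f N * x ^ N =
     (LINT t:{-pi..pi}|lborel. eval_fps f (x * cis t) * cis (- (N * t))) / (2 * pi)"
proof -
  define g where "g = (\<lambda>(k::nat) (t::real). indicator {-pi..pi} t *\<^sub>R (fps_nth f k * x ^ k * cis (real_of_int (int k - int N) * t)))"
  have sn: "summable (\<lambda>k. norm (fps_nth f k * x ^ k))"
    using abs_summable_in_conv_radius[of "of_real x" "fps_nth f"] rad
    by (simp add: fps_conv_radius_def)
  have ig: "integrable lborel (g k)" for k
    unfolding g_def
    by (rule borel_integrable_compact) (auto intro!: continuous_intros)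
  have ng: "norm (g k t) = indicator {-pi..pi} t * norm (fps_nth f k * x ^ k)" for k t
    by (auto simp: g_def norm_mult indicator_def)
  have "(\<integral>t. (\<Sum>k. g k t) \<partial>lborel) = (\<Sum>k. integral\<^sup>L lborel (g k))"
  proof (rule integral_suminf)
    show "AE t in lborel. summable (\<lambda>k. norm (g k t))"
      unfolding ng using sn by (intro always_eventually allI summable_mult)
    have "(\<integral>t. norm (g k t) \<partial>lborel) = 2 * pi * norm (fps_nth f k * x ^ k)" for k
      unfolding ng by simp
    thus "summable (\<lambda>k. \<integral>t. norm (g k t) \<partial>lborel)"
      using sn by (simp add: summable_mult)
  qed (rule ig)
  moreover have "(\<Sum>k. g k t) = indicator {-pi..pi} t *\<^sub>R (eval_fps f (x * cis t) * cis (- (N * t)))" for t :: real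
  proof -
    have s: "summable (\<lambda>k. fps_nth f k * (x * cis t) ^ k)"
      using summable_fps[of "x * cis t" f] rad by simp
    have "g k t = indicator {-pi..pi} t *\<^sub>R (fps_nth f k * (x * cis t) ^ k * cis (- (N * t)))" for k
    proof -
      have "cis (real_of_int (int k - int N) * t) = cis t ^ k * cis (- (N * t))"
        unfolding Complex.DeMoivre cis_mult by (simp add: left_diff_distrib)
      thus ?thesis by (simp add: g_def power_mult_distrib)
    qed
    thus ?thesis using s unfolding eval_fps_def
      by (simp add: suminf_mult2 indicator_def summable_mult2)
  qed
  moreover have "integral\<^sup>L lborel (g k) = (if k = N then 2 * pi * fps_nth f N * x ^ N else 0)" for k
  proof -
    have "integral\<^sup>L lborel (g k) = fps_nth f k * x ^ k * (LINT t:{-pi..pi}|lborel. cis (real_of_int (int k - int N) * t))"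
      unfolding g_def set_lebesgue_integral_def
      by (subst integral_mult_right_zero[symmetric]) (simp add: mult_ac scaleR_conv_of_real)
    also have "\<dots> = (if k = N then 2 * pi * fps_nth f N * x ^ N else 0)"
      using integral_cis_int[of "int k - int N"] by simp
    finally show ?thesis .
  qed
  moreover have "(\<Sum>k. (if k = N then 2 * pi * fps_nth f N * x ^ N else 0)) = 2 * pi * fps_nth f N * x ^ N"
    using sums_single[of N "\<lambda>k. 2 * pi * fps_nth f N * x ^ N"] by (simp add: sums_iff)
  ultimately show ?thesis by (simp add: set_lebesgue_integral_def)
qed

section \<open>Decay on circles\<close>

lemma norm_cis_diff_one: "norm (cis x - 1) ^ 2 = 2 - 2 * cos x"
proof -
  have "norm (cis x - 1) ^ 2 = (cos x - 1)^2 + (sin x)^2"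
    by (simp add: cmod_power2)
  also have "\<dots> = 2 - 2 * cos x"
    using sin_cos_squared_add[of x] unfolding power2_diff by simp
  finally show ?thesis .
qed

text \<open>The integers \<open>k\<close> for which \<open>cis (k t) - 1\<close> is controlled by finitely many
  \<open>cis ((d - a) t) - 1\<close> form a subgroup of the integers.\<close>
lemma cis_bezout:
  fixes D :: "nat set" and a :: nat
  assumes a: "\<And>d. d \<in> D \<Longrightarrow> a \<le> d" and gcd: "Gcd {d - a |d. d \<in> D} = 1"
  obtains C F where "C > 0" "finite F" "F \<subseteq> D"
    "\<And>t::real. norm (cis t - 1) \<le> C * (\<Sum>d\<in>F. norm (cis ((real d - real a) * t) - 1))"
proof -
  define K where "K = {k::int. \<exists>C\<ge>0. \<exists>F. finite F \<and> F \<subseteq> D \<and>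
     (\<forall>t::real. norm (cis (k * t) - 1) \<le> C * (\<Sum>d\<in>F. norm (cis ((real d - real a) * t) - 1)))}"
  have gen: "int d - int a \<in> K" if "d \<in> D" for d
    unfolding K_def using that by (auto intro!: exI[of _ 1] exI[of _ "{d}"])
  have minus: "- k \<in> K" if "k \<in> K" for k
  proof -
    have "norm (cis (real_of_int (- k) * t) - 1) = norm (cis (k * t) - 1)" for t :: real
    proof (rule power2_eq_imp_eq)
      show "norm (cis (real_of_int (- k) * t) - 1)^2 = norm (cis (k * t) - 1)^2"
        unfolding norm_cis_diff_one by simp
    qed auto
    thus ?thesis using that by (simp add: K_def)
  qed
  have add: "k + k' \<in> K" if "k \<in> K" "k' \<in> K" for k k'
  proof -
    from that(1) obtain C F where CF1: "C \<ge> 0" "finite F" "F \<subseteq> D" 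
       "\<And>t::real. norm (cis (k * t) - 1) \<le> C * (\<Sum>d\<in>F. norm (cis ((real d - real a) * t) - 1))"
      unfolding K_def mem_Collect_eq by metis
    from that(2) obtain C' F' where CF2: "C' \<ge> 0" "finite F'" "F' \<subseteq> D" 
       "\<And>t::real. norm (cis (k' * t) - 1) \<le> C' * (\<Sum>d\<in>F'. norm (cis ((real d - real a) * t) - 1))"
      unfolding K_def mem_Collect_eq by metis
    note CF = CF1 CF2
    have "norm (cis (real_of_int (k + k') * t) - 1) \<le>
        (C + C') * (\<Sum>d\<in>F \<union> F'. norm (cis ((real d - real a) * t) - 1))" for t :: real
    proof -
      have eq: "cis (real_of_int (k + k') * t) - 1 = cis (k * t) * (cis (k' * t) - 1) + (cis (k * t) - 1)"
        by (simp add: algebra_simps cis_mult)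
      have "norm (cis (real_of_int (k + k') * t) - 1) \<le> norm (cis (k' * t) - 1) + norm (cis (k * t) - 1)"
        unfolding eq by (rule order.trans[OF norm_triangle_ineq]) (simp add: norm_mult)
      also have "\<dots> \<le> C' * (\<Sum>d\<in>F'. norm (cis ((real d - real a) * t) - 1)) 
                   + C * (\<Sum>d\<in>F. norm (cis ((real d - real a) * t) - 1))"
        using CF by (intro add_mono) auto
      also have "\<dots> \<le> C' * (\<Sum>d\<in>F \<union> F'. norm (cis ((real d - real a) * t) - 1)) 
                   + C * (\<Sum>d\<in>F \<union> F'. norm (cis ((real d - real a) * t) - 1))"
        using CF by (intro add_mono mult_left_mono sum_mono2) auto
      finally show ?thesis by (simp add: algebra_simps)
    qed
    thus ?thesis unfolding K_def using CF
      by (auto intro!: exI[of _ "C + C'"] exI[of _ "F \<union> F'"])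
  qed
  have zero: "0 \<in> K" unfolding K_def by (auto intro!: exI[of _ 0] exI[of _ "{}"])
  have mult: "int q * k \<in> K" if "k \<in> K" for k q
  proof (induction q)
    case (Suc q) 
    have "int (Suc q) * k = int q * k + k" by (simp add: algebra_simps)
    thus ?case using Suc that add by simp
  qed (use zero in auto)
  have mult': "q * k \<in> K" if "k \<in> K" for k q :: int
  proof (cases "q \<ge> 0")
    case True thus ?thesis using mult[OF that, of "nat q"] by simp
  next
    case False thus ?thesis using minus[OF mult[OF that, of "nat (-q)"]] by simp
  qed
  have "\<exists>d\<in>D. d - a \<noteq> 0"
  proof (rule ccontr)
    assume "\<not> ?thesis"
    hence "{d - a |d. d \<in> D} \<subseteq> {0}" by auto
    hence "Gcd {d - a |d. d \<in> D} = 0" by (simp add: Gcd_0_iff)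
    with gcd show False by simp
  qed
  then obtain d0 where d0: "d0 \<in> D" "d0 > a" by auto
  have "\<exists>n::nat. n > 0 \<and> int n \<in> K"
    using gen[OF d0(1)] d0 by (intro exI[of _ "d0 - a"]) (auto simp: of_nat_diff)
  \<comment> \<open>A least positive element of a subgroup of the integers divides all elements,
    here the generators \<open>d - a\<close>; as their gcd is 1, it is 1.\<close>
  define g where "g = (LEAST n::nat. n > 0 \<and> int n \<in> K)"
  have g: "g > 0" "int g \<in> K"
    using LeastI_ex[OF \<open>\<exists>n::nat. n > 0 \<and> int n \<in> K\<close>] by (auto simp: g_def)
  have gmin: "g \<le> n" if "n > 0" "int n \<in> K" for n :: nat
    unfolding g_def using that by (intro Least_le) auto
  have "g dvd d - a" if d: "d \<in> D" for d
  proof -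
    have "int (d - a) mod int g = int (d - a) - int g * (int (d - a) div int g)"
      by (rule minus_mult_div_eq_mod[symmetric])
    hence "int ((d - a) mod g) = (int d - int a) + (- (int (d - a) div int g)) * int g"
      using a[OF d] by (simp add: of_nat_mod of_nat_diff)
    hence "int ((d - a) mod g) \<in> K" using add[OF gen[OF d] mult'[OF g(2)]] by (simp only:)
    moreover have "(d - a) mod g < g" using g(1) by simp
    ultimately have "(d - a) mod g = 0" using gmin[of "(d - a) mod g"] by linarith
    thus ?thesis by auto
  qed
  hence "g dvd Gcd {d - a |d. d \<in> D}" by (intro Gcd_greatest) auto
  hence "g = 1" using gcd by simp
  hence "(1::int) \<in> K" using g by simp
  then obtain C F where CF: "C \<ge> 0" "finite F" "F \<subseteq> D" 
       "\<And>t::real. norm (cis t - 1) \<le> C * (\<Sum>d\<in>F. norm (cis ((real d - real a) * t) - 1))"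
    unfolding K_def by auto
  have "norm (cis t - 1) \<le> (C+1) * (\<Sum>d\<in>F. norm (cis ((real d - real a) * t) - 1))" for t
    using CF(4)[of t] by (rule order.trans) (auto intro!: mult_right_mono sum_nonneg)
  thus ?thesis using that[of "C+1" F] CF by auto
qed

text \<open>By the half-angle formula this is Jordan's inequality for the sine, which holds because
  the concave sine lies above its chord from 0 to \<open>pi / 2\<close>. The constant is half the
  sharp one.\<close>

lemma norm_cis_diff_one_ge:
  assumes "\<bar>t\<bar> \<le> pi"
  shows "norm (cis t - 1) \<ge> \<bar>t\<bar> / pi"
proof -
  have "2 * (t/pi)^2 \<le> 1 - cos t" 
  proof -
    have "sin (\<bar>t\<bar>/2) \<ge> 2 / pi * (\<bar>t\<bar>/2)"
    proof -
      have c: "concave_on {0..pi} sin"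
        by (rule f''_le0_imp_concave[where f' = cos and f''="\<lambda>x. - sin x"])
           (auto intro!: derivative_eq_intros simp: sin_ge_zero)
      show ?thesis
      proof (cases "t = 0")
        case False
        have "concave_on {0..pi} sin" by fact
        hence "sin ((1 - \<bar>t\<bar>/pi) *\<^sub>R 0 + (\<bar>t\<bar>/pi) *\<^sub>R (pi/2)) \<ge> (1 - \<bar>t\<bar>/pi) * sin 0 + (\<bar>t\<bar>/pi) * sin (pi/2)"
          using assms by (intro concave_onD) (auto simp: field_simps)
        thus ?thesis by simp
      qed auto
    qed
    hence "(sin (\<bar>t\<bar>/2))^2 \<ge> (2 / pi * (\<bar>t\<bar>/2))^2" by (intro power_mono) auto
    moreover have "cos t = 1 - 2 * (sin (\<bar>t\<bar>/2))^2"
      using cos_double_sin[of "\<bar>t\<bar>/2"] by simp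
    ultimately show ?thesis by (simp add: power_divide)
  qed
  moreover have "0 \<le> t\<^sup>2 / pi\<^sup>2" by simp
  ultimately have "(\<bar>t\<bar> / pi)^2 \<le> norm (cis t - 1)^2"
    unfolding norm_cis_diff_one power_divide power2_abs by linarith
  thus ?thesis by (rule power2_le_imp_le) auto
qed

text \<open>With w = p q (1 - cos x) / (p + q), the squared modulus is exactly (p + q)^2 - 2 (p + q)
  w, that is (p + q - w)^2 - w^2.\<close>

lemma norm_two_terms:
  fixes p q x :: real
  assumes "p > 0" "q > 0"
  shows "norm (of_real p + of_real q * cis x) \<le> p + q - p * q / (p + q) * (1 - cos x)"
proof (rule power2_le_imp_le)
  have "norm (of_real p + of_real q * cis x)^2 = (p + q * cos x)^2 + (q * sin x)^2"
    by (simp add: cmod_power2)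
  also have "\<dots> = p^2 + 2 * p * q * cos x + q^2 * ((sin x)^2 + (cos x)^2)"
    by (simp only: power2_sum power_mult_distrib distrib_left)
  also have "\<dots> = (p + q)^2 - 2 * p * q * (1 - cos x)"
    by (simp add: power2_eq_square algebra_simps)
  also have "\<dots> = (p + q)^2 - 2 * (p + q) * (p * q / (p + q) * (1 - cos x))"
  proof -
    have "p + q \<noteq> 0" using assms by simp
    thus ?thesis by (simp add: divide_simps) (simp add: algebra_simps)
  qed
  also have "\<dots> \<le> (p + q - p * q / (p + q) * (1 - cos x))^2"
    by (simp add: power2_diff)
  finally show "norm (of_real p + of_real q * cis x)^2 \<le> (p + q - p * q / (p + q) * (1 - cos x))^2" .
  have "p * q * (1 - cos x) \<le> p * q * 2" using assms by (intro mult_left_mono) auto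
  also have "\<dots> \<le> (p + q)^2" using zero_le_power2[of p] zero_le_power2[of q] by (simp add: power2_sum)
  finally show "p + q - p * q / (p + q) * (1 - cos x) \<ge> 0"
    using assms by (simp add: field_simps power2_eq_square)
qed

text \<open>Only the terms of index \<open>a\<close> and \<open>d\<close> are allowed to cancel,
  through their phase difference \<open>(d - a) t\<close>; all others are replaced by their absolute
  values.\<close>

lemma Dl_circle_pair_bound:
  fixes x t :: real
  assumes "a \<in> D" "d \<in> D" "a < d" "x > 0"
  shows "norm (Dl D 0 (x * cis t)) \<le> Dl D 0 x - 
     (x ^ a / fact a) * (x ^ d / fact d) / (x ^ a / fact a + x ^ d / fact d) * (1 - cos ((real d - real a) * t))"
proof -
  define c where "c = (\<lambda>e. if e + 0 \<in> D then 1 / fact e else 0 :: real)"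
  define p q where "p = x ^ a / fact a" and "q = x ^ d / fact d"
  define z where "z = complex_of_real x * cis t"
  have pq: "p > 0" "q > 0" using assms by (auto simp: p_def q_def)
  define r where "r = (\<lambda>e. if e \<in> {a, d} then 0 else c e)"
  have sc: "summable (\<lambda>e. norm (of_real (c e) * z ^ e))"
    using Dl_summable_norm[of 0 D z] by (simp add: c_def if_distrib of_real_divide cong: if_cong)
  have sr: "summable (\<lambda>e. norm (of_real (r e) * z ^ e))"
    by (rule summable_comparison_test'[OF sc, of 0]) (auto simp: r_def)
  have D1: "Dl D 0 z = (\<Sum>e. of_real (c e) * z ^ e)"
    unfolding Dl_def c_def by (rule arg_cong[where f=suminf]) auto
  have split: "of_real (c e) * z ^ e = of_real (r e) * z ^ e + (if e = a then of_real (c e) * z ^ e else 0)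
      + (if e = d then of_real (c e) * z ^ e else 0)" for e
    using \<open>a < d\<close> by (auto simp: r_def)
  have zp: "of_real (c a) * z ^ a = of_real p * cis (a * t)" "of_real (c d) * z ^ d = of_real q * cis (d * t)"
    using assms unfolding z_def power_mult_distrib Complex.DeMoivre by (auto simp: c_def p_def q_def)
  have "(\<lambda>e. of_real (r e) * z ^ e + (if e = a then of_real (c e) * z ^ e else 0)
      + (if e = d then of_real (c e) * z ^ e else 0)) sums ((\<Sum>e. of_real (r e) * z ^ e) + of_real (c a) * z ^ a + of_real (c d) * z ^ d)"
    by (intro sums_add sums_single summable_sums summable_norm_cancel[OF sr])
  hence D2: "Dl D 0 z = (\<Sum>e. of_real (r e) * z ^ e) + (of_real p * cis (a * t) + of_real q * cis (d * t))"
    unfolding D1 split[symmetric] zp by (simp add: sums_iff algebra_simps)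
  have zn: "norm z = x" using assms by (simp add: z_def norm_mult)
  have sr': "summable (\<lambda>e. r e * x ^ e)"
  proof -
    have "norm (of_real (r e) * z ^ e) = r e * x ^ e" for e
      by (auto simp: norm_mult norm_power zn r_def c_def)
    thus ?thesis using sr by simp
  qed
  have "norm (\<Sum>e. of_real (r e) * z ^ e) \<le> (\<Sum>e. norm (of_real (r e) * z ^ e))"
    by (rule summable_norm[OF sr])
  also have "\<dots> = (\<Sum>e. r e * x ^ e)"
    by (rule arg_cong[where f=suminf]) (auto simp: fun_eq_iff norm_mult norm_power zn r_def c_def)
  also have "\<dots> = Dl D 0 x - p - q"
  proof -
    have "(\<lambda>e. r e * x ^ e + (if e = a then c e * x ^ e else 0)
      + (if e = d then c e * x ^ e else 0)) sums ((\<Sum>e. r e * x ^ e) + c a * x ^ a + c d * x ^ d)"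
      by (intro sums_add sums_single summable_sums sr')
    moreover have "c e * x ^ e = r e * x ^ e + (if e = a then c e * x ^ e else 0)
      + (if e = d then c e * x ^ e else 0)" for e using \<open>a < d\<close> by (auto simp: r_def)
    ultimately have "(\<lambda>e. c e * x ^ e) sums ((\<Sum>e. r e * x ^ e) + c a * x ^ a + c d * x ^ d)" by simp
    hence "Dl D 0 x = (\<Sum>e. r e * x ^ e) + c a * x ^ a + c d * x ^ d" unfolding Dl_def c_def by (simp add: sums_iff)
    thus ?thesis using assms by (simp add: c_def p_def q_def)
  qed
  finally have n1: "norm (\<Sum>e. of_real (r e) * z ^ e) \<le> Dl D 0 x - p - q" .
  have eq: "of_real p * cis (a * t) + of_real q * cis (d * t) = cis (a * t) * (of_real p + of_real q * cis ((real d - real a) * t))"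
    by (simp add: algebra_simps cis_mult)
  have n2: "norm (of_real p * cis (a * t) + of_real q * cis (d * t)) \<le> p + q - p * q / (p + q) * (1 - cos ((real d - real a) * t))"
    unfolding eq using norm_two_terms[OF pq] by (simp add: norm_mult)
  have "norm (Dl D 0 z) \<le> norm (\<Sum>e. of_real (r e) * z ^ e) + norm (of_real p * cis (a * t) + of_real q * cis (d * t))"
    unfolding D2 by (rule norm_triangle_ineq)
  thus ?thesis using n1 n2 by (simp add: p_def q_def z_def)
qed

text \<open>By \<open>cis_bezout\<close>, at each angle \<open>t\<close> some \<open>d\<close> in
  the finite set \<open>F\<close> keeps \<open>cis ((d - a) t)\<close> at a distance from 1
  proportional to |t|, and the pair of terms \<open>a\<close>, \<open>d\<close> then loses a
  quantity of order t^2. The constant is uniform over an interval of radii because the saddle point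
  moves with \<open>n\<close>.\<close>

lemma Dl_circle_decay:
  fixes D :: "nat set" and x1 x2 :: real
  assumes a: "a \<in> D" "\<And>d. d \<in> D \<Longrightarrow> a \<le> d" and gcd: "Gcd {d - a |d. d \<in> D} = 1"
    and x: "0 < x1" "x1 \<le> x2"
  obtains c where "c > 0" "\<And>x t. x1 \<le> x \<Longrightarrow> x \<le> x2 \<Longrightarrow> \<bar>t\<bar> \<le> pi \<Longrightarrow> 
     norm (Dl D 0 (of_real x * cis t)) \<le> Dl D 0 x * exp (- c * t\<^sup>2)"
proof -
  obtain C F where CF: "C > 0" "finite F" "F \<subseteq> D"
    "\<And>t::real. norm (cis t - 1) \<le> C * (\<Sum>d\<in>F. norm (cis ((real d - real a) * t) - 1))"
    using cis_bezout[OF a(2) gcd] by blast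
  define w where "w = (\<lambda>d (x::real). (x ^ a / fact a) * (x ^ d / fact d) / (x ^ a / fact a + x ^ d / fact d))"
  define M where "M = Dl D 0 x2"
  have M: "Dl D 0 x \<le> M" if "x1 \<le> x" "x \<le> x2" for x
    unfolding M_def Dl_def using that x
    by (intro suminf_le Dl_summable) (auto intro!: divide_right_mono power_mono)
  have "D \<noteq> {}" using a by auto
  hence "M > 0" using x unfolding M_def by (intro Dl_pos) auto
  have "\<exists>\<delta>>0. \<forall>x\<in>{x1..x2}. w d x \<ge> \<delta>" for d
  proof -
    have "continuous_on {x1..x2} (w d)"
      unfolding w_def using x by (auto intro!: continuous_intros simp: add_nonneg_eq_0_iff)
    then obtain y where y: "y \<in> {x1..x2}" "\<And>x. x \<in> {x1..x2} \<Longrightarrow> w d y \<le> w d x"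
      using continuous_attains_inf[of "{x1..x2}" "w d"] x by auto
    have "w d y > 0" unfolding w_def using x y(1) by (auto intro!: divide_pos_pos mult_pos_pos add_pos_pos)
    thus ?thesis using y(2) by (intro exI[of _ "w d y"]) auto
  qed
  then obtain \<delta> where \<delta>: "\<And>d. \<delta> d > 0" "\<And>d x. x \<in> {x1..x2} \<Longrightarrow> w d x \<ge> \<delta> d" by metis
  \<comment> \<open>If every \<open>d\<close> in \<open>F\<close> had norm below |t| / B, the bound
    of \<open>cis_bezout\<close> would fall below |t| / pi, against
    \<open>norm_cis_diff_one_ge\<close>. The \<open>+ 1\<close> makes this strict and keeps
    \<open>B\<close> positive when \<open>F\<close> is empty.\<close>
  define B where "B = pi * C * (real (card F) + 1)"
  have B: "B > 0" using CF by (simp add: B_def)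
  define \<eta> where "\<eta> = Min (insert 1 (\<delta> ` F))"
  have \<eta>: "\<eta> > 0" "\<And>d. d \<in> F \<Longrightarrow> \<eta> \<le> \<delta> d"
    unfolding \<eta>_def using CF(2) \<delta>(1) by (auto simp: Min_gr_iff)
  define c where "c = \<eta> / (2 * B\<^sup>2 * M)"
  have c: "c > 0" using \<eta> B \<open>M > 0\<close> by (simp add: c_def)
  have "norm (Dl D 0 (of_real x * cis t)) \<le> Dl D 0 x * exp (- c * t\<^sup>2)"
    if x': "x1 \<le> x" "x \<le> x2" and t: "\<bar>t\<bar> \<le> pi" for x t
  proof -
    have xp: "x > 0" using x x' by simp
    have "\<exists>d\<in>F. norm (cis ((real d - real a) * t) - 1) \<ge> \<bar>t\<bar> / B" if "t \<noteq> 0"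
    proof (rule ccontr)
      assume "\<not> ?thesis"
      hence "(\<Sum>d\<in>F. norm (cis ((real d - real a) * t) - 1)) \<le> (\<Sum>d\<in>F. \<bar>t\<bar> / B)"
        by (intro sum_mono) auto
      hence "C * (\<Sum>d\<in>F. norm (cis ((real d - real a) * t) - 1)) \<le> C * (card F * (\<bar>t\<bar> / B))"
        using CF(1) by (intro mult_left_mono) auto
      hence "norm (cis t - 1) \<le> C * (card F * (\<bar>t\<bar> / B))"
        using CF(4)[of t] by linarith
      also have "C * (card F * (\<bar>t\<bar> / B)) = \<bar>t\<bar> / pi * (real (card F) / (real (card F) + 1))"
        using CF(1) by (simp add: B_def divide_simps mult_ac add_nonneg_eq_0_iff)
      also have "\<dots> < \<bar>t\<bar> / pi * 1" using that by (intro mult_strict_left_mono) auto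
      finally show False using norm_cis_diff_one_ge[OF t] by simp
    qed
    moreover have ?thesis if d: "d \<in> F" "norm (cis ((real d - real a) * t) - 1) \<ge> \<bar>t\<bar> / B" "t \<noteq> 0" for d
    proof -
      have "\<bar>t\<bar> / B > 0" using d(3) B by simp
      hence "d \<noteq> a" using d(2) by auto
      hence ad: "a < d" using a(2)[of d] CF(3) d(1) by auto
      have "(\<bar>t\<bar> / B)^2 \<le> norm (cis ((real d - real a) * t) - 1)^2" using d B by (intro power_mono) auto
      hence tb: "t^2 / (2 * B^2) \<le> 1 - cos ((real d - real a) * t)"
        unfolding norm_cis_diff_one by (simp add: power_divide field_simps)
      have 1: "norm (Dl D 0 (of_real x * cis t)) \<le> Dl D 0 x - w d x * (1 - cos ((real d - real a) * t))"
        unfolding w_def using Dl_circle_pair_bound[of a D d x t] a(1) CF(3) d(1) ad xp by auto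
      have 2: "\<eta> * (t^2 / (2 * B^2)) \<le> w d x * (1 - cos ((real d - real a) * t))"
        using \<eta>(1) \<eta>(2)[OF d(1)] \<delta>(2)[of x d] x' tb B by (intro mult_mono) auto
      have 3: "\<eta> * (t^2 / (2 * B^2)) = M * (c * t^2)" using \<open>M > 0\<close> by (simp add: c_def)
      have 4: "Dl D 0 x * (c * t^2) \<le> M * (c * t^2)" using M[OF x'] c by (intro mult_right_mono) auto
      \<comment> \<open>\<open>M\<close> bounds \<Delta> on the whole interval, so the absolute loss
        M c t^2 is at least the relative loss c t^2.\<close>
      have "norm (Dl D 0 (of_real x * cis t)) \<le> Dl D 0 x * (1 + (- c * t^2))"
        using 1 2 3 4 by (simp add: algebra_simps)
      also have "\<dots> \<le> Dl D 0 x * exp (- c * t^2)" using xp by (intro mult_left_mono exp_ge_add_one_self Dl_nonneg) auto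
      finally show ?thesis .
    qed
    moreover have ?thesis if "t = 0" using that by (simp add: Dl_of_real Dl_nonneg xp less_imp_le)
    ultimately show ?thesis by blast
  qed
  thus ?thesis using that c by blast
qed

section \<open>The saddle point\<close>

text \<open>Under the weights x^d / d! on \<open>D\<close> this is the total deviation of
  \<open>d\<close> from \<open>c\<close>. Its zero in \<open>x\<close> is the saddle equation,
  written without a quotient.\<close>

lemma sums_mean_diff:
  fixes x c :: real
  shows "(\<lambda>d. (real d - c) * ((if d \<in> D then 1 / fact d else 0) * x ^ d)) sums (x * Dl D 1 x - c * Dl D 0 x)"
proof -
  have "(\<lambda>e. x * ((if e + 1 \<in> D then 1 / fact e else 0) * x ^ e)) sums (x * Dl D 1 x)"
    unfolding Dl_def by (intro sums_mult summable_sums Dl_summable)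
  moreover have "x * ((if e + 1 \<in> D then 1 / fact e else 0) * x ^ e) =
      real (Suc e) * ((if Suc e \<in> D then 1 / fact (Suc e) else 0) * x ^ Suc e)" for e
    by (simp add: field_simps del: of_nat_Suc)
  ultimately have "(\<lambda>e. real (Suc e) * ((if Suc e \<in> D then 1 / fact (Suc e) else 0) * x ^ Suc e)) sums (x * Dl D 1 x)"
    by (simp only:)
  hence "(\<lambda>e. real e * ((if e \<in> D then 1 / fact e else 0) * x ^ e)) sums (x * Dl D 1 x)"
    by (subst (asm) sums_Suc_iff) simp
  moreover have "(\<lambda>e. c * ((if e + 0 \<in> D then 1 / fact e else 0) * x ^ e)) sums (c * Dl D 0 x)"
    unfolding Dl_def by (intro sums_mult summable_sums Dl_summable)
  ultimately have "(\<lambda>e. real e * ((if e \<in> D then 1 / fact e else 0) * x ^ e) - c * ((if e + 0 \<in> D then 1 / fact e else 0) * x ^ e))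
     sums (x * Dl D 1 x - c * Dl D 0 x)" by (rule sums_diff)
  thus ?thesis by (simp add: left_diff_distrib)
qed

text \<open>Each term of \<open>\<Sum>(d - c) x\<^bsup>d - c\<^esup> / d!\<close> is nondecreasing in \<open>x\<close>.\<close>
lemma mean_diff_mono:
  fixes x y c :: real
  assumes D: "a \<in> D" "b \<in> D" "a \<noteq> b" and xy: "0 < x" "x < y"
  shows "(y / x) powr c * (x * Dl D 1 x - c * Dl D 0 x) < y * Dl D 1 y - c * Dl D 0 y"
proof -
  define u where "u = (\<lambda>d x. (if d \<in> D then 1 / fact d else 0) * x ^ d :: real)"
  define q where "q = y / x"
  have q: "q > 1" using xy by (simp add: q_def)
  define f where "f = (\<lambda>d. (real d - c) * u d y - q powr c * ((real d - c) * u d x))"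
  have sf: "f sums ((y * Dl D 1 y - c * Dl D 0 y) - q powr c * (x * Dl D 1 x - c * Dl D 0 x))"
    unfolding f_def u_def by (intro sums_diff sums_mult sums_mean_diff)
  have feq: "f d = u d x * ((real d - c) * (q powr d - q powr c))" for d
  proof -
    have "u d y = u d x * q powr d"
      using xy q by (simp add: u_def q_def powr_realpow power_divide)
    thus ?thesis by (simp add: f_def algebra_simps)
  qed
  have ge: "(real d - c) * (q powr d - q powr c) \<ge> 0" for d
  proof (cases "real d \<ge> c")
    case True thus ?thesis using q by (intro mult_nonneg_nonneg) (auto intro!: powr_mono)
  next
    case False thus ?thesis using q by (intro mult_nonpos_nonpos) (auto intro!: powr_mono)
  qed
  have fge: "f d \<ge> 0" for d unfolding feq using xy by (intro mult_nonneg_nonneg ge) (auto simp: u_def)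
  \<comment> \<open>Strict growth: of two elements of \<open>D\<close> at least one differs from
    \<open>c\<close>, and its term increases strictly.\<close>
  obtain d where d: "d \<in> D" "real d \<noteq> c" using D by (metis of_nat_eq_iff)
  have "q powr d \<noteq> q powr c" using powr_less_mono[of "real d" c q] powr_less_mono[of c "real d" q] d q by linarith
  hence "(real d - c) * (q powr d - q powr c) \<noteq> 0" using d by simp
  hence "(real d - c) * (q powr d - q powr c) > 0" using ge[of d] by linarith
  moreover have "u d x > 0" using d xy by (simp add: u_def)
  ultimately have "f d > 0" unfolding feq by (rule mult_pos_pos[rotated])
  hence "suminf f > 0" using fge sf by (intro suminf_pos2[where i=d]) (auto simp: sums_iff)
  thus ?thesis using sf by (simp add: sums_iff q_def)
qed

text \<open>Dividing by x^a, the lowest power present, leaves a power series with the negative value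
  (a - l) / a! at 0; by continuity the sign persists at small positive \<open>x\<close>.\<close>

lemma mean_diff_neg:
  assumes D: "a \<in> D" "\<And>d. d \<in> D \<Longrightarrow> a \<le> d" and l: "real a < l"
  shows "\<exists>x>0. x * Dl D 1 x - l * Dl D 0 x < 0"
proof -
  define c where "c = (\<lambda>e. (real (e + a) - l) * (if e + a \<in> D then 1 / fact (e + a) else 0))"
  have sums: "(\<lambda>e. x ^ a * (c e * x ^ e)) sums (x * Dl D 1 x - l * Dl D 0 x)" for x
  proof -
    have "(\<lambda>i. (real (i + a) - l) * ((if i + a \<in> D then 1 / fact (i + a) else 0) * x ^ (i + a))) sums
      (x * Dl D 1 x - l * Dl D 0 x - (\<Sum>i<a. (real i - l) * ((if i \<in> D then 1 / fact i else 0) * x ^ i)))"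
      by (subst sums_iff_shift) (simp only: diff_add_cancel sums_mean_diff)
    moreover have "(\<Sum>i<a. (real i - l) * ((if i \<in> D then 1 / fact i else 0) * x ^ i)) = 0"
      using D(2) by (intro sum.neutral) force
    ultimately show ?thesis by (simp add: c_def power_add mult_ac)
  qed
  have "summable (\<lambda>e. c e * 1 ^ e)" using sums[of 1] by (simp add: sums_iff)
  hence "isCont (\<lambda>x. \<Sum>e. c e * x ^ e) 0" by (rule isCont_powser) simp
  hence "((\<lambda>x. \<Sum>e. c e * x ^ e) \<longlongrightarrow> (\<Sum>e. c e * 0 ^ e)) (at_right 0)"
    by (simp add: isCont_def filterlim_at_split)
  moreover have "(\<Sum>e. c e * 0 ^ e) < 0" using D(1) l by (simp add: c_def divide_simps)
  ultimately have "eventually (\<lambda>x. (\<Sum>e. c e * x ^ e) < 0) (at_right 0)"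
    by (rule order_tendstoD)
  moreover have "eventually (\<lambda>x::real. x > 0) (at_right 0)" by (rule eventually_at_right_less)
  ultimately have "eventually (\<lambda>x. (\<Sum>e. c e * x ^ e) < 0 \<and> x > 0) (at_right 0)"
    by (rule eventually_conj)
  then obtain x where x: "x > 0" "(\<Sum>e. c e * x ^ e) < 0"
    using eventually_happens[of _ "at_right (0::real)"] by (auto simp: trivial_limit_at_right_real)
  have "summable (\<lambda>e. c e * x ^ e)" using sums[of x] x(1) by (simp add: sums_iff)
  hence "x * Dl D 1 x - l * Dl D 0 x = x ^ a * (\<Sum>e. c e * x ^ e)"
    using sums[of x] by (simp add: sums_iff suminf_mult)
  thus ?thesis using x by (intro exI[of _ x]) (simp add: mult_pos_neg)
qed

lemma mean_diff_pos:
  assumes D: "b \<in> D" and l: "0 \<le> l" "l < real b"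
  shows "\<exists>x>0. x * Dl D 1 x - l * Dl D 0 x > (0::real)"
proof -
  \<comment> \<open>\<open>x\<close> is so large that the term of index \<open>b\<close>, which is
    (b - l) x^b / b!, outweighs the \<open>b\<close> terms of lower index, each at least -l x^(b-1).
    The terms above \<open>b\<close> are nonnegative.\<close>
  define x where "x = max 1 ((l * b + 1) * fact b / (b - l))"
  have x: "x \<ge> 1" by (simp add: x_def)
  have b: "b \<ge> 1" using l by (cases b) auto
  define f where "f = (\<lambda>d. (real d - l) * ((if d \<in> D then 1 / fact d else 0) * x ^ d))"
  have sf: "f sums (x * Dl D 1 x - l * Dl D 0 x)" unfolding f_def by (rule sums_mean_diff)
  have "sum f {..b} \<le> suminf f"
    using sf l x by (intro sum_le_suminf) (auto simp: sums_iff f_def)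
  moreover have "sum f {..b} = sum f {..<b} + f b" by (simp add: lessThan_Suc_atMost[symmetric])
  moreover have "sum f {..<b} \<ge> (\<Sum>d<b. - l * x ^ (b - 1))"
  proof (rule sum_mono)
    fix d assume d: "d \<in> {..<b}"
    have "(if d \<in> D then 1 / fact d else 0) * x ^ d \<le> 1 * x ^ (b - 1)"
      using x d by (intro mult_mono power_increasing) (auto simp: divide_le_eq)
    hence "l * ((if d \<in> D then 1 / fact d else 0) * x ^ d) \<le> l * x ^ (b - 1)"
      using l by (intro mult_left_mono) auto
    moreover have "real d * ((if d \<in> D then 1 / fact d else 0) * x ^ d) \<ge> 0" using x by simp
    ultimately show "- l * x ^ (b - 1) \<le> f d" unfolding f_def left_diff_distrib by linarith
  qed
  moreover have "f b = (b - l) / fact b * x * x ^ (b - 1)"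
    using D b by (simp add: f_def power_eq_if)
  moreover have "(b - l) / fact b * x \<ge> l * b + 1"
  proof -
    have "x \<ge> (l * b + 1) * fact b / (b - l)" by (simp add: x_def)
    thus ?thesis using l by (simp add: field_simps)
  qed
  hence "(b - l) / fact b * x * x ^ (b - 1) \<ge> (l * b + 1) * x ^ (b - 1)"
    using x by (intro mult_right_mono) auto
  moreover have "x ^ (b - 1) > 0" using x by simp
  ultimately have "suminf f > 0" by (simp add: algebra_simps)
  thus ?thesis using sf x by (intro exI[of _ x]) (auto simp: sums_iff)
qed

text \<open>To the right of a point where \<open>G c\<close> is nonnegative it is positive, so it
  has at most one positive zero, and this is \<open>chi\<close>. The signs of \<open>G l\<close> on
  the two sides of its zero \<open>X\<close> are strict, hence persist for \<open>r n\<close> near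
  \<open>l\<close>, and the intermediate value theorem traps the zero of \<open>G (r n)\<close>
  between them.\<close>

lemma chi_tendsto:
  fixes D :: "nat set" and l :: real and r :: "nat \<Rightarrow> real"
  assumes two: "\<exists>a\<in>D. \<exists>b\<in>D. a \<noteq> b" and lo: "real (Inf D) < l" and hi: "finite D \<Longrightarrow> l < real (Max D)"
    and r: "r \<longlonglongrightarrow> l"
  obtains X where "X > 0" "(\<lambda>n. chi D (r n)) \<longlonglongrightarrow> X"
    "eventually (\<lambda>n. chi D (r n) > 0 \<and> chi D (r n) * Dl D 1 (chi D (r n)) = r n * Dl D 0 (chi D (r n))) sequentially"
proof -
  obtain a b where ab: "a \<in> D" "b \<in> D" "a \<noteq> b" using two by blast
  hence ne: "D \<noteq> {}" by auto
  have inf: "Inf D \<in> D" "\<And>d. d \<in> D \<Longrightarrow> Inf D \<le> d" using ne by (auto intro: Inf_nat_def1 cInf_lower)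
  have l0: "l \<ge> 0" using lo by simp
  define G where "G = (\<lambda>c x::real. x * Dl D 1 x - c * Dl D 0 x)"
  have Gmono: "G c y > 0" if "G c x \<ge> 0" "0 < x" "x < y" for c x y
  proof -
    have "(y / x) powr c * G c x \<ge> 0" using that by simp
    thus ?thesis using mean_diff_mono[OF ab that(2,3), of c] by (simp add: G_def)
  qed
  have cont: "continuous_on S (G c)" for S c unfolding G_def by (intro continuous_intros)
  obtain x1 where x1: "x1 > 0" "G l x1 < 0" using mean_diff_neg[OF inf lo] by (auto simp: G_def)
  have "\<exists>b\<in>D. l < real b"
  proof (cases "finite D")
    case True thus ?thesis using hi ne by (intro bexI[of _ "Max D"]) auto
  next
    case False
    then obtain b where "b \<in> D" "b > nat \<lceil>l\<rceil>" using infinite_nat_iff_unbounded by blast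
    thus ?thesis by (intro bexI[of _ b]) linarith+
  qed
  then obtain x2 where x2: "x2 > 0" "G l x2 > 0" using mean_diff_pos[of _ D l] l0 by (auto simp: G_def)
  have "x1 < x2"
    using Gmono[of l x2 x1] x1 x2 by (metis less_le_not_le linorder_not_le order.strict_iff_order)
  then obtain X where X: "x1 \<le> X" "X \<le> x2" "G l X = 0"
    using IVT'[of "G l" x1 0 x2] x1 x2 cont by auto
  have X0: "X > 0" using X x1 by simp
  have chi: "chi D c = x" if "x > 0" "G c x = 0" for c x
    unfolding chi_def deriv_Delta Delta_eq_Dl
  proof (rule the_equality)
    have P: "Dl D 0 y > 0" if "y > 0" for y :: real using Dl_pos[OF ne that] .
    show "0 < x \<and> x * Dl D 1 x / Dl D 0 x = c" using that P[of x] by (simp add: G_def field_simps)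
    fix y assume y: "0 < y \<and> y * Dl D 1 y / Dl D 0 y = c"
    hence "G c y = 0" using P[of y] by (auto simp: G_def field_simps)
    thus "y = x" using Gmono[of c x y] Gmono[of c y x] that y by (metis linorder_neqE_linordered_idom order.refl less_irrefl)
  qed
  have loc: "eventually (\<lambda>n. chi D (r n) \<in> {X - \<epsilon><..<X + \<epsilon>} \<and> chi D (r n) > 0 \<and> G (r n) (chi D (r n)) = 0) sequentially"
    if \<epsilon>: "0 < \<epsilon>" "\<epsilon> < X" for \<epsilon>
  proof -
    have lim: "(\<lambda>n. G (r n) x) \<longlonglongrightarrow> G l x" for x
      unfolding G_def using r by (intro tendsto_intros)
    have "G l (X - \<epsilon>) < 0" using Gmono[of l "X - \<epsilon>" X] X(3) \<epsilon> by force
    moreover have "G l (X + \<epsilon>) > 0" using Gmono[of l X "X + \<epsilon>"] X(3) \<epsilon> X0 by force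
    ultimately have "eventually (\<lambda>n. G (r n) (X - \<epsilon>) < 0 \<and> G (r n) (X + \<epsilon>) > 0) sequentially"
      using order_tendstoD[OF lim] by (intro eventually_conj) auto
    thus ?thesis
    proof eventually_elim
      case (elim n)
      then obtain x where x: "X - \<epsilon> \<le> x" "x \<le> X + \<epsilon>" "G (r n) x = 0"
        using IVT'[of "G (r n)" "X - \<epsilon>" 0 "X + \<epsilon>"] cont \<epsilon> by auto
      hence "x \<noteq> X - \<epsilon>" "x \<noteq> X + \<epsilon>" using elim by auto
      moreover have "x > 0" using x \<epsilon> by linarith
      ultimately show ?case using chi[OF _ x(3)] x by auto
    qed
  qed
  have "(\<lambda>n. chi D (r n)) \<longlonglongrightarrow> X"
  proof (rule tendstoI)
    fix e :: real assume e: "e > 0"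
    define \<epsilon> where "\<epsilon> = min e (X / 2)"
    have \<epsilon>: "0 < \<epsilon>" "\<epsilon> < X" "\<epsilon> \<le> e" using e X0 by (auto simp: \<epsilon>_def)
    show "eventually (\<lambda>n. dist (chi D (r n)) X < e) sequentially"
      using loc[OF \<epsilon>(1,2)] by eventually_elim (use \<epsilon> in \<open>auto simp: dist_real_def\<close>)
  qed
  moreover have "eventually (\<lambda>n. chi D (r n) > 0 \<and> chi D (r n) * Dl D 1 (chi D (r n)) = r n * Dl D 0 (chi D (r n))) sequentially"
    using loc[of "X/2"] X0 by (auto elim!: eventually_mono simp: G_def)
  ultimately show ?thesis using that X0 by blast
qed

text \<open>Divided by \<open>Dl D 0 x\<close>, this is the \<open>a\<close>-th factorial moment of
  the law with weights x^d / d! on \<open>D\<close>.\<close>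

definition Em :: "nat set \<Rightarrow> nat \<Rightarrow> 'a::{banach,real_normed_field} \<Rightarrow> 'a" where
  "Em D a z = z ^ a * Dl D a z"

lemma tendsto_Em:
  "(f \<longlongrightarrow> (x::'a::{banach,real_normed_field})) F \<Longrightarrow> ((\<lambda>t. Em D a (f t)) \<longlongrightarrow> Em D a x) F"
  unfolding Em_def by (intro tendsto_intros tendsto_Dl)

lemma Em_nonneg: "x \<ge> 0 \<Longrightarrow> Em D a (x::real) \<ge> 0"
  unfolding Em_def by (intro mult_nonneg_nonneg Dl_nonneg) auto

lemma Em_of_real: "Em D a (of_real x :: 'a::{banach,real_normed_field}) = of_real (Em D a x)"
  by (simp add: Em_def Dl_of_real)

lemma norm_Em_le: "norm (Em D a (z::'a::{banach,real_normed_field})) \<le> Em D a (norm z)"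
  unfolding Em_def norm_mult norm_power by (intro mult_left_mono norm_Dl_le) auto

lemma continuous_on_Em [continuous_intros]:
  "continuous_on S f \<Longrightarrow> continuous_on S (\<lambda>t. Em D a (f t :: 'a::{banach,real_normed_field}))"
  unfolding Em_def by (intro continuous_intros)

text \<open>Each vertex takes its own power z^(a v) into the factor \<open>Em\<close>. The power of
  \<open>x\<close> and the phase then involve only \<open>N\<close>, whatever \<open>a\<close> is,
  which makes the coefficients of different patterns comparable. The scale \<open>s\<close> will be
  \<open>sqrt n\<close>.\<close>

lemma coeff_scaled_integral:
  fixes a :: "'v \<Rightarrow> nat" and x :: real
  assumes V: "finite V" and r: "(\<Sum>v\<in>V. a v) \<le> N" and x: "x > 0" and s: "s > 0"
  shows "fps_nth (\<Prod>v\<in>V. egf D (a v)) (N - (\<Sum>v\<in>V. a v)) * x ^ N =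
    (\<integral>u. indicator {-(pi * s)..pi * s} u *\<^sub>R ((\<Prod>v\<in>V. Em D (a v) (x * cis (u / s))) * cis (- (N * (u / s)))) \<partial>lborel) / (2 * pi * s)"
proof -
  let ?r = "\<Sum>v\<in>V. a v"
  let ?f = "\<Prod>v\<in>V. egf D (a v)"
  have f: "fps_conv_radius ?f = \<infinity>" "\<And>z. eval_fps ?f z = (\<Prod>v\<in>V. Dl D (a v) z)"
    using eval_fps_prod[OF V, of "\<lambda>v. egf D (a v)"] by (auto simp: eval_egf)
  define G where "G = (\<lambda>t::real. indicator {-pi..pi} t *\<^sub>R ((\<Prod>v\<in>V. Em D (a v) (x * cis t)) * cis (- (N * t))))"
  have "fps_nth ?f (N - ?r) * x ^ N = x ^ ?r * (fps_nth ?f (N - ?r) * x ^ (N - ?r))"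
    using r by (simp add: power_add[symmetric])
  also have "\<dots> = (LINT t:{-pi..pi}|lborel. x ^ ?r * (eval_fps ?f (x * cis t) * cis (- (real (N - ?r) * t)))) / (2 * pi)"
    unfolding fps_nth_eq_integral[OF f(1) x] set_integral_mult_right by simp
  also have "(LINT t:{-pi..pi}|lborel. x ^ ?r * (eval_fps ?f (x * cis t) * cis (- (real (N - ?r) * t)))) = (\<integral>t. G t \<partial>lborel)"
    unfolding set_lebesgue_integral_def G_def
  proof (intro Bochner_Integration.integral_cong refl arg_cong2[where f=scaleR])
    fix t
    have "(\<Prod>v\<in>V. Em D (a v) (x * cis t)) = (x * cis t) ^ ?r * (\<Prod>v\<in>V. Dl D (a v) (x * cis t))"
      unfolding Em_def prod.distrib power_sum[symmetric] by simp
    moreover have "cis (- (real (N - ?r) * t)) = cis t ^ ?r * cis (- (N * t))"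
      unfolding Complex.DeMoivre cis_mult using r by (simp add: of_nat_diff algebra_simps)
    ultimately show "x ^ ?r * (eval_fps ?f (x * cis t) * cis (- (real (N - ?r) * t))) = (\<Prod>v\<in>V. Em D (a v) (x * cis t)) * cis (- (N * t))"
      unfolding f(2) by (simp add: power_mult_distrib mult_ac)
  qed
  also have "(\<integral>t. G t \<partial>lborel) = (1 / s) *\<^sub>R (\<integral>u. G (u / s) \<partial>lborel)"
    using lborel_integral_real_affine[of "1 / s" G 0] s by (simp add: field_simps)
  also have "(\<lambda>u. G (u / s)) = (\<lambda>u. indicator {-(pi * s)..pi * s} u *\<^sub>R ((\<Prod>v\<in>V. Em D (a v) (x * cis (u / s))) * cis (- (N * (u / s)))))"
    using s by (auto simp: G_def fun_eq_iff indicator_def field_simps)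
  finally show ?thesis by (simp add: scaleR_conv_of_real field_simps)
qed

section \<open>Gaussian and Taylor estimates\<close>

lemma integrable_exp_neg_square:
  assumes "c > 0" shows "integrable lborel (\<lambda>u::real. exp (- c * u\<^sup>2))"
proof -
  define \<sigma> where "\<sigma> = sqrt (1 / (2 * c))"
  have s: "\<sigma>\<^sup>2 = 1 / (2 * c)" "\<sigma> > 0" using assms by (auto simp: \<sigma>_def)
  have "integrable lborel (\<lambda>u. sqrt (2 * pi * \<sigma>\<^sup>2) * normal_density 0 \<sigma> u)"
    using s by (intro integrable_mult_right) auto
  moreover have "sqrt (2 * pi * \<sigma>\<^sup>2) * normal_density 0 \<sigma> u = exp (- c * u\<^sup>2)" for u
    using s assms by (simp add: normal_density_def field_simps)
  ultimately show ?thesis by (simp only:)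
qed

lemma cube_le_exp: "(x::real) \<ge> 0 \<Longrightarrow> x ^ 3 / 6 \<le> exp x"
proof -
  assume x: "x \<ge> 0"
  have "sum (\<lambda>n. x ^ n /\<^sub>R fact n) {3} \<le> (\<Sum>n. x ^ n /\<^sub>R fact n)"
    using x by (intro sum_le_suminf summable_exp_generic) auto
  thus ?thesis by (simp add: exp_def numeral_3_eq_3)
qed

lemma exp_neg_approx:
  assumes "(y::real) \<ge> 0" shows "\<bar>exp (- y) - (1 - y)\<bar> \<le> y\<^sup>2"
proof -
  have "exp (-y) \<ge> 1 - y" using exp_ge_add_one_self[of "-y"] by simp
  moreover have "exp (-y) * (1 + y) \<le> exp (-y) * exp y" using exp_ge_add_one_self[of y] by (intro mult_left_mono) auto
  hence "exp (-y) * (1 + y) \<le> 1" by (simp add: exp_minus)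
  moreover have "(1 - y + y^2) * (1 + y) \<ge> 1" using assms by (simp add: power2_eq_square algebra_simps)
  hence "exp (-y) * (1 + y) \<le> (1 - y + y^2) * (1 + y)" using calculation by linarith
  hence "exp (-y) \<le> 1 - y + y^2" using assms by (simp add: mult_le_cancel_right)
  ultimately show ?thesis by (simp add: abs_le_iff)
qed

lemma cis_taylor2: "norm (cis y - (1 + \<i> * y - y\<^sup>2 / 2)) \<le> \<bar>y\<bar> ^ 3 / 6"
proof -
  have "(\<Sum>k\<le>2. (\<i> * y)^k / fact k) = 1 + \<i> * y - y\<^sup>2 / 2"
  proof -
    have "{..2} = {0, 1, 2::nat}" by auto
    thus ?thesis by (simp add: power_mult_distrib)
  qed
  thus ?thesis using iexp_approx1[of y 2] by (simp add: cis_conv_exp numeral_3_eq_3 fact_numeral)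
qed

text \<open>The squares \<open>d\<^sup>2\<close> are split as \<open>d (d - 1) + d\<close>, the coefficients of the second and first derivatives.\<close>
lemma sums_second_moment:
  fixes x :: real
  shows "(\<lambda>d. (real d)\<^sup>2 * ((if d \<in> D then 1 / fact d else 0) * x ^ d)) sums (Em D 2 x + Em D 1 x)"
proof -
  have 1: "(\<lambda>d. (real d - 0) * ((if d \<in> D then 1 / fact d else 0) * x ^ d)) sums (x * Dl D 1 x - 0 * Dl D 0 x)"
    by (rule sums_mean_diff)
  have "(\<lambda>e. x^2 * ((if e + 2 \<in> D then 1 / fact e else 0) * x ^ e)) sums (x^2 * Dl D 2 x)"
    unfolding Dl_def by (intro sums_mult summable_sums Dl_summable)
  moreover have "x^2 * ((if e + 2 \<in> D then 1 / fact e else 0) * x ^ e) =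
      (real (e + 2) * (real (e + 2) - 1)) * ((if e + 2 \<in> D then 1 / fact (e + 2) else 0) * x ^ (e + 2))" for e
  proof -
    have "fact (e + 2) = real (e + 2) * (real (e + 2) - 1) * fact e"
      by (simp add: algebra_simps)
    moreover have "real (e + 2) * (real (e + 2) - 1) \<noteq> 0" by simp
    ultimately show ?thesis by (simp add: power_add power2_eq_square)
  qed
  ultimately have "(\<lambda>e. (real (e + 2) * (real (e + 2) - 1)) * ((if e + 2 \<in> D then 1 / fact (e + 2) else 0) * x ^ (e + 2))) sums (x^2 * Dl D 2 x)"
    by (simp only:)
  hence "(\<lambda>d. (real d * (real d - 1)) * ((if d \<in> D then 1 / fact d else 0) * x ^ d)) sums (x^2 * Dl D 2 x)"
    by (subst (asm) sums_iff_shift) (simp add: numeral_2_eq_2)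
  hence "(\<lambda>d. (real d * (real d - 1)) * ((if d \<in> D then 1 / fact d else 0) * x ^ d) +
      (real d - 0) * ((if d \<in> D then 1 / fact d else 0) * x ^ d)) sums (x^2 * Dl D 2 x + (x * Dl D 1 x - 0 * Dl D 0 x))"
    using 1 by (rule sums_add)
  thus ?thesis by (simp add: Em_def power2_eq_square algebra_simps)
qed

text \<open>Centring at the mean \<mu> removes the linear term, and \<open>V\<close> is the
  unnormalised variance. The cubic remainder is summed by means of |d - \<mu>|^3 / 6 \<le> exp |d -
  \<mu>| \<le> exp \<mu> exp d, which turns \<Delta> at \<open>x\<close> into \<Delta> at
  \<open>x * exp 1\<close>.\<close>

lemma centered_taylor:
  fixes x \<mu> \<theta> :: real
  assumes x: "x > 0" and \<mu>: "\<mu> \<ge> 0" "Em D 1 x = \<mu> * Dl D 0 x"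
  defines "V \<equiv> Em D 2 x + Em D 1 x - \<mu>\<^sup>2 * Dl D 0 x"
  shows "V \<ge> 0"
    and "norm (Dl D 0 (x * cis \<theta>) * cis (- (\<mu> * \<theta>)) - (Dl D 0 x - V * \<theta>\<^sup>2 / 2)) \<le> \<bar>\<theta>\<bar> ^ 3 * (exp \<mu> * Dl D 0 (x * exp 1))"
proof -
  define u where "u = (\<lambda>d. (if d \<in> D then 1 / fact d else 0) * x ^ d)"
  have u0: "u d \<ge> 0" for d using x by (simp add: u_def)
  have s0: "u sums Dl D 0 x" unfolding u_def Dl_def using summable_sums[OF Dl_summable[of 0 D x]] by simp
  have s1: "(\<lambda>d. (real d - \<mu>) * u d) sums 0"
    using sums_mean_diff[of \<mu> D x] \<mu>(2) by (simp add: u_def Em_def)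
  have s1': "(\<lambda>d. real d * u d) sums (\<mu> * Dl D 0 x)"
    using sums_mean_diff[of 0 D x] \<mu>(2) by (simp add: u_def Em_def)
  have "(\<lambda>d. (real d)\<^sup>2 * u d - 2 * \<mu> * (real d * u d) + \<mu>\<^sup>2 * u d) sums (Em D 2 x + Em D 1 x - 2 * \<mu> * (\<mu> * Dl D 0 x) + \<mu>\<^sup>2 * Dl D 0 x)"
    unfolding u_def by (intro sums_add sums_diff sums_mult sums_second_moment) (use s0 s1' in \<open>auto simp: u_def\<close>)
  hence s2: "(\<lambda>d. (real d - \<mu>)\<^sup>2 * u d) sums V"
    by (simp add: V_def power2_diff algebra_simps power2_eq_square)
  show "V \<ge> 0" using s2 u0 by (intro sums_le[OF _ sums_zero s2]) auto
  define h where "h = (\<lambda>d. of_real (u d) * (cis ((real d - \<mu>) * \<theta>) - (1 + \<i> * ((real d - \<mu>) * \<theta>) - ((real d - \<mu>) * \<theta>)\<^sup>2 / 2)))"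
  have hs: "h sums (Dl D 0 (x * cis \<theta>) * cis (- (\<mu> * \<theta>)) - (Dl D 0 x + \<i> * \<theta> * 0 - of_real (\<theta>\<^sup>2 / 2) * V))"
  proof -
    have A: "(\<lambda>d. of_real (u d) * cis ((real d - \<mu>) * \<theta>)) sums (Dl D 0 (x * cis \<theta>) * cis (- (\<mu> * \<theta>)))"
    proof -
      have "(\<lambda>d. ((if d + 0 \<in> D then 1 / fact d else 0) * (x * cis \<theta>) ^ d) * cis (- (\<mu> * \<theta>))) sums (Dl D 0 (x * cis \<theta>) * cis (- (\<mu> * \<theta>)))"
        unfolding Dl_def by (intro sums_mult2 summable_sums Dl_summable)
      moreover have "((if d + 0 \<in> D then 1 / fact d else 0) * (x * cis \<theta>) ^ d) * cis (- (\<mu> * \<theta>)) = of_real (u d) * cis ((real d - \<mu>) * \<theta>)" for d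
      proof -
        have "cis ((real d - \<mu>) * \<theta>) = cis \<theta> ^ d * cis (- (\<mu> * \<theta>))"
          unfolding Complex.DeMoivre cis_mult by (simp add: left_diff_distrib)
        thus ?thesis by (simp add: u_def power_mult_distrib)
      qed
      ultimately show ?thesis by (simp only:)
    qed
    have B: "(\<lambda>d. complex_of_real (u d)) sums of_real (Dl D 0 x)" using s0 by (rule sums_of_real)
    have C: "(\<lambda>d. \<i> * \<theta> * complex_of_real ((real d - \<mu>) * u d)) sums (\<i> * \<theta> * of_real 0)"
      by (intro sums_mult sums_of_real s1)
    have E: "(\<lambda>d. complex_of_real (\<theta>\<^sup>2 / 2) * complex_of_real ((real d - \<mu>)\<^sup>2 * u d)) sums (of_real (\<theta>\<^sup>2 / 2) * of_real V)"
      by (intro sums_mult sums_of_real s2)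
    have "(\<lambda>d. of_real (u d) * cis ((real d - \<mu>) * \<theta>) - (complex_of_real (u d) + \<i> * \<theta> * complex_of_real ((real d - \<mu>) * u d) - complex_of_real (\<theta>\<^sup>2 / 2) * complex_of_real ((real d - \<mu>)\<^sup>2 * u d)))
      sums (Dl D 0 (x * cis \<theta>) * cis (- (\<mu> * \<theta>)) - (of_real (Dl D 0 x) + \<i> * \<theta> * of_real 0 - of_real (\<theta>\<^sup>2 / 2) * of_real V))"
      by (intro sums_diff sums_add A B C E)
    moreover have "of_real (u d) * cis ((real d - \<mu>) * \<theta>) - (complex_of_real (u d) + \<i> * \<theta> * complex_of_real ((real d - \<mu>) * u d) - complex_of_real (\<theta>\<^sup>2 / 2) * complex_of_real ((real d - \<mu>)\<^sup>2 * u d)) = h d" for d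
    proof -
      have "of_real v * c - (complex_of_real v + \<i> * \<theta> * complex_of_real (a * v) - complex_of_real (\<theta>\<^sup>2 / 2) * complex_of_real (a\<^sup>2 * v))
        = of_real v * (c - (1 + \<i> * (a * \<theta>) - (a * \<theta>)\<^sup>2 / 2))" for a v :: real and c
        by (simp add: algebra_simps power_mult_distrib)
      thus ?thesis unfolding h_def .
    qed
    ultimately show ?thesis by simp
  qed
  define b where "b = (\<lambda>d. \<bar>\<theta>\<bar> ^ 3 * exp \<mu> * ((if d + 0 \<in> D then 1 / fact d else 0) * (x * exp 1) ^ d))"
  have bs: "b sums (\<bar>\<theta>\<bar> ^ 3 * exp \<mu> * Dl D 0 (x * exp 1))"
    unfolding b_def Dl_def by (intro sums_mult summable_sums Dl_summable)
  have hb: "norm (h d) \<le> b d" for d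
  proof -
    have "norm (h d) \<le> u d * (\<bar>(real d - \<mu>) * \<theta>\<bar> ^ 3 / 6)"
      unfolding h_def norm_mult using u0[of d] cis_taylor2[of "(real d - \<mu>) * \<theta>"] by (intro mult_mono) auto
    also have "\<dots> = u d * \<bar>\<theta>\<bar> ^ 3 * (\<bar>real d - \<mu>\<bar> ^ 3 / 6)" by (simp add: abs_mult power_mult_distrib)
    also have "\<dots> \<le> u d * \<bar>\<theta>\<bar> ^ 3 * exp (\<bar>real d - \<mu>\<bar>)"
      using u0[of d] by (intro mult_left_mono cube_le_exp) auto
    also have "\<dots> \<le> u d * \<bar>\<theta>\<bar> ^ 3 * exp (\<mu> + real d)"
      using u0[of d] \<mu>(1) by (intro mult_left_mono) auto
    also have "\<dots> = b d" by (simp add: b_def u_def exp_add power_mult_distrib exp_of_nat_mult[symmetric])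
    finally show ?thesis .
  qed
  have sb: "summable b" using bs by (rule sums_summable)
  have sn: "summable (\<lambda>d. norm (h d))" 
    by (rule summable_comparison_test'[OF sb, of 0]) (simp add: hb)
  have "norm (suminf h) \<le> (\<Sum>d. norm (h d))" by (rule summable_norm[OF sn])
  also have "\<dots> \<le> suminf b" by (rule suminf_le[OF hb sn sb])
  finally show "norm (Dl D 0 (x * cis \<theta>) * cis (- (\<mu> * \<theta>)) - (Dl D 0 x - V * \<theta>\<^sup>2 / 2)) \<le> \<bar>\<theta>\<bar> ^ 3 * (exp \<mu> * Dl D 0 (x * exp 1))"
    unfolding sums_unique[OF hs, symmetric] sums_unique[OF bs, symmetric] by (simp add: mult_ac)
qed

section \<open>Coefficient asymptotics\<close>

text \<open>\<open>N\<close> is the total degree. The saddle equation is imposed at every large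
  \<open>n\<close> and not only in the limit: at the angle u / sqrt n, an error \<delta> in the mean
  would shift the phase of an \<open>n\<close>-th power by about \<delta> u sqrt n.\<close>

locale coeff_seq =
  fixes D :: "nat set" and N :: "nat \<Rightarrow> nat" and x :: "nat \<Rightarrow> real" and X :: real
  assumes D_ne: "D \<noteq> {}" and D_gcd: "Gcd {d - Inf D |d. d \<in> D} = 1"
    and X_pos: "X > 0" and x_lim: "x \<longlonglongrightarrow> X" and N_lim: "filterlim N at_top sequentially"
    and saddle: "eventually (\<lambda>n. x n > 0 \<and> Em D 1 (x n) = real (N n) / real n * Dl D 0 (x n)) sequentially"
begin

text \<open>Mean, second factorial moment and variance of the law with weights X^d / d! on
  \<open>D\<close>. Despite its letter, \<open>\<sigma>\<close> is a variance.\<close>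

definition \<mu> where "\<mu> = Em D 1 X / Dl D 0 X"
definition \<kappa> where "\<kappa> = Em D 2 X / Dl D 0 X"
definition \<sigma> where "\<sigma> = \<kappa> + \<mu> - \<mu>\<^sup>2"

lemma Dl_X: "Dl D 0 X > 0" using Dl_pos[OF D_ne X_pos] .

lemma eventually_good:
  "eventually (\<lambda>n. n \<ge> n0 \<and> N n \<ge> r \<and> x n > 0 \<and> Dl D 0 (x n) > 0 \<and> X / 2 \<le> x n \<and> x n \<le> 2 * X \<and>
      Em D 1 (x n) = real (N n) / real n * Dl D 0 (x n)) sequentially"
proof -
  have "eventually (\<lambda>n. N n \<ge> r) sequentially" using N_lim by (simp add: filterlim_at_top)
  moreover have "eventually (\<lambda>n. x n > X / 2) sequentially" "eventually (\<lambda>n. x n < 2 * X) sequentially"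
    using order_tendstoD(1)[OF x_lim, of "X / 2"] order_tendstoD(2)[OF x_lim, of "2 * X"] X_pos by auto
  ultimately show ?thesis using saddle eventually_ge_at_top[of n0]
    by eventually_elim (use Dl_pos[OF D_ne] in auto)
qed

lemma tendsto_ratio: "(\<lambda>n. Em D a (x n) / Dl D 0 (x n)) \<longlonglongrightarrow> Em D a X / Dl D 0 X"
  using Dl_X by (intro tendsto_intros tendsto_Em tendsto_Dl x_lim) auto

lemma tendsto_mu: "(\<lambda>n. real (N n) / real n) \<longlonglongrightarrow> \<mu>"
proof (rule Lim_transform_eventually)
  show "(\<lambda>n. Em D 1 (x n) / Dl D 0 (x n)) \<longlonglongrightarrow> \<mu>" unfolding \<mu>_def by (rule tendsto_ratio)
  show "eventually (\<lambda>n. Em D 1 (x n) / Dl D 0 (x n) = real (N n) / real n) sequentially"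
    using eventually_good[of 0 0] by eventually_elim auto
qed

lemma inv_sqrt_lim: "(\<lambda>n. a / sqrt (real n)) \<longlonglongrightarrow> 0"
  by (intro real_tendsto_divide_at_top[OF tendsto_const] filterlim_compose[OF sqrt_at_top filterlim_real_sequentially])

lemma tendsto_circle: "(\<lambda>n. complex_of_real (x n) * cis (u / sqrt n)) \<longlonglongrightarrow> complex_of_real X"
proof -
  have "(\<lambda>n. complex_of_real (x n) * exp (\<i> * of_real (u / sqrt n))) \<longlonglongrightarrow> complex_of_real X * exp (\<i> * of_real 0)"
    by (intro tendsto_intros x_lim inv_sqrt_lim)
  thus ?thesis by (simp add: cis_conv_exp)
qed

lemma tendsto_ratio_circle:
  "(\<lambda>n. Em D a (complex_of_real (x n) * cis (u / sqrt n)) / complex_of_real (Dl D 0 (x n))) \<longlonglongrightarrow> of_real (Em D a X / Dl D 0 X)"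
  unfolding of_real_divide Em_of_real[symmetric]
  using Dl_X by (intro tendsto_divide tendsto_Em tendsto_circle tendsto_of_real tendsto_Dl x_lim) auto

text \<open>The central limit theorem for the degrees weighted by \<open>x^d / d!\<close>, on characteristic functions.\<close>
lemma tendsto_gaussian:
  "(\<lambda>n. (Dl D 0 (complex_of_real (x n) * cis (u / sqrt n)) / complex_of_real (Dl D 0 (x n))) ^ n * cis (- (N n * (u / sqrt n))))
     \<longlonglongrightarrow> complex_of_real (exp (- (\<sigma> * u\<^sup>2 / 2)))"
proof -
  define F where "F = (\<lambda>n. Dl D 0 (x n))"
  define \<theta> where "\<theta> = (\<lambda>n. u / sqrt (real n))"
  define m where "m = (\<lambda>n. real (N n) / real n)"
  define s where "s = (\<lambda>n. (Em D 2 (x n) + Em D 1 (x n) - (m n)\<^sup>2 * F n) / F n)"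
  define B where "B = (\<lambda>n. exp (m n) * Dl D 0 (x n * exp 1) / F n)"
  define y where "y = (\<lambda>n. Dl D 0 (complex_of_real (x n) * cis (\<theta> n)) / complex_of_real (F n) * cis (- (m n * \<theta> n)))"
  define w where "w = (\<lambda>n. exp (- (s n * (\<theta> n)\<^sup>2 / 2)))"
  have s_lim: "s \<longlonglongrightarrow> \<sigma>"
  proof (rule Lim_transform_eventually)
    show "(\<lambda>n. Em D 2 (x n) / Dl D 0 (x n) + Em D 1 (x n) / Dl D 0 (x n) - (m n)\<^sup>2) \<longlonglongrightarrow> \<sigma>"
      unfolding \<sigma>_def \<kappa>_def m_def using tendsto_ratio[of 2] tendsto_ratio[of 1] tendsto_mu
      by (intro tendsto_diff tendsto_add tendsto_power) (auto simp: \<mu>_def)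
    show "eventually (\<lambda>n. Em D 2 (x n) / Dl D 0 (x n) + Em D 1 (x n) / Dl D 0 (x n) - (m n)\<^sup>2 = s n) sequentially"
      using eventually_good[of 0 0] by eventually_elim (auto simp: s_def F_def field_simps)
  qed
  have B_lim: "B \<longlonglongrightarrow> exp \<mu> * Dl D 0 (X * exp 1) / Dl D 0 X"
    unfolding B_def F_def m_def using Dl_X by (intro tendsto_intros tendsto_Dl x_lim tendsto_mu) auto
  have bound: "eventually (\<lambda>n. norm (y n ^ n - complex_of_real (w n) ^ n) \<le> \<bar>u\<bar> ^ 3 * B n / sqrt n + (s n * u\<^sup>2 / 2)\<^sup>2 / n) sequentially"
    using eventually_good[of 1 0]
  proof eventually_elim
    case (elim n)
    hence F: "F n > 0" and n: "n \<ge> 1" "x n > 0" and m: "m n \<ge> 0" "Em D 1 (x n) = m n * Dl D 0 (x n)"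
      by (auto simp: F_def m_def)
    note ct = centered_taylor[OF n(2) m]
    have s0: "s n \<ge> 0" using ct(1) F by (simp add: s_def F_def)
    have "norm (Dl D 0 (complex_of_real (x n) * cis (\<theta> n))) \<le> F n"
      using norm_Dl_le[of D 0 "complex_of_real (x n) * cis (\<theta> n)"] n by (simp add: norm_mult F_def)
    hence y1: "norm (y n) \<le> 1" using F by (simp add: y_def norm_mult norm_divide)
    have w1: "norm (complex_of_real (w n)) \<le> 1" using s0 by (simp add: w_def)
    have "y n - (1 - s n * (\<theta> n)\<^sup>2 / 2) = 
      (Dl D 0 (x n * cis (\<theta> n)) * cis (- (m n * \<theta> n)) - (Dl D 0 (x n) - (Em D 2 (x n) + Em D 1 (x n) - (m n)\<^sup>2 * Dl D 0 (x n)) * (\<theta> n)\<^sup>2 / 2)) / complex_of_real (F n)"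
      using F by (simp add: y_def s_def F_def field_simps)
    hence "norm (y n - (1 - s n * (\<theta> n)\<^sup>2 / 2)) \<le> (\<bar>\<theta> n\<bar> ^ 3 * (exp (m n) * Dl D 0 (x n * exp 1))) / F n"
      using ct(2)[of "\<theta> n"] F by (simp only: norm_divide norm_of_real) (simp add: divide_right_mono)
    hence 1: "norm (y n - (1 - s n * (\<theta> n)\<^sup>2 / 2)) \<le> \<bar>\<theta> n\<bar> ^ 3 * B n" by (simp add: B_def)
    have "norm (complex_of_real (w n) - (1 - s n * (\<theta> n)\<^sup>2 / 2)) = \<bar>w n - (1 - s n * (\<theta> n)\<^sup>2 / 2)\<bar>"
      by (metis norm_of_real of_real_diff of_real_1)
    also have "\<dots> \<le> (s n * (\<theta> n)\<^sup>2 / 2)\<^sup>2" unfolding w_def using s0 by (intro exp_neg_approx) auto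
    finally have 2: "norm (complex_of_real (w n) - (1 - s n * (\<theta> n)\<^sup>2 / 2)) \<le> (s n * (\<theta> n)\<^sup>2 / 2)\<^sup>2" .
    have 3: "norm (y n - complex_of_real (w n)) \<le> \<bar>\<theta> n\<bar> ^ 3 * B n + (s n * (\<theta> n)\<^sup>2 / 2)\<^sup>2"
      using norm_triangle_ineq4[of "y n - (1 - s n * (\<theta> n)\<^sup>2 / 2)" "complex_of_real (w n) - (1 - s n * (\<theta> n)\<^sup>2 / 2)"] 1 2 by simp
    \<comment> \<open>Both bases lie in the unit disc, so the powers differ by at most
      \<open>n\<close> times the distance of the bases, which is of order n^(-3/2).\<close>
    have "norm (y n ^ n - complex_of_real (w n) ^ n) \<le> n * norm (y n - complex_of_real (w n))"
      by (rule norm_power_diff[OF y1 w1])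
    also have "\<dots> \<le> n * (\<bar>\<theta> n\<bar> ^ 3 * B n + (s n * (\<theta> n)\<^sup>2 / 2)\<^sup>2)" using 3 by (intro mult_left_mono) auto
    also have "\<dots> = \<bar>u\<bar> ^ 3 * B n / sqrt n + (s n * u\<^sup>2 / 2)\<^sup>2 / n"
    proof -
      have "\<bar>\<theta> n\<bar> ^ 3 = \<bar>u\<bar> ^ 3 / (n * sqrt n)" using n by (simp add: \<theta>_def power_divide power3_eq_cube)
      moreover have "(\<theta> n)\<^sup>2 = u\<^sup>2 / n" by (simp add: \<theta>_def power_divide)
      ultimately show ?thesis using n by (simp add: power_mult_distrib power_divide distrib_left power2_eq_square)
    qed
    finally show ?case .
  qed
  have "(\<lambda>n. \<bar>u\<bar> ^ 3 * B n / sqrt n + (s n * u\<^sup>2 / 2)\<^sup>2 / n) \<longlonglongrightarrow> 0 + 0"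
    by (intro tendsto_add real_tendsto_divide_at_top[OF tendsto_mult[OF tendsto_const B_lim]]
        real_tendsto_divide_at_top[OF tendsto_power[OF tendsto_divide[OF tendsto_mult[OF s_lim tendsto_const] tendsto_const]]]
        filterlim_compose[OF sqrt_at_top filterlim_real_sequentially] filterlim_real_sequentially) auto
  hence "(\<lambda>n. y n ^ n - complex_of_real (w n) ^ n) \<longlonglongrightarrow> 0"
    using Lim_null_comparison[OF bound] by simp
  moreover have "(\<lambda>n. complex_of_real (w n) ^ n) \<longlonglongrightarrow> complex_of_real (exp (- (\<sigma> * u\<^sup>2 / 2)))"
  proof (rule Lim_transform_eventually)
    show "(\<lambda>n. complex_of_real (exp (- (s n * u\<^sup>2 / 2)))) \<longlonglongrightarrow> complex_of_real (exp (- (\<sigma> * u\<^sup>2 / 2)))"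
      by (intro tendsto_intros s_lim) auto
    show "eventually (\<lambda>n. complex_of_real (exp (- (s n * u\<^sup>2 / 2))) = complex_of_real (w n) ^ n) sequentially"
      using eventually_gt_at_top[of 0]
    proof eventually_elim
      case (elim n)
      have "w n ^ n = exp (n * (- (s n * (\<theta> n)\<^sup>2 / 2)))" by (simp add: w_def exp_of_nat_mult[symmetric])
      also have "n * (- (s n * (\<theta> n)\<^sup>2 / 2)) = - (s n * u\<^sup>2 / 2)" using elim by (simp add: \<theta>_def power_divide)
      finally show ?case by (simp flip: of_real_power)
    qed
  qed
  ultimately have "(\<lambda>n. (y n ^ n - complex_of_real (w n) ^ n) + complex_of_real (w n) ^ n) \<longlonglongrightarrow> 0 + complex_of_real (exp (- (\<sigma> * u\<^sup>2 / 2)))"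
    by (rule tendsto_add)
  hence lim: "(\<lambda>n. y n ^ n) \<longlonglongrightarrow> complex_of_real (exp (- (\<sigma> * u\<^sup>2 / 2)))" by simp
  show ?thesis
  proof (rule Lim_transform_eventually[OF lim])
    show "eventually (\<lambda>n. y n ^ n = (Dl D 0 (complex_of_real (x n) * cis (u / sqrt n)) / complex_of_real (Dl D 0 (x n))) ^ n * cis (- (N n * (u / sqrt n)))) sequentially"
      using eventually_gt_at_top[of 0]
    proof eventually_elim
      case (elim n)
      have "real n * - (m n * \<theta> n) = - (N n * (u / sqrt n))"
        using elim by (simp add: m_def \<theta>_def)
      hence "cis (- (m n * \<theta> n)) ^ n = cis (- (N n * (u / sqrt n)))"
        unfolding Complex.DeMoivre by (simp only:)
      thus ?case by (simp only: y_def power_mult_distrib F_def \<theta>_def)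
    qed
  qed
qed

text \<open>At most \<open>r\<close> vertices have \<open>a v\<close> nonzero, and their factors are
  bounded by \<open>K\<close> after division by \<Delta>. The other factors number at least n / 2
  and each carries exp (- c u^2 / n), so the product decays like a Gaussian in \<open>u\<close>,
  uniformly in the pattern \<open>a\<close>.\<close>

lemma prod_bound:
  obtains c K where "c > 0" "K \<ge> 1" 
   "eventually (\<lambda>n. \<forall>a u. (\<Sum>v=1..n. a v) = r \<longrightarrow> \<bar>u\<bar> \<le> pi * sqrt n \<longrightarrow>
     norm (\<Prod>v=1..n. Em D (a v) (complex_of_real (x n) * cis (u / sqrt n))) \<le> Dl D 0 (x n) ^ n * K * exp (- c * u\<^sup>2)) sequentially"
proof -
  have inf: "Inf D \<in> D" "\<And>d. d \<in> D \<Longrightarrow> Inf D \<le> d" using D_ne by (auto intro: Inf_nat_def1 cInf_lower)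
  obtain c where c: "c > 0" "\<And>x t. X / 2 \<le> x \<Longrightarrow> x \<le> 2 * X \<Longrightarrow> \<bar>t\<bar> \<le> pi \<Longrightarrow> 
     norm (Dl D 0 (of_real x * cis t)) \<le> Dl D 0 x * exp (- c * t\<^sup>2)"
    using Dl_circle_decay[OF inf D_gcd, of "X / 2" "2 * X"] X_pos by auto
  \<comment> \<open>Each limit is raised by 1 so that the bound is strict there and hence valid at
    \<open>x n\<close> for large \<open>n\<close>; the leading 1 gives \<open>K \<ge> 1\<close>, so
    that powers of \<open>K\<close> grow with the exponent.\<close>
  define K where "K = 1 + (\<Sum>a\<le>r. Em D a X / Dl D 0 X + 1)"
  have Ka: "Em D a X / Dl D 0 X < K" if "a \<le> r" for a
  proof -
    have "Em D a X / Dl D 0 X + 1 \<le> (\<Sum>a\<le>r. Em D a X / Dl D 0 X + 1)"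
      using that Dl_X X_pos by (intro member_le_sum) (auto intro!: add_nonneg_nonneg divide_nonneg_nonneg Em_nonneg)
    thus ?thesis by (simp add: K_def)
  qed
  have K1: "K \<ge> 1" unfolding K_def using Dl_X X_pos
    by (auto intro!: sum_nonneg add_nonneg_nonneg divide_nonneg_nonneg Em_nonneg)
  have "eventually (\<lambda>n. \<forall>a\<in>{..r}. Em D a (x n) / Dl D 0 (x n) < K) sequentially"
    using Ka by (intro eventually_ball_finite ballI order_tendstoD(2)[OF tendsto_ratio]) auto
  with eventually_good[of "2 * r + 1" 0]
  have "eventually (\<lambda>n. \<forall>a u. (\<Sum>v=1..n. a v) = r \<longrightarrow> \<bar>u\<bar> \<le> pi * sqrt n \<longrightarrow>
     norm (\<Prod>v=1..n. Em D (a v) (complex_of_real (x n) * cis (u / sqrt n))) \<le> Dl D 0 (x n) ^ n * K ^ r * exp (- (c / 2) * u\<^sup>2)) sequentially"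
  proof eventually_elim
    case (elim n)
    define F where "F = Dl D 0 (x n)"
    have F: "F > 0" using elim by (simp add: F_def)
    show ?case
    proof (intro allI impI)
      fix a :: "nat \<Rightarrow> nat" and u :: real
      assume ar: "(\<Sum>v=1..n. a v) = r" and u: "\<bar>u\<bar> \<le> pi * sqrt n"
      define t where "t = u / sqrt n"
      have n0: "n > 0" using elim by simp
      have t: "\<bar>t\<bar> \<le> pi" using u n0 by (simp add: t_def field_simps)
      define S where "S = {v\<in>{1..n}. a v \<noteq> 0}"
      define f where "f = (\<lambda>v. if v \<in> S then K else exp (- c * t\<^sup>2))"
      have "card S = (\<Sum>v\<in>S. 1)" by simp
      also have "\<dots> \<le> (\<Sum>v\<in>S. a v)" by (intro sum_mono) (auto simp: S_def)
      also have "\<dots> \<le> r" unfolding ar[symmetric] by (intro sum_mono2) (auto simp: S_def)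
      finally have cS: "card S \<le> r" .
      have "norm (Em D (a v) (complex_of_real (x n) * cis t)) \<le> F * f v" if v: "v \<in> {1..n}" for v
      proof (cases "a v = 0")
        case True
        thus ?thesis using c(2)[of "x n" t] elim t by (simp add: Em_def f_def S_def F_def)
      next
        case False
        have "a v \<le> (\<Sum>v=1..n. a v)" using v by (intro member_le_sum) auto
        hence "Em D (a v) (x n) / F < K" using elim ar by (auto simp: F_def)
        hence "Em D (a v) (x n) \<le> F * K" using F by (simp add: field_simps)
        moreover have "norm (Em D (a v) (complex_of_real (x n) * cis t)) \<le> Em D (a v) (x n)"
          using norm_Em_le[of D "a v" "complex_of_real (x n) * cis t"] elim by (simp add: norm_mult)
        ultimately show ?thesis using False v by (simp add: f_def S_def)
      qed
      hence "norm (\<Prod>v=1..n. Em D (a v) (complex_of_real (x n) * cis t)) \<le> (\<Prod>v=1..n. F * f v)"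
        unfolding prod_norm[symmetric] by (intro prod_mono) auto
      also have "\<dots> = F ^ n * (\<Prod>v=1..n. f v)" by (simp add: prod.distrib)
      also have "(\<Prod>v=1..n. f v) = K ^ card S * exp (- c * t\<^sup>2) ^ (n - card S)"
      proof -
        have "{1..n} \<inter> S = S" "{1..n} \<inter> - S = {1..n} - S" by (auto simp: S_def)
        moreover have "card ({1..n} - S) = n - card S" by (subst card_Diff_subset) (auto simp: S_def)
        ultimately show ?thesis unfolding f_def by (simp add: prod.If_cases)
      qed
      also have "\<dots> \<le> K ^ r * exp (- (c / 2) * u\<^sup>2)"
      proof (intro mult_mono power_increasing cS K1)
        have "real n / 2 \<le> real (n - card S)" using cS elim by linarith
        hence "(c * t\<^sup>2) * (real n / 2) \<le> (c * t\<^sup>2) * real (n - card S)"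
          using c by (intro mult_left_mono) auto
        moreover have "(c * t\<^sup>2) * (real n / 2) = c / 2 * u\<^sup>2" using n0 by (simp add: t_def power_divide)
        ultimately have "real (n - card S) * (- c * t\<^sup>2) \<le> - (c / 2) * u\<^sup>2" by (simp only: mult_ac)
        thus "exp (- c * t\<^sup>2) ^ (n - card S) \<le> exp (- (c / 2) * u\<^sup>2)"
          unfolding exp_of_nat_mult[symmetric] exp_le_cancel_iff .
      qed (use K1 in auto)
      finally show "norm (\<Prod>v=1..n. Em D (a v) (complex_of_real (x n) * cis (u / sqrt n))) \<le> Dl D 0 (x n) ^ n * K ^ r * exp (- (c / 2) * u\<^sup>2)"
        using F by (simp add: F_def t_def mult_left_mono mult.assoc)
    qed
  qed
  thus ?thesis using that[of "c / 2" "K ^ r"] c K1 by (auto simp: one_le_power)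
qed


section \<open>Coefficients as integrals over the rescaled angle, and their limits\<close>

definition coeff :: "nat \<Rightarrow> (nat \<Rightarrow> nat) \<Rightarrow> complex" where
  "coeff n a = fps_nth (\<Prod>v=1..n. egf D (a v)) (N n - (\<Sum>v=1..n. a v))"

definition integrand :: "nat \<Rightarrow> (nat \<Rightarrow> nat) \<Rightarrow> real \<Rightarrow> complex" where
  "integrand n a u = indicator {-(pi * sqrt n)..pi * sqrt n} u *\<^sub>R
     ((\<Prod>v=1..n. Em D (a v) (complex_of_real (x n) * cis (u / sqrt n))) * cis (- (N n * (u / sqrt n))) / complex_of_real (Dl D 0 (x n)) ^ n)"

lemma integrable_integrand: "integrable lborel (integrand n a)"
  unfolding integrand_def
  by (rule borel_integrable_compact) (auto intro!: continuous_intros simp: divide_inverse)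

lemma norm_integrand_le:
  assumes "Dl D 0 (x n) > 0" "B \<ge> 0"
    and "\<bar>u\<bar> \<le> pi * sqrt n \<Longrightarrow>
      norm (\<Prod>v=1..n. Em D (a v) (complex_of_real (x n) * cis (u / sqrt n))) \<le> Dl D 0 (x n) ^ n * B"
  shows "norm (integrand n a u) \<le> B"
proof (cases "\<bar>u\<bar> \<le> pi * sqrt n")
  case True
  have "norm (integrand n a u) = norm (\<Prod>v=1..n. Em D (a v) (complex_of_real (x n) * cis (u / sqrt n))) / Dl D 0 (x n) ^ n"
    using True assms(1) by (simp add: integrand_def norm_mult norm_divide norm_power indicator_def abs_le_iff)
  also have "\<dots> \<le> B"
    using assms(3)[OF True] assms(1) by (simp add: divide_le_eq mult.commute)
  finally show ?thesis .
next
  case False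
  thus ?thesis using assms(2) by (auto simp: integrand_def indicator_def)
qed

lemma coeff_eq:
  assumes "n > 0" "x n > 0" "Dl D 0 (x n) > 0" "(\<Sum>v=1..n. a v) \<le> N n"
  shows "coeff n a * x n ^ N n = Dl D 0 (x n) ^ n / (2 * pi * sqrt n) * integral\<^sup>L lborel (integrand n a)"
proof -
  have "coeff n a * x n ^ N n = (\<integral>u. complex_of_real (Dl D 0 (x n)) ^ n * integrand n a u \<partial>lborel) / (2 * pi * sqrt n)"
    unfolding coeff_def using assms
    by (subst coeff_scaled_integral[where s="sqrt n"])
       (auto simp: integrand_def scaleR_conv_of_real intro!: Bochner_Integration.integral_cong)
  thus ?thesis by simp
qed

lemma coeff_upper:
  "\<exists>C>0. eventually (\<lambda>n. \<forall>a. (\<Sum>v=1..n. a v) = r \<longrightarrow> 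
     norm (coeff n a) * x n ^ N n \<le> C * (Dl D 0 (x n) ^ n / sqrt n)) sequentially"
proof -
  obtain c K where cK: "c > 0" "K \<ge> 1" and ev:
   "eventually (\<lambda>n. \<forall>a u. (\<Sum>v=1..n. a v) = r \<longrightarrow> \<bar>u\<bar> \<le> pi * sqrt n \<longrightarrow>
     norm (\<Prod>v=1..n. Em D (a v) (complex_of_real (x n) * cis (u / sqrt n))) \<le> Dl D 0 (x n) ^ n * K * exp (- c * u\<^sup>2)) sequentially"
    using prod_bound[of r] by blast
  define G where "G = integral\<^sup>L lborel (\<lambda>u. K * exp (- c * u\<^sup>2))"
  have iG: "integrable lborel (\<lambda>u. K * exp (- c * u\<^sup>2))" 
    using integrable_exp_neg_square[OF cK(1)] by (rule integrable_mult_right)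
  have G0: "G \<ge> 0" unfolding G_def using cK by (intro Bochner_Integration.integral_nonneg) auto
  have "eventually (\<lambda>n. \<forall>a. (\<Sum>v=1..n. a v) = r \<longrightarrow> 
     norm (coeff n a) * x n ^ N n \<le> (G / (2 * pi) + 1) * (Dl D 0 (x n) ^ n / sqrt n)) sequentially"
    using ev eventually_good[of 1 r]
  proof eventually_elim
    case (elim n)
    show ?case
    proof (intro allI impI)
      fix a assume a: "(\<Sum>v=1..n. a v) = r"
      have b: "norm (integrand n a u) \<le> K * exp (- c * u\<^sup>2)" for u
        using elim a cK by (intro norm_integrand_le) (auto simp: mult.assoc)
      have "norm (coeff n a) * x n ^ N n = norm (coeff n a * x n ^ N n)" using elim by (simp add: norm_mult norm_power)
      also have "\<dots> = Dl D 0 (x n) ^ n / (2 * pi * sqrt n) * norm (integral\<^sup>L lborel (integrand n a))"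
        using elim a by (subst coeff_eq) (auto simp: norm_mult norm_divide norm_power)
      also have "norm (integral\<^sup>L lborel (integrand n a)) \<le> G"
        unfolding G_def by (rule Bochner_Integration.integral_norm_bound_integral[OF integrable_integrand iG b])
      hence "Dl D 0 (x n) ^ n / (2 * pi * sqrt n) * norm (integral\<^sup>L lborel (integrand n a)) \<le> Dl D 0 (x n) ^ n / (2 * pi * sqrt n) * G"
        using elim by (intro mult_left_mono) auto
      also have "\<dots> = G / (2 * pi) * (Dl D 0 (x n) ^ n / sqrt n)" by simp
      also have "\<dots> \<le> (G / (2 * pi) + 1) * (Dl D 0 (x n) ^ n / sqrt n)"
        using elim by (intro mult_right_mono) auto
      finally show "norm (coeff n a) * x n ^ N n \<le> (G / (2 * pi) + 1) * (Dl D 0 (x n) ^ n / sqrt n)" .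
    qed
  qed
  moreover have "G / (2 * pi) + 1 > 0" using G0 by (simp add: add_nonneg_pos)
  ultimately show ?thesis by blast
qed

text \<open>The pattern left by disjoint cycles on \<open>J\<close> vertices, each vertex being met
  at two positions. The coefficient depends only on how many vertices have each value, so the first
  \<open>J\<close> vertices serve as representatives.\<close>

definition doubles :: "nat \<Rightarrow> nat \<Rightarrow> nat" where
  "doubles J v = (if v \<in> {1..J} then 2 else 0)"

lemma prod_doubles:
  assumes "J \<le> n"
  shows "(\<Prod>v=1..n. f (doubles J v)) = f 2 ^ J * (f 0 :: 'b :: comm_monoid_mult) ^ (n - J)"
proof -
  have eq: "{1..n} \<inter> {v. v \<in> {1..J}} = {1..J}" "{1..n} \<inter> - {v. v \<in> {1..J}} = {Suc J..n}" using assms by auto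
  have "(\<Prod>v=1..n. f (doubles J v)) = (\<Prod>v=1..n. if v \<in> {1..J} then f 2 else f 0)"
    by (intro prod.cong) (auto simp: doubles_def)
  also have "\<dots> = (\<Prod>v\<in>{1..n} \<inter> {v. v \<in> {1..J}}. f 2) * (\<Prod>v\<in>{1..n} \<inter> - {v. v \<in> {1..J}}. f 0)"
    by (rule prod.If_cases) simp
  finally show ?thesis unfolding eq by simp
qed

lemma sum_doubles: "J \<le> n \<Longrightarrow> (\<Sum>v=1..n. doubles J v) = 2 * J"
proof -
  assume "J \<le> n"
  hence "{1..n} \<inter> {1..J} = {1..J}" by auto
  moreover have "(\<Sum>v=1..n. doubles J v) = sum (\<lambda>_. 2) ({1..n} \<inter> {1..J})"
    unfolding doubles_def by (rule sum.inter_restrict[symmetric]) simp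
  moreover have "sum (\<lambda>_. 2) {1..J} = 2 * J" by simp
  ultimately show ?thesis by (simp only:)
qed

text \<open>The Gaussian integral is left unevaluated, because it cancels from every ratio of
  coefficients once it is known to be positive.\<close>

definition L where "L = integral\<^sup>L lborel (\<lambda>u. exp (- (\<sigma> * u\<^sup>2 / 2)))"

text \<open>The \<open>J\<close> doubled factors tend to \<kappa> each, and the remaining
  \<open>n - J\<close> factors form the \<open>n\<close>-th power of \<open>tendsto_gaussian\<close>
  divided by \<open>J\<close> factors that tend to 1. Domination by \<open>prod_bound\<close> also
  yields integrability of the limit, which \<open>L_pos\<close> relies on: the integral of a
  function that is not integrable is 0 by convention.\<close>

lemma integral_limit_aux:
  "(\<lambda>n. integral\<^sup>L lborel (integrand n (doubles J))) \<longlonglongrightarrow> (\<integral>u. \<kappa> ^ J * complex_of_real (exp (- (\<sigma> * u\<^sup>2 / 2))) \<partial>lborel)" (is ?A)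
  "integrable lborel (\<lambda>u. \<kappa> ^ J * complex_of_real (exp (- (\<sigma> * u\<^sup>2 / 2))))" (is ?B)
proof -
  obtain c K where cK: "c > 0" "K \<ge> 1" and ev:
   "eventually (\<lambda>n. \<forall>a u. (\<Sum>v=1..n. a v) = 2 * J \<longrightarrow> \<bar>u\<bar> \<le> pi * sqrt n \<longrightarrow>
     norm (\<Prod>v=1..n. Em D (a v) (complex_of_real (x n) * cis (u / sqrt n))) \<le> Dl D 0 (x n) ^ n * K * exp (- c * u\<^sup>2)) sequentially"
    using prod_bound[of "2 * J"] by blast
  from eventually_conj[OF ev eventually_good[of "J + 1" "2 * J"]] obtain n0 where n0:
    "\<And>n a u. n \<ge> n0 \<Longrightarrow> (\<Sum>v=1..n. a v) = 2 * J \<Longrightarrow> \<bar>u\<bar> \<le> pi * sqrt n \<Longrightarrow>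
     norm (\<Prod>v=1..n. Em D (a v) (complex_of_real (x n) * cis (u / sqrt n))) \<le> Dl D 0 (x n) ^ n * K * exp (- c * u\<^sup>2)"
    "\<And>n. n \<ge> n0 \<Longrightarrow> n \<ge> J + 1 \<and> x n > 0 \<and> Dl D 0 (x n) > 0"
    unfolding eventually_sequentially by blast
  have iG: "integrable lborel (\<lambda>u. K * exp (- c * u\<^sup>2))" 
    using integrable_exp_neg_square[OF cK(1)] by (rule integrable_mult_right)
  \<comment> \<open>The domination holds only from \<open>n0\<close> on, so the sequence is
    shifted.\<close>
  have b: "norm (integrand (n + n0) (doubles J) u) \<le> K * exp (- c * u\<^sup>2)" for u n
    using n0(1)[of "n+n0" "doubles J" u] n0(2)[of "n+n0"] sum_doubles[of J "n+n0"] cK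
    by (intro norm_integrand_le) (auto simp: mult.assoc)
  have lim: "(\<lambda>n. integrand n (doubles J) u) \<longlonglongrightarrow> \<kappa> ^ J * complex_of_real (exp (- (\<sigma> * u\<^sup>2 / 2)))" for u
  proof -
    define w where "w = (\<lambda>n. Em D 0 (complex_of_real (x n) * cis (u / sqrt n)) / complex_of_real (Dl D 0 (x n)))"
    define w2 where "w2 = (\<lambda>n. Em D 2 (complex_of_real (x n) * cis (u / sqrt n)) / complex_of_real (Dl D 0 (x n)))"
    have w: "w \<longlonglongrightarrow> 1"
      using tendsto_ratio_circle[of 0 u] Dl_X unfolding w_def by (simp add: Em_def)
    have w2: "w2 \<longlonglongrightarrow> complex_of_real \<kappa>"
      using tendsto_ratio_circle[of 2 u] unfolding w2_def \<kappa>_def .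
    have g: "(\<lambda>n. w n ^ n * cis (- (N n * (u / sqrt n)))) \<longlonglongrightarrow> complex_of_real (exp (- (\<sigma> * u\<^sup>2 / 2)))"
      using tendsto_gaussian[of u] unfolding w_def by (simp add: Em_def)
    have "(\<lambda>n. w2 n ^ J * (w n ^ n * cis (- (N n * (u / sqrt n))) / w n ^ J)) \<longlonglongrightarrow> complex_of_real \<kappa> ^ J * (complex_of_real (exp (- (\<sigma> * u\<^sup>2 / 2))) / 1 ^ J)"
      by (intro tendsto_mult tendsto_power tendsto_divide w w2 g) auto
    hence "(\<lambda>n. w2 n ^ J * (w n ^ n * cis (- (N n * (u / sqrt n))) / w n ^ J)) \<longlonglongrightarrow> complex_of_real \<kappa> ^ J * complex_of_real (exp (- (\<sigma> * u\<^sup>2 / 2)))"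
      by simp
    moreover have "eventually (\<lambda>n. w2 n ^ J * (w n ^ n * cis (- (N n * (u / sqrt n))) / w n ^ J) = integrand n (doubles J) u) sequentially"
    proof -
      have "eventually (\<lambda>n. w n \<noteq> 0) sequentially" using w by (rule tendsto_imp_eventually_ne) simp
      moreover have "eventually (\<lambda>n. pi * sqrt n \<ge> \<bar>u\<bar>) sequentially"
      proof -
        have "eventually (\<lambda>n. sqrt (real n) \<ge> \<bar>u\<bar> / pi) sequentially"
          using filterlim_compose[OF sqrt_at_top filterlim_real_sequentially] by (simp add: filterlim_at_top)
        thus ?thesis by eventually_elim (simp add: field_simps)
      qed
      ultimately show ?thesis using eventually_good[of J 0]
      proof eventually_elim
        case (elim n)
        have "integrand n (doubles J) u = w2 n ^ J * w n ^ (n - J) * cis (- (N n * (u / sqrt n)))"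
        proof -
          define F where "F = complex_of_real (Dl D 0 (x n))"
          have "F ^ n = F ^ J * F ^ (n - J)" using elim by (simp add: power_add[symmetric])
          thus ?thesis using elim(1,2,3) 
            by (simp add: integrand_def prod_doubles[where f="\<lambda>a. Em D a (complex_of_real (x n) * cis (u / sqrt n))", simplified] w_def w2_def F_def[symmetric] power_divide indicator_def abs_le_iff)
        qed
        moreover have "w n ^ n = w n ^ (n - J) * w n ^ J" using elim by (simp add: power_add[symmetric])
        ultimately show ?case using elim(1) by simp
      qed
    qed
    ultimately show ?thesis unfolding of_real_power by (rule Lim_transform_eventually)
  qed
  have meas: "(\<lambda>u. \<kappa> ^ J * complex_of_real (exp (- (\<sigma> * u\<^sup>2 / 2)))) \<in> borel_measurable lborel"
    by measurable
  have dl: "AE u in lborel. (\<lambda>n. integrand (n + n0) (doubles J) u) \<longlonglongrightarrow> \<kappa> ^ J * complex_of_real (exp (- (\<sigma> * u\<^sup>2 / 2)))"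
    by (rule AE_I2, rule LIMSEQ_ignore_initial_segment, rule lim)
  have db: "AE u in lborel. norm (integrand (n + n0) (doubles J) u) \<le> K * exp (- c * u\<^sup>2)" for n
    by (rule AE_I2, rule b)
  note dom = meas borel_measurable_integrable[OF integrable_integrand] iG dl db
  have "(\<lambda>n. integral\<^sup>L lborel (integrand (n + n0) (doubles J))) \<longlonglongrightarrow> (\<integral>u. \<kappa> ^ J * complex_of_real (exp (- (\<sigma> * u\<^sup>2 / 2))) \<partial>lborel)"
    by (rule integral_dominated_convergence[OF dom])
  thus "(\<lambda>n. integral\<^sup>L lborel (integrand n (doubles J))) \<longlonglongrightarrow> (\<integral>u. \<kappa> ^ J * complex_of_real (exp (- (\<sigma> * u\<^sup>2 / 2))) \<partial>lborel)"
    by (rule LIMSEQ_offset)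
  show "integrable lborel (\<lambda>u. \<kappa> ^ J * complex_of_real (exp (- (\<sigma> * u\<^sup>2 / 2))))"
    by (rule integrable_dominated_convergence[OF dom])
qed

lemma L_pos: "L > 0"
proof -
  have "integrable lborel (\<lambda>u. complex_of_real (exp (- (\<sigma> * u\<^sup>2 / 2))))" using integral_limit_aux(2)[of 0] by simp
  hence i: "integrable lborel (\<lambda>u. exp (- (\<sigma> * u\<^sup>2 / 2)))" by (simp only: complex_of_real_integrable_eq)
  have "L \<ge> 0" unfolding L_def by (intro Bochner_Integration.integral_nonneg) auto
  moreover have "L \<noteq> 0"
  proof
    assume "L = 0"
    hence "AE u in lborel. exp (- (\<sigma> * u\<^sup>2 / 2)) = (0::real)"
      unfolding L_def by (subst (asm) integral_nonneg_eq_0_iff_AE[OF i]) auto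
    hence "AE u::real in lborel. False" by simp
    thus False by (simp add: AE_iff_null null_sets_def)
  qed
  ultimately show ?thesis by simp
qed

lemma integral_limit:
  "(\<lambda>n. integral\<^sup>L lborel (integrand n (doubles J))) \<longlonglongrightarrow> complex_of_real (\<kappa> ^ J * L)"
proof -
  have "(\<integral>u. \<kappa> ^ J * complex_of_real (exp (- (\<sigma> * u\<^sup>2 / 2))) \<partial>lborel) = complex_of_real (\<kappa> ^ J * L)"
    unfolding L_def by (simp only: of_real_mult[symmetric] integral_complex_of_real integral_mult_right_zero)
  thus ?thesis using integral_limit_aux(1)[of J] by (simp only:)
qed

lemma coeff_doubles_limit:
  "(\<lambda>n. coeff n (doubles J) / coeff n (\<lambda>_. 0)) \<longlonglongrightarrow> complex_of_real (\<kappa> ^ J)"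
  "eventually (\<lambda>n. coeff n (\<lambda>_. 0) \<noteq> 0) sequentially"
proof -
  have d0: "doubles 0 = (\<lambda>_. 0)" by (auto simp: doubles_def)
  have l0: "(\<lambda>n. integral\<^sup>L lborel (integrand n (\<lambda>_. 0))) \<longlonglongrightarrow> complex_of_real L"
    using integral_limit[of 0] by (simp add: d0)
  have ne: "eventually (\<lambda>n. integral\<^sup>L lborel (integrand n (\<lambda>_. 0)) \<noteq> 0) sequentially"
    using l0 by (rule tendsto_imp_eventually_ne) (use L_pos in auto)
  have "(\<lambda>n. integral\<^sup>L lborel (integrand n (doubles J)) / integral\<^sup>L lborel (integrand n (\<lambda>_. 0))) \<longlonglongrightarrow> complex_of_real (\<kappa> ^ J * L) / complex_of_real L"
    by (intro tendsto_divide integral_limit l0) (use L_pos in auto)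
  moreover have "complex_of_real (\<kappa> ^ J * L) / complex_of_real L = complex_of_real (\<kappa> ^ J)" using L_pos by simp
  moreover have "eventually (\<lambda>n. integral\<^sup>L lborel (integrand n (doubles J)) / integral\<^sup>L lborel (integrand n (\<lambda>_. 0)) = coeff n (doubles J) / coeff n (\<lambda>_. 0)) sequentially"
    using eventually_good[of "J + 1" "2 * J"]
  proof eventually_elim
    case (elim n)
    have "coeff n (doubles J) / coeff n (\<lambda>_. 0) = (coeff n (doubles J) * x n ^ N n) / (coeff n (\<lambda>_. 0) * x n ^ N n)"
      using elim by simp
    also have "\<dots> = integral\<^sup>L lborel (integrand n (doubles J)) / integral\<^sup>L lborel (integrand n (\<lambda>_. 0))"
      using elim by (subst (1 2) coeff_eq) (auto simp: sum_doubles[unfolded One_nat_def])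
    finally show ?case by simp
  qed
  ultimately show "(\<lambda>n. coeff n (doubles J) / coeff n (\<lambda>_. 0)) \<longlonglongrightarrow> complex_of_real (\<kappa> ^ J)"
    using Lim_transform_eventually by fastforce
  show "eventually (\<lambda>n. coeff n (\<lambda>_. 0) \<noteq> 0) sequentially"
    using eventually_good[of 1 0] ne
  proof eventually_elim
    case (elim n)
    hence "coeff n (\<lambda>_. 0) * x n ^ N n \<noteq> 0" by (subst coeff_eq) auto
    thus ?case by auto
  qed
qed

text \<open>\<open>coeff_upper\<close> bounds the numerator by a multiple of \<Delta>^n / sqrt n,
  and positivity of \<open>L\<close> shows that the denominator is at least of this order. The
  constant depends on the number \<open>r\<close> of prescribed letters and not on which letters
  they are.\<close>

lemma coeff_bound:
  "\<exists>C>0. eventually (\<lambda>n. \<forall>a. (\<Sum>v=1..n. a v) = r \<longrightarrow> norm (coeff n a) \<le> C * norm (coeff n (\<lambda>_. 0))) sequentially"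
proof -
  obtain C where C: "C > 0" and ev: "eventually (\<lambda>n. \<forall>a. (\<Sum>v=1..n. a v) = r \<longrightarrow> 
     norm (coeff n a) * x n ^ N n \<le> C * (Dl D 0 (x n) ^ n / sqrt n)) sequentially"
    using coeff_upper[of r] by blast
  have d0: "doubles 0 = (\<lambda>_. 0)" by (auto simp: doubles_def)
  have "(\<lambda>n. norm (integral\<^sup>L lborel (integrand n (\<lambda>_. 0)))) \<longlonglongrightarrow> norm (complex_of_real L)"
    using tendsto_norm[OF integral_limit[of 0]] by (simp add: d0)
  hence "eventually (\<lambda>n. norm (integral\<^sup>L lborel (integrand n (\<lambda>_. 0))) > L / 2) sequentially"
    by (rule order_tendstoD) (use L_pos in auto)
  with ev eventually_good[of 1 r]
  have "eventually (\<lambda>n. \<forall>a. (\<Sum>v=1..n. a v) = r \<longrightarrow> norm (coeff n a) \<le> (4 * pi * C / L) * norm (coeff n (\<lambda>_. 0))) sequentially"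
  proof eventually_elim
    case (elim n)
    show ?case
    proof (intro allI impI)
      fix a assume a: "(\<Sum>v=1..n. a v) = r"
      define F where "F = Dl D 0 (x n) ^ n / sqrt n"
      have F: "F > 0" using elim by (simp add: F_def)
      have "norm (coeff n (\<lambda>_. 0)) * x n ^ N n = norm (coeff n (\<lambda>_. 0) * x n ^ N n)" using elim by (simp add: norm_mult norm_power)
      also have "\<dots> = F / (2 * pi) * norm (integral\<^sup>L lborel (integrand n (\<lambda>_. 0)))"
        using elim by (subst coeff_eq) (auto simp: norm_mult norm_divide norm_power F_def)
      also have "\<dots> \<ge> F / (2 * pi) * (L / 2)" using elim F by (intro mult_left_mono) auto
      finally have 1: "F * (L / (4 * pi)) \<le> norm (coeff n (\<lambda>_. 0)) * x n ^ N n" by simp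
      have "norm (coeff n a) * x n ^ N n \<le> C * F" using elim(1) a by (simp add: F_def)
      also have "C * F = (4 * pi * C / L) * (F * (L / (4 * pi)))" using L_pos by simp
      also have "\<dots> \<le> (4 * pi * C / L) * (norm (coeff n (\<lambda>_. 0)) * x n ^ N n)"
        using 1 C L_pos by (intro mult_left_mono) auto
      finally have "norm (coeff n a) * x n ^ N n \<le> ((4 * pi * C / L) * norm (coeff n (\<lambda>_. 0))) * x n ^ N n" by simp
      thus "norm (coeff n a) \<le> (4 * pi * C / L) * norm (coeff n (\<lambda>_. 0))"
        using elim by (subst (asm) mult_le_cancel_right) auto
    qed
  qed
  moreover have "4 * pi * C / L > 0" using C L_pos by simp
  ultimately show ?thesis by blast
qed

end

section \<open>From factorial moments to Poisson limits\<close>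

definition avg :: "'b set \<Rightarrow> ('b \<Rightarrow> real) \<Rightarrow> real" where
  "avg A f = (\<Sum>x\<in>A. f x) / real (card A)"

lemma avg_mono: "(\<And>x. x \<in> A \<Longrightarrow> f x \<le> g x) \<Longrightarrow> avg A f \<le> avg A g"
  unfolding avg_def by (intro divide_right_mono sum_mono) auto

lemma avg_nonneg: "(\<And>x. x \<in> A \<Longrightarrow> f x \<ge> 0) \<Longrightarrow> avg A f \<ge> 0"
  unfolding avg_def by (intro divide_nonneg_nonneg sum_nonneg) auto

lemma avg_cong: "(\<And>x. x \<in> A \<Longrightarrow> f x = g x) \<Longrightarrow> avg A f = avg A g"
  unfolding avg_def by (simp cong: sum.cong)

lemma avg_add: "avg A (\<lambda>x. f x + g x) = avg A f + avg A g"
  unfolding avg_def by (simp add: sum.distrib add_divide_distrib)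

lemma avg_diff: "avg A (\<lambda>x. f x - g x) = avg A f - avg A g"
  unfolding avg_def by (simp add: sum_subtractf diff_divide_distrib)

lemma avg_cmult: "avg A (\<lambda>x. c * f x) = c * avg A f"
  unfolding avg_def by (simp add: sum_distrib_left)

lemma avg_sum: "avg A (\<lambda>x. \<Sum>i\<in>I. f i x) = (\<Sum>i\<in>I. avg A (f i))"
  unfolding avg_def by (subst sum.swap) (simp add: sum_divide_distrib)

lemma avg_abs: "\<bar>avg A f\<bar> \<le> avg A (\<lambda>x. \<bar>f x\<bar>)"
  unfolding avg_def by (simp add: abs_divide divide_right_mono sum_abs)

text \<open>A truncated alternating row of Pascal's triangle telescopes to a signed binomial
  coefficient of the row above. This is Bonferroni's inequality for the event that a count
  vanishes.\<close>

lemma alternating_choose_bound: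
  assumes "R > 0"
  shows "\<bar>(if y = 0 then 1 else 0) - (\<Sum>s<R. (-1) ^ s * real (y choose s))\<bar> \<le> real (y choose R)"
proof (cases y)
  case 0
  have "(\<Sum>s<R. (-1) ^ s * real (0 choose s)) = (\<Sum>s<R. if s = 0 then 1 else 0)"
    by (intro sum.cong) auto
  thus ?thesis using 0 assms by simp
next
  case (Suc z)
  have "(\<Sum>s<Suc r. (-1) ^ s * real (Suc z choose s)) = (-1) ^ r * real (z choose r)" for r
  proof (induction r)
    case (Suc r)
    thus ?case by (simp add: algebra_simps)
  qed simp
  hence "(\<Sum>s<R. (-1) ^ s * real (y choose s)) = (-1) ^ (R - 1) * real (z choose (R - 1))"
    using assms Suc by (cases R) auto
  moreover have "real (z choose (R - 1)) \<le> real (y choose R)"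
    using assms Suc by (cases R) auto
  ultimately show ?thesis using Suc by (simp add: abs_mult)
qed

text \<open>The identity (t + s choose t) (x choose t + s) = (x choose t) (x - t choose s) reduces
  the event x = t to the event x - t = 0.\<close>

lemma indicator_choose_bound:
  assumes "R > 0"
  shows "\<bar>(if x = t then 1 else 0) - (\<Sum>s<R. (-1) ^ s * real ((t + s) choose t) * real (x choose (t + s)))\<bar>
     \<le> real ((t + R) choose t) * real (x choose (t + R))"
proof (cases "t \<le> x")
  case False
  hence "x choose (t + s) = 0" for s by (simp add: binomial_eq_0)
  moreover have "x \<noteq> t" using False by simp
  ultimately show ?thesis by (simp only: if_False of_nat_0 mult_zero_right sum.neutral_const)
next
  case True
  have ch: "real ((t + s) choose t) * real (x choose (t + s)) = real (x choose t) * real ((x - t) choose s)" for s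
  proof (cases "t + s \<le> x")
    case True
    thus ?thesis using choose_mult[of t "t + s" x] by (simp flip: of_nat_mult add: mult.commute)
  next
    case False
    hence "x - t < s" "x < t + s" using \<open>t \<le> x\<close> by linarith+
    thus ?thesis by (simp add: binomial_eq_0)
  qed
  have "(if x = t then 1 else 0) - (\<Sum>s<R. (-1) ^ s * real ((t + s) choose t) * real (x choose (t + s)))
     = real (x choose t) * ((if x - t = 0 then 1 else 0) - (\<Sum>s<R. (-1) ^ s * real ((x - t) choose s)))"
    unfolding mult.assoc ch using True by (simp add: right_diff_distrib sum_distrib_left mult_ac)
  thus ?thesis using mult_left_mono[OF alternating_choose_bound[OF assms, of "x - t"], of "real (x choose t)"]
    unfolding ch by (simp add: abs_mult)
qed

text \<open>The weight \<open>Y\<close> carries the other variables, so that the joint law can be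
  reached by treating one variable at a time. The truncation level \<open>R\<close> is chosen from
  the limits alone; for fixed \<open>R\<close> only finitely many moments are involved as
  \<open>n\<close> grows.\<close>

lemma sieve_one:
  fixes A :: "nat \<Rightarrow> 'b set" and Y :: "nat \<Rightarrow> 'b \<Rightarrow> real" and Z :: "nat \<Rightarrow> 'b \<Rightarrow> nat" and lam y :: real
  assumes Y: "\<And>n x. x \<in> A n \<Longrightarrow> Y n x \<ge> 0"
    and mom: "\<And>r. (\<lambda>n. avg (A n) (\<lambda>x. Y n x * real (Z n x choose r))) \<longlonglongrightarrow> y * (lam ^ r / fact r)"
  shows "(\<lambda>n. avg (A n) (\<lambda>x. Y n x * (if Z n x = t then 1 else 0))) \<longlonglongrightarrow> y * (lam ^ t / fact t * exp (- lam))"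
proof -
  \<comment> \<open>\<open>P R\<close> is a partial sum of the series of y lam^t / t! exp (- lam),
    and \<open>Q R\<close> is the limit of the Bonferroni error, up to a constant factor a single
    term of an exponential series.\<close>
  define P where "P = (\<lambda>R. \<Sum>s<R. (-1) ^ s * real ((t + s) choose t) * (y * (lam ^ (t + s) / fact (t + s))))"
  define Q where "Q = (\<lambda>R. real ((t + R) choose t) * (y * (lam ^ (t + R) / fact (t + R))))"
  have ch: "real ((t + s) choose t) / fact (t + s) = 1 / (fact t * fact s)" for s
    by (simp add: binomial_fact)
  have Qeq: "Q R = y * lam ^ t / fact t * (lam ^ R / fact R)" for R
    using ch[of R] by (simp add: Q_def power_add field_simps)
  have Peq: "P R = (\<Sum>s<R. y * lam ^ t / fact t * ((- lam) ^ s / fact s))" for R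
    unfolding P_def
  proof (intro sum.cong refl)
    fix s
    have "(-1) ^ s * real ((t + s) choose t) * (y * (lam ^ (t + s) / fact (t + s))) =
       (-1) ^ s * y * lam ^ (t + s) * (real ((t + s) choose t) / fact (t + s))" by simp
    also have "\<dots> = y * lam ^ t / fact t * ((- lam) ^ s / fact s)"
      unfolding ch by (simp add: power_add power_minus[of lam])
    finally show "(-1) ^ s * real ((t + s) choose t) * (y * (lam ^ (t + s) / fact (t + s))) = y * lam ^ t / fact t * ((- lam) ^ s / fact s)" .
  qed
  have "(\<lambda>R. \<Sum>s<R. (- lam) ^ s /\<^sub>R fact s) \<longlonglongrightarrow> exp (- lam)"
    using exp_converges[of "- lam"] by (simp add: sums_def)
  hence Plim: "P \<longlonglongrightarrow> y * (lam ^ t / fact t * exp (- lam))"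
    unfolding Peq sum_distrib_left[symmetric] by (auto intro!: tendsto_eq_intros simp: field_simps)
  have "(\<lambda>R. lam ^ R /\<^sub>R fact R) \<longlonglongrightarrow> 0"
    by (rule summable_LIMSEQ_zero[OF summable_exp_generic])
  hence "(\<lambda>R. lam ^ R / fact R) \<longlonglongrightarrow> 0" by (simp add: divide_inverse mult.commute)
  hence Qlim: "Q \<longlonglongrightarrow> 0"
    unfolding Qeq by (rule tendsto_mult_right_zero)
  have key: "\<bar>avg (A n) (\<lambda>x. Y n x * (if Z n x = t then 1 else 0)) - (\<Sum>s<R. (-1) ^ s * real ((t + s) choose t) * avg (A n) (\<lambda>x. Y n x * real (Z n x choose (t + s))))\<bar>
     \<le> real ((t + R) choose t) * avg (A n) (\<lambda>x. Y n x * real (Z n x choose (t + R)))" if "R > 0" for R n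
  proof -
    have eq: "avg (A n) (\<lambda>x. Y n x * (if Z n x = t then 1 else 0)) - (\<Sum>s<R. (-1) ^ s * real ((t + s) choose t) * avg (A n) (\<lambda>x. Y n x * real (Z n x choose (t + s))))
      = avg (A n) (\<lambda>x. Y n x * ((if Z n x = t then 1 else 0) - (\<Sum>s<R. (-1) ^ s * real ((t + s) choose t) * real (Z n x choose (t + s)))))"
      unfolding avg_cmult[symmetric] avg_sum[symmetric] avg_diff[symmetric]
      by (rule avg_cong) (simp add: right_diff_distrib sum_distrib_left mult_ac)
    have "\<bar>avg (A n) (\<lambda>x. Y n x * (if Z n x = t then 1 else 0)) - (\<Sum>s<R. (-1) ^ s * real ((t + s) choose t) * avg (A n) (\<lambda>x. Y n x * real (Z n x choose (t + s))))\<bar>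
      \<le> avg (A n) (\<lambda>x. \<bar>Y n x * ((if Z n x = t then 1 else 0) - (\<Sum>s<R. (-1) ^ s * real ((t + s) choose t) * real (Z n x choose (t + s))))\<bar>)"
      unfolding eq by (rule avg_abs)
    also have "\<dots> \<le> avg (A n) (\<lambda>x. real ((t + R) choose t) * (Y n x * real (Z n x choose (t + R))))"
    proof (rule avg_mono)
      fix x assume "x \<in> A n"
      hence Y0: "Y n x \<ge> 0" by (rule Y)
      have "\<bar>Y n x * ((if Z n x = t then 1 else 0) - (\<Sum>s<R. (-1) ^ s * real ((t + s) choose t) * real (Z n x choose (t + s))))\<bar>
         \<le> Y n x * (real ((t + R) choose t) * real (Z n x choose (t + R)))"
        unfolding abs_mult abs_of_nonneg[OF Y0] by (intro mult_left_mono indicator_choose_bound that Y0)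
      thus "\<bar>Y n x * ((if Z n x = t then 1 else 0) - (\<Sum>s<R. (-1) ^ s * real ((t + s) choose t) * real (Z n x choose (t + s))))\<bar> \<le> real ((t + R) choose t) * (Y n x * real (Z n x choose (t + R)))"
        by (simp only: mult.left_commute)
    qed
    finally show ?thesis unfolding avg_cmult .
  qed
  show ?thesis
  proof (rule LIMSEQ_I)
    fix e :: real assume e: "e > 0"
    define l where "l = y * (lam ^ t / fact t * exp (- lam))"
    have "eventually (\<lambda>R. \<bar>P R - l\<bar> < e / 4) sequentially"
      using tendstoD[OF Plim, of "e / 4"] e by (simp add: dist_real_def l_def)
    moreover have "eventually (\<lambda>R. \<bar>Q R\<bar> < e / 4) sequentially"
      using tendstoD[OF Qlim, of "e / 4"] e by (simp add: dist_real_def)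
    ultimately have "eventually (\<lambda>R. \<bar>P R - l\<bar> < e / 4 \<and> \<bar>Q R\<bar> < e / 4 \<and> R > 0) sequentially"
      using eventually_gt_at_top[of 0] by eventually_elim auto
    then obtain R where R: "\<bar>P R - l\<bar> < e / 4" "\<bar>Q R\<bar> < e / 4" "R > 0"
      unfolding eventually_sequentially by blast
    have "(\<lambda>n. \<Sum>s<R. (-1) ^ s * real ((t + s) choose t) * avg (A n) (\<lambda>x. Y n x * real (Z n x choose (t + s)))) \<longlonglongrightarrow> P R"
      unfolding P_def by (intro tendsto_sum tendsto_mult tendsto_const mom)
    hence 1: "eventually (\<lambda>n. \<bar>(\<Sum>s<R. (-1) ^ s * real ((t + s) choose t) * avg (A n) (\<lambda>x. Y n x * real (Z n x choose (t + s)))) - P R\<bar> < e / 4) sequentially"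
      using tendstoD[of _ "P R" sequentially "e / 4"] e by (simp add: dist_real_def)
    have "(\<lambda>n. real ((t + R) choose t) * avg (A n) (\<lambda>x. Y n x * real (Z n x choose (t + R)))) \<longlonglongrightarrow> Q R"
      unfolding Q_def by (intro tendsto_mult tendsto_const mom)
    hence 2: "eventually (\<lambda>n. \<bar>real ((t + R) choose t) * avg (A n) (\<lambda>x. Y n x * real (Z n x choose (t + R))) - Q R\<bar> < e / 4) sequentially"
      using tendstoD[of _ "Q R" sequentially "e / 4"] e by (simp add: dist_real_def)
    from 1 2 have "eventually (\<lambda>n. \<bar>avg (A n) (\<lambda>x. Y n x * (if Z n x = t then 1 else 0)) - l\<bar> < e) sequentially"
    proof eventually_elim
      case (elim n)
      show ?case using elim key[OF R(3), of n] R(1,2) by linarith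
    qed
    thus "\<exists>no. \<forall>n\<ge>no. norm (avg (A n) (\<lambda>x. Y n x * (if Z n x = t then 1 else 0)) - y * (lam ^ t / fact t * exp (- lam))) < e"
      by (simp add: eventually_sequentially l_def)
  qed
qed

text \<open>In the induction the coordinates in \<open>S\<close> have been turned into indicators
  while the others still appear as binomial moments. The claim is kept for all \<open>r\<close>,
  because converting the coordinate \<open>i\<close> uses all of its moments.\<close>

lemma sieve:
  fixes A :: "nat \<Rightarrow> 'b set" and Z :: "nat \<Rightarrow> 'i \<Rightarrow> 'b \<Rightarrow> nat" and lam :: "'i \<Rightarrow> real"
  assumes K: "finite K"
    and mom: "\<And>r. (\<lambda>n. avg (A n) (\<lambda>x. \<Prod>j\<in>K. real (Z n j x choose r j))) \<longlonglongrightarrow> (\<Prod>j\<in>K. lam j ^ r j / fact (r j))"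
  shows "(\<lambda>n. avg (A n) (\<lambda>x. \<Prod>j\<in>K. if Z n j x = t j then 1 else 0)) \<longlonglongrightarrow> (\<Prod>j\<in>K. lam j ^ t j / fact (t j) * exp (- lam j))"
proof -
  have "(\<lambda>n. avg (A n) (\<lambda>x. (\<Prod>j\<in>S. if Z n j x = t j then 1 else 0) * (\<Prod>j\<in>K-S. real (Z n j x choose r j)))) \<longlonglongrightarrow>
      (\<Prod>j\<in>S. lam j ^ t j / fact (t j) * exp (- lam j)) * (\<Prod>j\<in>K-S. lam j ^ r j / fact (r j))"
    if "S \<subseteq> K" for S r
    using finite_subset[OF that K] that
  proof (induction S arbitrary: r rule: finite_induct)
    case empty
    thus ?case using mom[of r] by simp
  next
    case (insert i S)
    define Y where "Y = (\<lambda>n x. (\<Prod>j\<in>S. if Z n j x = t j then 1 else 0) * (\<Prod>j\<in>K-insert i S. real (Z n j x choose r j)))"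
    have KS: "K - S = insert i (K - insert i S)" using insert by auto
    have fin: "finite (K - insert i S)" using K by auto
    have "(\<lambda>n. avg (A n) (\<lambda>x. Y n x * (if Z n i x = t i then 1 else 0))) \<longlonglongrightarrow>
       ((\<Prod>j\<in>S. lam j ^ t j / fact (t j) * exp (- lam j)) * (\<Prod>j\<in>K-insert i S. lam j ^ r j / fact (r j))) * (lam i ^ t i / fact (t i) * exp (- lam i))"
    proof (rule sieve_one)
      show "Y n x \<ge> 0" for n x unfolding Y_def by (intro mult_nonneg_nonneg prod_nonneg) auto
      fix q
      have "(\<lambda>n. avg (A n) (\<lambda>x. (\<Prod>j\<in>S. if Z n j x = t j then 1 else 0) * (\<Prod>j\<in>K-S. real (Z n j x choose (r(i := q)) j)))) \<longlonglongrightarrow>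
      (\<Prod>j\<in>S. lam j ^ t j / fact (t j) * exp (- lam j)) * (\<Prod>j\<in>K-S. lam j ^ (r(i := q)) j / fact ((r(i := q)) j))"
        using insert by auto
      moreover have "(\<Prod>j\<in>K-S. real (Z n j x choose (r(i := q)) j)) = real (Z n i x choose q) * (\<Prod>j\<in>K-insert i S. real (Z n j x choose r j))" for n x
        unfolding KS using fin by (subst prod.insert) (auto intro!: prod.cong)
      moreover have "(\<Prod>j\<in>K-S. lam j ^ (r(i := q)) j / fact ((r(i := q)) j)) = lam i ^ q / fact q * (\<Prod>j\<in>K-insert i S. lam j ^ r j / fact (r j))"
        unfolding KS using fin by (subst prod.insert) (auto intro!: prod.cong)
      ultimately show "(\<lambda>n. avg (A n) (\<lambda>x. Y n x * real (Z n i x choose q))) \<longlonglongrightarrow>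
         ((\<Prod>j\<in>S. lam j ^ t j / fact (t j) * exp (- lam j)) * (\<Prod>j\<in>K-insert i S. lam j ^ r j / fact (r j))) * (lam i ^ q / fact q)"
        by (simp add: Y_def mult_ac)
    qed
    thus ?case using insert by (simp add: Y_def mult_ac)
  qed
  from this[of K] show ?thesis by simp
qed

section \<open>Words with restricted letter counts\<close>

text \<open>The set of admissible counts varies with the letter, so that it can absorb occurrences
  prescribed elsewhere.\<close>

definition words :: "'p set \<Rightarrow> 'v set \<Rightarrow> ('v \<Rightarrow> nat set) \<Rightarrow> ('p \<Rightarrow> 'v) set" where
  "words P V Dv = {w \<in> P \<rightarrow>\<^sub>E V. \<forall>v\<in>V. card {p\<in>P. w p = v} \<in> Dv v}"

lemma finite_words [simp]: "finite P \<Longrightarrow> finite V \<Longrightarrow> finite (words P V Dv)"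
  by (rule finite_subset[of _ "P \<rightarrow>\<^sub>E V"]) (auto simp: words_def intro: finite_PiE)

lemma sum_Pow_card:
  fixes g :: "nat \<Rightarrow> 'c::comm_semiring_1"
  assumes "finite P"
  shows "(\<Sum>S\<in>Pow P. g (card S)) = (\<Sum>s\<le>card P. of_nat (card P choose s) * g s)"
proof -
  have "(\<Sum>S\<in>Pow P. g (card S)) = (\<Sum>s\<le>card P. \<Sum>S\<in>{S\<in>Pow P. card S = s}. g (card S))"
    using assms by (intro sum.group[symmetric]) (auto intro: card_mono)
  also have "\<dots> = (\<Sum>s\<le>card P. of_nat (card P choose s) * g s)"
    using n_subsets[OF assms] by (intro sum.cong) (auto simp: Pow_def)
  finally show ?thesis .
qed

text \<open>A word is the set \<open>S\<close> of positions of the new letter together with a word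
  on the other positions; this is the combinatorial side of multiplying exponential generating
  functions.\<close>

lemma card_words_insert:
  fixes P :: "'p set" and V :: "'v set"
  assumes "finite P" "finite V" "v \<notin> V"
  shows "card (words P (insert v V) Dv) = (\<Sum>S\<in>Pow P. if card S \<in> Dv v then card (words (P - S) V Dv) else 0)"
proof -
  define T where "T = (SIGMA S:{S\<in>Pow P. card S \<in> Dv v}. words (P - S) V Dv)"
  define f where "f = (\<lambda>w :: 'p \<Rightarrow> 'v. ({p\<in>P. w p = v}, restrict w (P - {p\<in>P. w p = v})))"
  define g where "g = (\<lambda>(S, u :: 'p \<Rightarrow> 'v) p. if p \<in> S then v else u p)"
  have "bij_betw f (words P (insert v V) Dv) T"
  proof (rule bij_betw_byWitness[where f' = g])
    show "\<forall>w\<in>words P (insert v V) Dv. g (f w) = w"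
      by (auto simp: f_def g_def words_def fun_eq_iff PiE_def extensional_def)
    show "\<forall>z\<in>T. f (g z) = z"
    proof
      fix z assume "z \<in> T"
      then obtain S u where z: "z = (S, u)" "S \<subseteq> P" "u \<in> words (P - S) V Dv" by (auto simp: T_def)
      have u: "p \<in> P - S \<Longrightarrow> u p \<in> V" "p \<notin> P - S \<Longrightarrow> u p = undefined" for p
        using z(3) by (auto simp: words_def PiE_def extensional_def)
      have S: "{p\<in>P. g z p = v} = S" using u z(2) \<open>v \<notin> V\<close> by (auto simp: g_def z(1))
      have "restrict (g z) (P - S) = u" using u z(2) by (fastforce simp: g_def z(1) fun_eq_iff)
      thus "f (g z) = z" using S by (simp add: f_def z(1))
    qed
    show "f ` words P (insert v V) Dv \<subseteq> T"
    proof (rule image_subsetI)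
      fix w assume w: "w \<in> words P (insert v V) Dv"
      let ?S = "{p\<in>P. w p = v}"
      have "card {p \<in> P - ?S. restrict w (P - ?S) p = v'} = card {p\<in>P. w p = v'}" if "v' \<in> V" for v'
        using that \<open>v \<notin> V\<close> by (intro arg_cong[where f=card]) auto
      thus "f w \<in> T" using w by (auto simp: T_def f_def words_def PiE_def)
    qed
    show "g ` T \<subseteq> words P (insert v V) Dv"
    proof (rule image_subsetI)
      fix z assume "z \<in> T"
      then obtain S u where z: "z = (S, u)" "(S, u) \<in> T" by (cases z) auto
      hence S: "S \<subseteq> P" "card S \<in> Dv v" and u: "u \<in> words (P - S) V Dv" by (auto simp: T_def)
      have u': "p \<in> P - S \<Longrightarrow> u p \<in> V" "p \<notin> P - S \<Longrightarrow> u p = undefined" for p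
        using u by (auto simp: words_def PiE_def extensional_def)
      have "{p\<in>P. g (S, u) p = v} = S" using u' S \<open>v \<notin> V\<close> by (auto simp: g_def)
      moreover have "{p\<in>P. g (S, u) p = v'} = {p\<in>P - S. u p = v'}" if "v' \<in> V" for v'
        using that \<open>v \<notin> V\<close> by (auto simp: g_def)
      moreover have "g (S, u) \<in> P \<rightarrow>\<^sub>E insert v V" using u' S by (auto simp: g_def PiE_def extensional_def)
      ultimately show "g z \<in> words P (insert v V) Dv"
        using u S unfolding z(1) by (auto simp: words_def)
    qed
  qed
  hence "card (words P (insert v V) Dv) = card T" by (rule bij_betw_same_card)
  also have "\<dots> = (\<Sum>S\<in>{S\<in>Pow P. card S \<in> Dv v}. card (words (P - S) V Dv))"
    unfolding T_def using assms by (intro card_SigmaI) auto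
  also have "\<dots> = (\<Sum>S\<in>Pow P. if card S \<in> Dv v then card (words (P - S) V Dv) else 0)"
    using assms by (intro sum.inter_filter) auto
  finally show ?thesis .
qed

lemma card_words:
  assumes "finite V" "finite P"
  shows "of_nat (card (words P V Dv)) = (fact (card P) *
    fps_nth (\<Prod>v\<in>V. Abs_fps (\<lambda>e. if e \<in> Dv v then 1 / fact e else 0)) (card P) :: complex)"
  using assms
proof (induction V arbitrary: P rule: finite_induct)
  case empty
  thus ?case by (cases "P = {}") (auto simp: words_def)
next
  case (insert v V)
  define F where "F = (\<Prod>v\<in>V. Abs_fps (\<lambda>e. if e \<in> Dv v then 1 / fact e else 0 :: complex))"
  define g where "g = (\<lambda>s. if s \<in> Dv v then fact (card P - s) * fps_nth F (card P - s) else 0)"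
  have "of_nat (card (words P (insert v V) Dv)) = (\<Sum>S\<in>Pow P. if card S \<in> Dv v then of_nat (card (words (P - S) V Dv)) else (0::complex))"
    unfolding card_words_insert[OF \<open>finite P\<close> insert(1,2)] of_nat_sum by (intro sum.cong) auto
  also have "\<dots> = (\<Sum>S\<in>Pow P. g (card S))"
  proof (intro sum.cong refl)
    fix S assume S: "S \<in> Pow P"
    have "card (P - S) = card P - card S" using S insert.prems finite_subset by (intro card_Diff_subset) auto
    thus "(if card S \<in> Dv v then of_nat (card (words (P - S) V Dv)) else 0) = g (card S)"
      using insert.IH[of "P - S"] insert.prems by (simp add: g_def F_def)
  qed
  also have "\<dots> = (\<Sum>s\<le>card P. of_nat (card P choose s) * g s)" by (rule sum_Pow_card[OF insert.prems])
  also have "\<dots> = (\<Sum>s\<le>card P. fact (card P) * ((if s \<in> Dv v then 1 / fact s else 0) * fps_nth F (card P - s)))"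
    by (intro sum.cong) (auto simp: g_def binomial_fact)
  also have "\<dots> = fact (card P) * fps_nth (Abs_fps (\<lambda>e. if e \<in> Dv v then 1 / fact e else 0) * F) (card P)"
    by (simp add: fps_mult_nth sum_distrib_left atMost_atLeast0)
  finally show ?case using insert by (simp add: F_def)
qed

text \<open>Once the positions in \<open>Q\<close> are set aside, a letter with \<open>a\<close>
  prescribed occurrences may occur \<open>e\<close> more times when \<open>e + a\<close> lies in
  \<open>D\<close>; the generating function of these \<open>e\<close> is the derivative of \<Delta>
  of order \<open>a\<close>.\<close>

lemma card_words_pattern:
  fixes D :: "nat set" and P :: "'p set" and V :: "'v set"
  assumes V: "finite V" and P: "finite P" and Q: "Q \<subseteq> P" and g: "\<And>q. q \<in> Q \<Longrightarrow> g q \<in> V"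
  shows "of_nat (card {w \<in> words P V (\<lambda>_. D). \<forall>q\<in>Q. w q = g q}) =
     fact (card P - card Q) * fps_nth (\<Prod>v\<in>V. egf D (card {q\<in>Q. g q = v})) (card P - card Q)"
proof -
  define Dv where "Dv = (\<lambda>v. {e. e + card {q\<in>Q. g q = v} \<in> D})"
  have fQ: "finite Q" using P Q finite_subset by blast
  define f where "f = (\<lambda>w :: 'p \<Rightarrow> 'v. restrict w (P - Q))"
  define h where "h = (\<lambda>(u :: 'p \<Rightarrow> 'v) q. if q \<in> Q then g q else u q)"
  have split: "card {p\<in>P. w p = v} = card {p\<in>P - Q. w p = v} + card {q\<in>Q. g q = v}" if "\<forall>q\<in>Q. w q = g q" for w v
  proof -
    have "{p\<in>P. w p = v} = {p\<in>P - Q. w p = v} \<union> {q\<in>Q. g q = v}" using that Q by auto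
    thus ?thesis using fQ P by (auto intro!: card_Un_disjoint)
  qed
  have "bij_betw f {w \<in> words P V (\<lambda>_. D). \<forall>q\<in>Q. w q = g q} (words (P - Q) V Dv)"
  proof (rule bij_betw_byWitness[where f' = h])
    show "\<forall>w\<in>{w \<in> words P V (\<lambda>_. D). \<forall>q\<in>Q. w q = g q}. h (f w) = w"
      using Q by (auto simp: f_def h_def words_def fun_eq_iff PiE_def extensional_def)
    show "\<forall>u\<in>words (P - Q) V Dv. f (h u) = u"
      by (auto simp: f_def h_def words_def fun_eq_iff PiE_def extensional_def)
    show "f ` {w \<in> words P V (\<lambda>_. D). \<forall>q\<in>Q. w q = g q} \<subseteq> words (P - Q) V Dv"
    proof (rule image_subsetI)
      fix w assume "w \<in> {w \<in> words P V (\<lambda>_. D). \<forall>q\<in>Q. w q = g q}"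
      hence w: "w \<in> words P V (\<lambda>_. D)" "\<forall>q\<in>Q. w q = g q" by auto
      have "card {p \<in> P - Q. f w p = v} = card {p \<in> P - Q. w p = v}" for v
        by (intro arg_cong[where f=card]) (auto simp: f_def)
      thus "f w \<in> words (P - Q) V Dv" using w split[OF w(2)] 
        by (auto simp: words_def f_def Dv_def PiE_def)
    qed
    show "h ` words (P - Q) V Dv \<subseteq> {w \<in> words P V (\<lambda>_. D). \<forall>q\<in>Q. w q = g q}"
    proof (rule image_subsetI)
      fix u assume u: "u \<in> words (P - Q) V Dv"
      have hq: "\<forall>q\<in>Q. h u q = g q" by (simp add: h_def)
      have "card {p \<in> P - Q. h u p = v} = card {p \<in> P - Q. u p = v}" for v
        by (intro arg_cong[where f=card]) (auto simp: h_def)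
      moreover have "h u \<in> P \<rightarrow>\<^sub>E V" using u g Q by (auto simp: words_def h_def PiE_def extensional_def)
      ultimately show "h u \<in> {w \<in> words P V (\<lambda>_. D). \<forall>q\<in>Q. w q = g q}"
        using u split[OF hq] hq by (auto simp: words_def Dv_def)
    qed
  qed
  hence "card {w \<in> words P V (\<lambda>_. D). \<forall>q\<in>Q. w q = g q} = card (words (P - Q) V Dv)"
    by (rule bij_betw_same_card)
  thus ?thesis using card_words[OF V, of "P - Q" Dv] P card_Diff_subset[OF fQ Q]
    by (simp add: Dv_def egf_def)
qed

section \<open>Cycles in words\<close>

definition opp :: "nat \<times> bool \<Rightarrow> nat \<times> bool" where
  "opp p = (fst p, \<not> snd p)"

lemma opp_simps [simp]: "fst (opp p) = fst p" "opp (opp p) = p" "opp p \<noteq> p" "p \<noteq> opp p"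
  by (auto simp: opp_def prod_eq_iff)

lemma fst_eq_cases: "fst p = fst q \<Longrightarrow> p = q \<or> p = opp q"
  by (cases p; cases q) (auto simp: opp_def)

definition letters :: "(nat \<times> bool \<Rightarrow> 'v) \<Rightarrow> nat set \<Rightarrow> 'v set" where
  "letters w A = w ` (A \<times> UNIV)"

text \<open>A slot \<open>s\<close> carries the edge joining \<open>w (s, False)\<close> and \<open>w (s, True)\<close>. A rooted oriented cycle on
  the slot set \<open>C\<close> is the sequence of the positions at which its slots are entered; lengths one (loops)
  and two (double edges) are included.\<close>
definition rooted_cycles :: "(nat \<times> bool \<Rightarrow> 'v) \<Rightarrow> nat \<Rightarrow> nat set \<Rightarrow> (nat \<Rightarrow> nat \<times> bool) set" where
  "rooted_cycles w j C = {c \<in> {..<j} \<rightarrow>\<^sub>E C \<times> UNIV. inj_on (\<lambda>x. fst (c x)) {..<j} \<and> (\<lambda>x. fst (c x)) ` {..<j} = C \<and>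
     (\<forall>x<j. w (opp (c x)) = w (c (Suc x mod j))) \<and> inj_on (\<lambda>x. w (c x)) {..<j}}"

text \<open>Cycles are counted as slot sets, free of root and orientation, so that each cycle of a
  simple word is counted once, as in the graph.\<close>

definition cyc :: "(nat \<times> bool \<Rightarrow> 'v) \<Rightarrow> nat set \<Rightarrow> bool" where
  "cyc w C \<longleftrightarrow> finite C \<and> C \<noteq> {} \<and> rooted_cycles w (card C) C \<noteq> {}"

lemma letters_Un: "letters w (A \<union> B) = letters w A \<union> letters w B"
  by (auto simp: letters_def)

lemma finite_letters [simp]: "finite A \<Longrightarrow> finite (letters w A)"
  by (simp add: letters_def)

lemma letters_empty [simp]: "letters w {} = {}"
  by (simp add: letters_def)

lemma letters_mono: "A \<subseteq> B \<Longrightarrow> letters w A \<subseteq> letters w B"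
  by (auto simp: letters_def)

lemma letters_eq_empty [simp]: "letters w A = {} \<longleftrightarrow> A = {}"
  by (auto simp: letters_def)

context
  fixes w :: "nat \<times> bool \<Rightarrow> 'v" and j :: nat and C :: "nat set" and c
  assumes c: "c \<in> rooted_cycles w j C" and j: "j > 0"
begin

lemma rooted_cyclesD:
  shows "\<And>x. x < j \<Longrightarrow> fst (c x) \<in> C"
    and "\<And>x y. x < j \<Longrightarrow> y < j \<Longrightarrow> fst (c x) = fst (c y) \<Longrightarrow> x = y"
    and "(\<lambda>x. fst (c x)) ` {..<j} = C"
    and "\<And>x. x < j \<Longrightarrow> w (opp (c x)) = w (c (Suc x mod j))"
    and "\<And>x y. x < j \<Longrightarrow> y < j \<Longrightarrow> w (c x) = w (c y) \<Longrightarrow> x = y"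
    and "\<And>x. \<not> x < j \<Longrightarrow> c x = undefined"
proof -
  have 1: "c \<in> {..<j} \<rightarrow>\<^sub>E C \<times> UNIV" and 2: "inj_on (\<lambda>x. fst (c x)) {..<j}" and 3: "(\<lambda>x. fst (c x)) ` {..<j} = C"
    and 4: "\<forall>x<j. w (opp (c x)) = w (c (Suc x mod j))" and 5: "inj_on (\<lambda>x. w (c x)) {..<j}"
    using c by (auto simp: rooted_cycles_def)
  show "fst (c x) \<in> C" if "x < j" for x using 3 that by blast
  show "x = y" if "x < j" "y < j" "fst (c x) = fst (c y)" for x y using inj_onD[OF 2 that(3)] that by auto
  show "(\<lambda>x. fst (c x)) ` {..<j} = C" by fact
  show "w (opp (c x)) = w (c (Suc x mod j))" if "x < j" for x using 4 that by blast
  show "x = y" if "x < j" "y < j" "w (c x) = w (c y)" for x y using inj_onD[OF 5 that(3)] that by auto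
  show "c x = undefined" if "\<not> x < j" for x using 1 that by (auto simp: PiE_def extensional_def)
qed

lemma card_rooted: "card C = j"
proof -
  have "inj_on (\<lambda>x. fst (c x)) {..<j}" using rooted_cyclesD(2) by (auto intro!: inj_onI)
  from card_image[OF this] show ?thesis by (simp add: rooted_cyclesD(3))
qed

lemma position_cases:
  assumes "p \<in> C \<times> UNIV"
  obtains x where "x < j" "p = c x" | x where "x < j" "p = opp (c x)"
proof -
  have "fst p \<in> (\<lambda>x. fst (c x)) ` {..<j}" using assms rooted_cyclesD(3) by auto
  then obtain x where x: "x < j" "fst p = fst (c x)" by auto
  from fst_eq_cases[OF x(2)] show ?thesis using that x(1) by blast
qed

text \<open>The far end of each slot carries the letter at which the next slot is entered, so
  \<open>B\<close> sees the entries of its own slots and those of their successors.\<close>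

lemma letters_sub:
  assumes "B \<subseteq> C"
  shows "letters w B = (\<lambda>x. w (c x)) ` ({x. x < j \<and> fst (c x) \<in> B} \<union> (\<lambda>x. Suc x mod j) ` {x. x < j \<and> fst (c x) \<in> B})"
    (is "_ = ?R")
proof
  show "letters w B \<subseteq> ?R"
  proof
    fix l assume "l \<in> letters w B"
    then obtain p where p: "p \<in> B \<times> UNIV" "l = w p" by (auto simp: letters_def)
    hence "p \<in> C \<times> UNIV" using assms by auto
    thus "l \<in> ?R"
    proof (cases rule: position_cases)
      case (1 x)
      hence "x \<in> {x. x < j \<and> fst (c x) \<in> B}" using p by (auto simp: mem_Times_iff)
      thus ?thesis using 1 p(2) by blast
    next
      case (2 x)
      hence "x \<in> {x. x < j \<and> fst (c x) \<in> B}" using p by (auto simp: mem_Times_iff)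
      moreover have "l = w (c (Suc x mod j))" using 2 p(2) rooted_cyclesD(4) by simp
      ultimately show ?thesis by blast
    qed
  qed
  show "?R \<subseteq> letters w B"
  proof
    fix l assume "l \<in> ?R"
    then obtain x where x: "x < j" "fst (c x) \<in> B" "l = w (c x) \<or> l = w (opp (c x))"
      using rooted_cyclesD(4) by auto
    thus "l \<in> letters w B" unfolding letters_def
      by (metis (no_types) UNIV_I imageI mem_Sigma_iff opp_simps(1) prod.collapse)
  qed
qed

lemma letters_rooted: "letters w C = (\<lambda>x. w (c x)) ` {..<j}"
proof -
  have "{x. x < j \<and> fst (c x) \<in> C} = {..<j}" using rooted_cyclesD(1) by auto
  moreover have "(\<lambda>x. Suc x mod j) ` {..<j} \<subseteq> {..<j}" using j by auto
  ultimately show ?thesis using letters_sub[of C] by (simp add: Un_absorb2)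
qed

lemma card_letters_rooted: "card (letters w C) = j"
proof -
  have "inj_on (\<lambda>x. w (c x)) {..<j}" using rooted_cyclesD(5) by (auto intro!: inj_onI)
  thus ?thesis unfolding letters_rooted by (simp add: card_image)
qed

text \<open>A proper nonempty part of a cycle is a union of disjoint paths, and a path has one
  vertex more than it has edges.\<close>

lemma card_letters_proper:
  assumes B: "B \<subset> C" "B \<noteq> {}"
  shows "card B < card (letters w B)"
proof -
  define I where "I = {x. x < j \<and> fst (c x) \<in> B}"
  let ?s = "\<lambda>x. Suc x mod j"
  have IB: "(\<lambda>x. fst (c x)) ` I = B" using B rooted_cyclesD(3) by (auto simp: I_def)
  have "inj_on (\<lambda>x. fst (c x)) I" using rooted_cyclesD(2) by (auto intro!: inj_onI simp: I_def)
  hence cB: "card B = card I" using card_image IB by metis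
  have sub: "I \<union> ?s ` I \<subseteq> {..<j}" using j by (auto simp: I_def)
  have "inj_on (\<lambda>x. w (c x)) (I \<union> ?s ` I)"
    using sub rooted_cyclesD(5) by (intro inj_onI) auto
  hence cL: "card (letters w B) = card (I \<union> ?s ` I)"
    using letters_sub[of B] B by (simp add: I_def[symmetric] card_image)
  \<comment> \<open>A nonempty set of residues closed under the cyclic successor is everything, so a
    proper part gains at least one letter.\<close>
  have "\<not> ?s ` I \<subseteq> I"
  proof
    assume s: "?s ` I \<subseteq> I"
    obtain x0 where x0: "x0 \<in> I" using B IB by auto
    have step: "(x0 + k) mod j \<in> I" for k
    proof (induction k)
      case 0 thus ?case using x0 by (simp add: I_def)
    next
      case (Suc k)
      have "?s ((x0 + k) mod j) \<in> I" using Suc s by blast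
      thus ?case by (simp add: mod_Suc_eq)
    qed
    have "y \<in> I" if "y < j" for y
    proof -
      have "x0 < j" using x0 by (simp add: I_def)
      hence "(x0 + (j - x0 + y)) mod j = y" using that by simp
      thus ?thesis using step[of "j - x0 + y"] by simp
    qed
    hence "B = C" using B rooted_cyclesD(3) by (auto simp: I_def)
    thus False using B by simp
  qed
  hence "I \<subset> I \<union> ?s ` I" by auto
  hence "card I < card (I \<union> ?s ` I)" using sub finite_subset[OF sub] by (intro psubset_card_mono) auto
  thus ?thesis using cB cL by simp
qed

text \<open>On a cycle each letter sits at exactly two positions, the entry of a slot and the exit
  of the slot before it; a walk that has entered a slot therefore has no choice in
  continuing.\<close>

lemma same_letter:
  assumes p: "p \<in> C \<times> UNIV" "w p = w (c (Suc x))" and x: "Suc x < j"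
  shows "p = c (Suc x) \<or> p = opp (c x)"
  using p(1)
proof (cases rule: position_cases)
  case (1 y)
  thus ?thesis using rooted_cyclesD(5)[of y "Suc x"] p x by auto
next
  case (2 y)
  hence "w (c (Suc y mod j)) = w (c (Suc x))" using p rooted_cyclesD(4)[of y] by simp
  hence "Suc y mod j = Suc x" using rooted_cyclesD(5)[of "Suc y mod j" "Suc x"] x j by auto
  hence "y = x" using 2(1) x by (cases "Suc y = j") auto
  thus ?thesis using 2 by auto
qed

lemma rotate_rooted: "(\<lambda>x\<in>{..<j}. c ((x + z) mod j)) \<in> rooted_cycles w j C"
proof -
  have inj: "x = y" if "x < j" "y < j" "(x + z) mod j = (y + z) mod j" for x y
  proof -
    note t = that
    obtain q1 q2 where "x + z + j * q1 = y + z + j * q2" using t(3) unfolding nat_mod_eq_iff by blast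
    hence "x + j * q1 = y + j * q2" by simp
    hence "x mod j = y mod j" unfolding nat_mod_eq_iff by blast
    thus ?thesis using t by simp
  qed
  have surj: "\<exists>x<j. (x + z) mod j = y" if "y < j" for y
  proof -
    have "inj_on (\<lambda>x. (x + z) mod j) {..<j}" using inj by (auto intro!: inj_onI)
    moreover have "(\<lambda>x. (x + z) mod j) ` {..<j} \<subseteq> {..<j}" using j by auto
    ultimately have "(\<lambda>x. (x + z) mod j) ` {..<j} = {..<j}" by (intro endo_inj_surj) auto
    thus ?thesis using that by (metis (no_types, lifting) image_iff lessThan_iff)
  qed
  have lt: "(x + z) mod j < j" for x using j by simp
  have fi: "x = y" if "x < j" "y < j" "fst (c ((x + z) mod j)) = fst (c ((y + z) mod j))" for x y
    using inj[OF that(1,2) rooted_cyclesD(2)[OF lt lt that(3)]] .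
  have wi: "x = y" if "x < j" "y < j" "w (c ((x + z) mod j)) = w (c ((y + z) mod j))" for x y
    using inj[OF that(1,2) rooted_cyclesD(5)[OF lt lt that(3)]] .
  have s: "w (opp (c ((x + z) mod j))) = w (c ((Suc x mod j + z) mod j))" for x
    using rooted_cyclesD(4)[OF lt[of x]] by (simp add: mod_simps)
  show ?thesis unfolding rooted_cycles_def
  proof (intro CollectI conjI)
    show "(\<lambda>x\<in>{..<j}. c ((x + z) mod j)) \<in> {..<j} \<rightarrow>\<^sub>E C \<times> UNIV"
      using rooted_cyclesD(1)[OF lt] by (auto simp: mem_Times_iff)
    show "inj_on (\<lambda>x. fst ((\<lambda>x\<in>{..<j}. c ((x + z) mod j)) x)) {..<j}"
      by (rule inj_onI, rule fi) auto
    show "inj_on (\<lambda>x. w ((\<lambda>x\<in>{..<j}. c ((x + z) mod j)) x)) {..<j}"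
      by (rule inj_onI, rule wi) auto
    show "(\<lambda>x. fst ((\<lambda>x\<in>{..<j}. c ((x + z) mod j)) x)) ` {..<j} = C"
    proof
      show "(\<lambda>x. fst ((\<lambda>x\<in>{..<j}. c ((x + z) mod j)) x)) ` {..<j} \<subseteq> C" using rooted_cyclesD(1)[OF lt] by auto
      show "C \<subseteq> (\<lambda>x. fst ((\<lambda>x\<in>{..<j}. c ((x + z) mod j)) x)) ` {..<j}"
      proof
        fix s assume "s \<in> C"
        then obtain y where y: "y < j" "s = fst (c y)" using rooted_cyclesD(3) by auto
        then obtain x where "x < j" "(x + z) mod j = y" using surj by blast
        thus "s \<in> (\<lambda>x. fst ((\<lambda>x\<in>{..<j}. c ((x + z) mod j)) x)) ` {..<j}" using y by (intro image_eqI[of _ _ x]) auto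
      qed
    qed
    show "\<forall>x<j. w (opp ((\<lambda>x\<in>{..<j}. c ((x + z) mod j)) x)) = w ((\<lambda>x\<in>{..<j}. c ((x + z) mod j)) (Suc x mod j))"
      using s j by simp
  qed
qed

text \<open>Read backwards, a slot is entered at its other end. The index
  \<open>(j - x) mod j\<close> keeps the root slot in front, so the reversed cycle starts at
  \<open>opp (c 0)\<close>.\<close>

lemma reverse_rooted: "(\<lambda>x\<in>{..<j}. opp (c ((j - x) mod j))) \<in> rooted_cycles w j C"
proof -
  have val: "(j - x) mod j = (if x = 0 then 0 else j - x)" if "x < j" for x using that by auto
  have inj: "x = y" if "x < j" "y < j" "(j - x) mod j = (j - y) mod j" for x y
    using that by (auto simp: val split: if_splits)
  have surj: "\<exists>x<j. (j - x) mod j = y" if "y < j" for y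
    using that by (intro exI[of _ "(j - y) mod j"]) (auto simp: val)
  have lt: "(j - x) mod j < j" "Suc ((j - x) mod j) mod j < j" for x using j by auto
  have key: "Suc ((j - Suc x mod j) mod j) mod j = (j - x) mod j" if "x < j" for x
  proof (cases "Suc x = j")
    case True
    hence "j - x = 1" by auto
    thus ?thesis using True by simp
  next
    case False
    hence "Suc x < j" using that by auto
    hence "(j - Suc x mod j) mod j = j - Suc x" by auto
    moreover have "Suc (j - Suc x) = j - x" using that by auto
    ultimately show ?thesis by simp
  qed
  have fi: "x = y" if "x < j" "y < j" "fst (c ((j - x) mod j)) = fst (c ((j - y) mod j))" for x y
    using inj[OF that(1,2) rooted_cyclesD(2)[OF lt(1) lt(1) that(3)]] .
  have s: "w (opp (opp (c ((j - x) mod j)))) = w (opp (c ((j - Suc x mod j) mod j)))" if "x < j" for x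
    using rooted_cyclesD(4)[OF lt(1)[of "Suc x mod j"]] key[OF that] by simp
  have wi: "x = y" if "x < j" "y < j" "w (opp (c ((j - x) mod j))) = w (opp (c ((j - y) mod j)))" for x y
  proof -
    have "Suc ((j - x) mod j) mod j = Suc ((j - y) mod j) mod j"
      using that(3) rooted_cyclesD(4)[OF lt(1)] rooted_cyclesD(5)[OF lt(2) lt(2)] by metis
    moreover have "a = b" if "a < j" "b < j" "Suc a mod j = Suc b mod j" for a b
      using that by (cases "Suc a = j"; cases "Suc b = j") auto
    ultimately have "(j - x) mod j = (j - y) mod j" using lt(1) by blast
    thus ?thesis using inj that by blast
  qed
  show ?thesis unfolding rooted_cycles_def
  proof (intro CollectI conjI)
    show "(\<lambda>x\<in>{..<j}. opp (c ((j - x) mod j))) \<in> {..<j} \<rightarrow>\<^sub>E C \<times> UNIV"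
      using rooted_cyclesD(1)[OF lt(1)] by (auto simp: mem_Times_iff)
    show "inj_on (\<lambda>x. fst ((\<lambda>x\<in>{..<j}. opp (c ((j - x) mod j))) x)) {..<j}"
      by (rule inj_onI, rule fi) auto
    show "inj_on (\<lambda>x. w ((\<lambda>x\<in>{..<j}. opp (c ((j - x) mod j))) x)) {..<j}"
      by (rule inj_onI, rule wi) auto
    show "(\<lambda>x. fst ((\<lambda>x\<in>{..<j}. opp (c ((j - x) mod j))) x)) ` {..<j} = C"
    proof
      show "(\<lambda>x. fst ((\<lambda>x\<in>{..<j}. opp (c ((j - x) mod j))) x)) ` {..<j} \<subseteq> C" using rooted_cyclesD(1)[OF lt(1)] by auto
      show "C \<subseteq> (\<lambda>x. fst ((\<lambda>x\<in>{..<j}. opp (c ((j - x) mod j))) x)) ` {..<j}"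
      proof
        fix s assume "s \<in> C"
        then obtain y where y: "y < j" "s = fst (c y)" using rooted_cyclesD(3) by auto
        then obtain x where "x < j" "(j - x) mod j = y" using surj by blast
        thus "s \<in> (\<lambda>x. fst ((\<lambda>x\<in>{..<j}. opp (c ((j - x) mod j))) x)) ` {..<j}" using y by (intro image_eqI[of _ _ x]) auto
      qed
    qed
    show "\<forall>x<j. w (opp ((\<lambda>x\<in>{..<j}. opp (c ((j - x) mod j))) x)) = w ((\<lambda>x\<in>{..<j}. opp (c ((j - x) mod j))) (Suc x mod j))"
      using s j by simp
  qed
qed

end

text \<open>A rooted oriented cycle is determined by its first position, which is arbitrary.\<close>
lemma card_rooted_cycles:
  assumes c: "c \<in> rooted_cycles w j C" and j: "j > 0"
  shows "card (rooted_cycles w j C) = 2 * j"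
proof -
  have "bij_betw (\<lambda>c. c 0) (rooted_cycles w j C) (C \<times> UNIV)"
  proof (rule bij_betw_imageI)
    show "inj_on (\<lambda>c. c 0) (rooted_cycles w j C)"
    proof (rule inj_onI)
      fix c c' assume cc: "c \<in> rooted_cycles w j C" "c' \<in> rooted_cycles w j C" "c 0 = c' 0"
      have "x < j \<longrightarrow> c x = c' x" for x
      proof (induction x)
        case (Suc x)
        show ?case
        proof
          assume x: "Suc x < j"
          hence eq: "c x = c' x" using Suc by simp
          have "w (c' (Suc x)) = w (opp (c' x))" using rooted_cyclesD(4)[OF cc(2) j, of x] x by simp
          also have "\<dots> = w (c (Suc x))" using rooted_cyclesD(4)[OF cc(1) j, of x] x eq by simp
          finally have "c' (Suc x) = c (Suc x) \<or> c' (Suc x) = opp (c x)"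
            using rooted_cyclesD(1)[OF cc(2) j x] by (intro same_letter[OF cc(1) j _ _ x]) (auto simp: mem_Times_iff)
          \<comment> \<open>\<open>opp (c x)\<close> lies in the slot just traversed, and the slots
            of a cycle are distinct.\<close>
          moreover have "c' (Suc x) \<noteq> opp (c x)"
            using rooted_cyclesD(2)[OF cc(2) j, of "Suc x" x] x eq by auto
          ultimately show "c (Suc x) = c' (Suc x)" by simp
        qed
      qed (use cc in simp)
      thus "c = c'" using rooted_cyclesD(6)[OF cc(1) j] rooted_cyclesD(6)[OF cc(2) j] by (metis ext)
    qed
    show "(\<lambda>c. c 0) ` rooted_cycles w j C = C \<times> UNIV"
    proof
      show "(\<lambda>c. c 0) ` rooted_cycles w j C \<subseteq> C \<times> UNIV"
        by (rule image_subsetI) (simp add: mem_Times_iff rooted_cyclesD(1)[OF _ j j])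
      show "C \<times> UNIV \<subseteq> (\<lambda>c. c 0) ` rooted_cycles w j C"
      proof
        fix p :: "nat \<times> bool" assume "p \<in> C \<times> UNIV"
        then consider z where "z < j" "p = c z" | z where "z < j" "p = opp (c z)"
          using position_cases[OF c j, of p] by blast
        thus "p \<in> (\<lambda>c. c 0) ` rooted_cycles w j C"
        proof cases
          case (1 z)
          thus ?thesis using rotate_rooted[OF c j, of z] j by (intro image_eqI) auto
        next
          case (2 z)
          thus ?thesis using reverse_rooted[OF rotate_rooted[OF c j, of z] j] j by (intro image_eqI) auto
        qed
      qed
    qed
  qed
  hence "card (rooted_cycles w j C) = card (C \<times> (UNIV :: bool set))" by (rule bij_betw_same_card)
  thus ?thesis using card_rooted[OF c j] by (simp add: card_cartesian_product)
qed

lemma cyc_facts: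
  assumes "cyc w C"
  shows "finite C" "C \<noteq> {}" "card C > 0" "card (letters w C) = card C" "card (rooted_cycles w (card C) C) = 2 * card C"
    "\<And>B. B \<subset> C \<Longrightarrow> B \<noteq> {} \<Longrightarrow> card B < card (letters w B)"
proof -
  show f: "finite C" "C \<noteq> {}" using assms by (auto simp: cyc_def)
  thus p: "card C > 0" by (simp add: card_gt_0_iff)
  obtain c where c: "c \<in> rooted_cycles w (card C) C" using assms by (auto simp: cyc_def)
  show "card (letters w C) = card C" using card_letters_rooted[OF c p] .
  show "card (rooted_cycles w (card C) C) = 2 * card C" using card_rooted_cycles[OF c p] .
  show "\<And>B. B \<subset> C \<Longrightarrow> B \<noteq> {} \<Longrightarrow> card B < card (letters w B)" using card_letters_proper[OF c p] .
qed

section \<open>Overlapping cycles\<close>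

definition deficient :: "(nat \<times> bool \<Rightarrow> 'v) \<Rightarrow> nat set \<Rightarrow> bool" where
  "deficient w A \<longleftrightarrow> card (letters w A) < card A"

text \<open>A cycle has as many letters as slots, so by inclusion and exclusion adding
  \<open>C\<close> changes the balance, letters minus slots, by \<open>i - k\<close>, the shared
  slots minus the shared letters. A proper nonempty part of \<open>C\<close> has more letters than
  slots, whence \<open>i < k\<close> when slots are shared; sharing letters only gives
  \<open>i = 0 < k\<close>.\<close>

lemma cyc_union_step:
  assumes U: "finite U" and C: "cyc w C"
    and h: "deficient w U \<or> (card (letters w U) \<le> card U \<and> \<not> C \<subseteq> U \<and> letters w U \<inter> letters w C \<noteq> {})"
  shows "deficient w (U \<union> C)"
proof (cases "C \<subseteq> U")
  case True
  thus ?thesis using h by (auto simp: Un_absorb2)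
next
  case False
  note cf = cyc_facts[OF C]
  define k where "k = card (letters w U \<inter> letters w C)"
  define i where "i = card (U \<inter> C)"
  have 1: "card (letters w (U \<union> C)) + k = card (letters w U) + card C"
    unfolding letters_Un k_def cf(4)[symmetric] using U cf(1) by (intro card_Un_Int[symmetric]) auto
  have 2: "card (U \<union> C) + i = card U + card C"
    unfolding i_def using U cf(1) by (intro card_Un_Int[symmetric]) auto
  have 3: "i < k \<or> U \<inter> C = {}"
  proof (cases "U \<inter> C = {}")
    case ne: False
    have "card (U \<inter> C) < card (letters w (U \<inter> C))" using False ne by (intro cf(6)) auto
    also have "\<dots> \<le> k" unfolding k_def using U cf(1) by (intro card_mono) (auto simp: letters_def)
    finally show ?thesis by (simp add: i_def)
  qed simp
  hence 4: "i \<le> k" by (auto simp: i_def)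
  from h show ?thesis
  proof
    assume "deficient w U"
    thus ?thesis using 1 2 4 by (simp add: deficient_def)
  next
    assume *: "card (letters w U) \<le> card U \<and> \<not> C \<subseteq> U \<and> letters w U \<inter> letters w C \<noteq> {}"
    hence "k > 0" using U by (simp add: k_def card_gt_0_iff)
    hence "i < k" using 3 by (auto simp: i_def)
    thus ?thesis using 1 2 * by (simp add: deficient_def)
  qed
qed

text \<open>Two different cycles are not nested, since a proper part of a cycle has more letters
  than slots while a cycle has equally many. The union of two that touch is therefore deficient, and
  it stays so when further cycles are added.\<close>

lemma deficient_Union:
  assumes F: "finite F" "\<And>C. C \<in> F \<Longrightarrow> cyc w C" and AB: "A \<in> F" "B \<in> F" "A \<noteq> B" "letters w A \<inter> letters w B \<noteq> {}"
  shows "deficient w (\<Union>F)"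
proof -
  note A = cyc_facts[OF F(2)[OF AB(1)]] and B = cyc_facts[OF F(2)[OF AB(2)]]
  have "\<not> B \<subseteq> A"
  proof
    assume "B \<subseteq> A"
    hence "card B < card (letters w B)" using AB(3) B(2) by (intro A(6)) auto
    thus False using B(4) by simp
  qed
  hence AB': "deficient w (A \<union> B)" using AB A by (intro cyc_union_step F(2)) auto
  have "deficient w (A \<union> B \<union> \<Union>G)" if "finite G" "G \<subseteq> F" for G
    using that
  proof (induction G rule: finite_induct)
    case (insert C G)
    have "finite (A \<union> B \<union> \<Union>G)" using insert A(1) B(1) cyc_facts(1)[OF F(2)] by auto
    hence "deficient w ((A \<union> B \<union> \<Union>G) \<union> C)" using insert by (intro cyc_union_step F(2)) auto
    moreover have "(A \<union> B \<union> \<Union>G) \<union> C = A \<union> B \<union> \<Union>(insert C G)" by auto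
    ultimately show ?case by simp
  qed (use AB' in simp)
  from this[of F] have "deficient w (A \<union> B \<union> \<Union>F)" using F by simp
  moreover have "A \<union> B \<union> \<Union>F = \<Union>F" using AB by auto
  ultimately show ?thesis by simp
qed

section \<open>Counting words that contain given disjoint cycles\<close>

definition pos :: "nat \<Rightarrow> (nat \<times> bool) set" where
  "pos m = {..<m} \<times> UNIV"

lemma finite_pos [simp]: "finite (pos m)" and card_pos [simp]: "card (pos m) = 2 * m"
  by (auto simp: pos_def card_cartesian_product)

lemma mem_pos_iff: "p \<in> pos m \<longleftrightarrow> fst p < m"
  by (cases p) (auto simp: pos_def)

definition slot_placements :: "nat \<Rightarrow> 'i set \<Rightarrow> ('i \<Rightarrow> nat \<times> bool) set" where
  "slot_placements m I = {ps \<in> I \<rightarrow>\<^sub>E pos m. inj_on (\<lambda>i. fst (ps i)) I}"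

text \<open>All rooted cycles of a family at once: \<open>\<tau>\<close> steps along each cycle,
  with one orbit for each, and distinctness of the letters over the whole of \<open>I\<close> makes
  the cycles vertex-disjoint.\<close>

definition systems :: "(nat \<times> bool \<Rightarrow> 'v) \<Rightarrow> nat \<Rightarrow> 'i set \<Rightarrow> ('i \<Rightarrow> 'i) \<Rightarrow> ('i \<Rightarrow> nat \<times> bool) set" where
  "systems w m I \<tau> = {ps \<in> slot_placements m I. (\<forall>i\<in>I. w (opp (ps i)) = w (ps (\<tau> i))) \<and> inj_on (\<lambda>i. w (ps i)) I}"

lemma finite_slot_placements [simp]: "finite I \<Longrightarrow> finite (slot_placements m I)"
  by (rule finite_subset[of _ "I \<rightarrow>\<^sub>E pos m"]) (auto simp: slot_placements_def intro: finite_PiE)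

lemma finite_inj_PiE [simp]: "finite I \<Longrightarrow> finite V \<Longrightarrow> finite {v \<in> I \<rightarrow>\<^sub>E V. inj_on v I}"
  by (rule finite_subset[of _ "I \<rightarrow>\<^sub>E V"]) (auto intro: finite_PiE)

lemma card_slot_placements:
  assumes "finite I"
  shows "card (slot_placements m I) = 2 ^ card I * card {s \<in> I \<rightarrow>\<^sub>E {..<m}. inj_on s I}"
proof -
  define f where "f = (\<lambda>ps. (restrict (\<lambda>i. fst (ps i :: nat \<times> bool)) I, restrict (\<lambda>i. snd (ps i)) I))"
  define g where "g = (\<lambda>(s, b). restrict (\<lambda>i. (s i :: nat, b i :: bool)) I)"
  have "bij_betw f (slot_placements m I) ({s \<in> I \<rightarrow>\<^sub>E {..<m}. inj_on s I} \<times> (I \<rightarrow>\<^sub>E UNIV))"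
  proof (rule bij_betw_byWitness[where f' = g])
    show "\<forall>ps\<in>slot_placements m I. g (f ps) = ps"
      by (auto simp: f_def g_def slot_placements_def fun_eq_iff PiE_def extensional_def)
    show "\<forall>z\<in>{s \<in> I \<rightarrow>\<^sub>E {..<m}. inj_on s I} \<times> (I \<rightarrow>\<^sub>E UNIV). f (g z) = z"
      by (auto simp: f_def g_def fun_eq_iff PiE_def extensional_def)
    show "f ` slot_placements m I \<subseteq> {s \<in> I \<rightarrow>\<^sub>E {..<m}. inj_on s I} \<times> (I \<rightarrow>\<^sub>E UNIV)"
      by (auto simp: f_def slot_placements_def pos_def inj_on_def PiE_def Pi_def mem_Times_iff)
    show "g ` ({s \<in> I \<rightarrow>\<^sub>E {..<m}. inj_on s I} \<times> (I \<rightarrow>\<^sub>E UNIV)) \<subseteq> slot_placements m I"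
      by (auto simp: g_def slot_placements_def pos_def inj_on_def PiE_def Pi_def)
  qed
  hence "card (slot_placements m I) = card ({s \<in> I \<rightarrow>\<^sub>E {..<m}. inj_on s I} \<times> (I \<rightarrow>\<^sub>E (UNIV :: bool set)))"
    by (rule bij_betw_same_card)
  thus ?thesis using assms by (simp add: card_cartesian_product card_funcsetE)
qed

text \<open>Every prescribed letter is met exactly twice, at \<open>ps i\<close> and at the far end
  of the slot of the predecessor of \<open>i\<close> under \<tau>. Hence \<open>card I\<close>
  factors are second derivatives, and the count depends neither on the placement nor on the
  letters.\<close>

lemma card_words_system:
  fixes V :: "'v set" and D :: "nat set"
  assumes I: "finite I" and \<tau>: "bij_betw \<tau> I I" and V: "finite V"
    and ps: "ps \<in> slot_placements m I" and v: "v \<in> I \<rightarrow>\<^sub>E V" "inj_on v I"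
  shows "of_nat (card {w \<in> words (pos m) V (\<lambda>_. D). \<forall>i\<in>I. w (ps i) = v i \<and> w (opp (ps i)) = v (\<tau> i)}) =
     fact (2 * m - 2 * card I) * fps_nth (egf D 2 ^ card I * egf D 0 ^ (card V - card I)) (2 * m - 2 * card I)"
proof -
  have pinj: "i = k" if "i \<in> I" "k \<in> I" "fst (ps i) = fst (ps k)" for i k
    using ps that by (auto simp: slot_placements_def inj_on_def)
  have ppos: "ps i \<in> pos m" if "i \<in> I" for i using ps that by (auto simp: slot_placements_def)
  define Q where "Q = ps ` I \<union> opp ` ps ` I"
  define g where "g = (\<lambda>q. if q \<in> ps ` I then v (inv_into I ps q) else v (\<tau> (inv_into I ps (opp q))))"
  have injps: "inj_on ps I" using pinj by (auto intro!: inj_onI)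
  have injop: "inj_on opp A" for A by (rule inj_on_inverseI[of _ opp]) simp
  have nops: "opp (ps i) \<noteq> ps k" if "i \<in> I" "k \<in> I" for i k
  proof
    assume eq: "opp (ps i) = ps k"
    hence "fst (ps i) = fst (ps k)" by (metis opp_simps(1))
    hence "i = k" using pinj that by blast
    thus False using eq by simp
  qed
  have g1: "g (ps i) = v i" if "i \<in> I" for i using that injps by (simp add: g_def inv_into_f_f)
  have g2: "g (opp (ps i)) = v (\<tau> i)" if "i \<in> I" for i
  proof -
    have "opp (ps i) \<notin> ps ` I" using nops that by auto
    thus ?thesis using that injps by (simp add: g_def inv_into_f_f)
  qed
  have \<tau>I: "\<tau> i \<in> I" if "i \<in> I" for i using \<tau> that by (auto simp: bij_betw_def)
  have vV: "v i \<in> V" if "i \<in> I" for i using v(1) that by auto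
  have QP: "Q \<subseteq> pos m" using ppos by (auto simp: Q_def mem_pos_iff)
  have gV: "g q \<in> V" if "q \<in> Q" for q using that g1 g2 \<tau>I vV by (auto simp: Q_def)
  have cQ: "card Q = 2 * card I"
  proof -
    have "ps ` I \<inter> opp ` ps ` I = {}"
    proof (rule equals0I)
      fix q assume q: "q \<in> ps ` I \<inter> opp ` ps ` I"
      obtain k where k: "k \<in> I" "q = ps k" using IntD1[OF q] by (rule imageE)
      obtain i where i: "i \<in> I" "q = opp (ps i)" using IntD2[OF q] unfolding image_image by (rule imageE)
      show False using nops[OF i(1) k(1)] k(2) i(2) by simp
    qed
    hence "card Q = card (ps ` I) + card (opp ` ps ` I)" unfolding Q_def
      using I by (intro card_Un_disjoint) auto
    thus ?thesis by (simp add: card_image injop injps)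
  qed
  have eq: "{w \<in> words (pos m) V (\<lambda>_. D). \<forall>i\<in>I. w (ps i) = v i \<and> w (opp (ps i)) = v (\<tau> i)} = {w \<in> words (pos m) V (\<lambda>_. D). \<forall>q\<in>Q. w q = g q}"
    using g1 g2 by (auto simp: Q_def)
  have mult: "card {q\<in>Q. g q = x} = (if x \<in> v ` I then 2 else 0)" for x
  proof (cases "x \<in> v ` I")
    case False
    hence "{q\<in>Q. g q = x} = {}" using g1 g2 \<tau>I by (auto simp: Q_def)
    thus ?thesis using False by (simp only: card.empty if_False)
  next
    case True
    then obtain i where i: "i \<in> I" "x = v i" by auto
    have "i \<in> \<tau> ` I" using \<tau> i(1) by (simp add: bij_betw_def)
    then obtain k where k: "k \<in> I" "\<tau> k = i" by (metis imageE)
    have vi: "v a = v b \<longleftrightarrow> a = b" if "a \<in> I" "b \<in> I" for a b using v(2) that by (auto simp: inj_on_def)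
    have ti: "\<tau> a = \<tau> b \<longleftrightarrow> a = b" if "a \<in> I" "b \<in> I" for a b using \<tau> that by (auto simp: bij_betw_def inj_on_def)
    have "{q\<in>Q. g q = x} = {ps i, opp (ps k)}"
    proof
      show "{q \<in> Q. g q = x} \<subseteq> {ps i, opp (ps k)}"
      proof
        fix q assume "q \<in> {q \<in> Q. g q = x}"
        then consider a where "a \<in> I" "q = ps a" "g q = x" | a where "a \<in> I" "q = opp (ps a)" "g q = x"
          by (auto simp: Q_def)
        thus "q \<in> {ps i, opp (ps k)}"
        proof cases
          case (1 a)
          hence "a = i" using g1 vi i by auto
          thus ?thesis using 1 by simp
        next
          case (2 a)
          hence "\<tau> a = \<tau> k" using g2 vi i \<tau>I k by auto
          hence "a = k" using ti 2 k by auto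
          thus ?thesis using 2 by simp
        qed
      qed
      show "{ps i, opp (ps k)} \<subseteq> {q \<in> Q. g q = x}" using i k g1 g2 by (auto simp: Q_def)
    qed
    moreover have "ps i \<noteq> opp (ps k)" using nops[OF k(1) i(1)] by metis
    ultimately show ?thesis using True by simp
  qed
  have vI: "v ` I \<subseteq> V" "card (v ` I) = card I" using vV v(2) by (auto simp: card_image)
  have "(\<Prod>x\<in>V. egf D (card {q\<in>Q. g q = x})) = (\<Prod>x\<in>V. if x \<in> v ` I then egf D 2 else egf D 0)"
    unfolding mult by (intro prod.cong) auto
  also have "\<dots> = (\<Prod>x\<in>V \<inter> {x. x \<in> v ` I}. egf D 2) * (\<Prod>x\<in>V \<inter> - {x. x \<in> v ` I}. egf D 0)"
    by (rule prod.If_cases[OF V])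
  also have "V \<inter> {x. x \<in> v ` I} = v ` I" using vI by auto
  also have "V \<inter> - {x. x \<in> v ` I} = V - v ` I" by auto
  also have "(\<Prod>x\<in>v ` I. egf D 2) * (\<Prod>x\<in>V - v ` I. egf D 0) = egf D 2 ^ card I * egf D 0 ^ (card V - card I)"
    using vI I by (simp add: card_Diff_subset)
  finally have pr: "(\<Prod>x\<in>V. egf D (card {q\<in>Q. g q = x})) = egf D 2 ^ card I * egf D 0 ^ (card V - card I)" .
  have "of_nat (card {w \<in> words (pos m) V (\<lambda>_. D). \<forall>q\<in>Q. w q = g q}) =
     fact (card (pos m) - card Q) * fps_nth (\<Prod>v\<in>V. egf D (card {q\<in>Q. g q = v})) (card (pos m) - card Q)"
    by (rule card_words_pattern[OF V finite_pos QP]) (rule gV)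
  thus ?thesis unfolding eq pr cQ card_pos .
qed

text \<open>Pairs of a word and a system are counted twice, the second time grouped by the placement
  and then by the letters read along it; all groups have the size given by
  \<open>card_words_system\<close>.\<close>

lemma sum_card_systems:
  fixes V :: "'v set" and D :: "nat set" and I :: "'i set"
  assumes I: "finite I" and \<tau>: "bij_betw \<tau> I I" and V: "finite V"
  shows "of_nat (\<Sum>w\<in>words (pos m) V (\<lambda>_. D). card (systems w m I \<tau>)) =
     of_nat (card (slot_placements m I) * card {v \<in> I \<rightarrow>\<^sub>E V. inj_on v I}) *
     (fact (2 * m - 2 * card I) * fps_nth (egf D 2 ^ card I * egf D 0 ^ (card V - card I)) (2 * m - 2 * card I))"
    (is "_ = _ * ?K")
proof -
  let ?W = "words (pos m) V (\<lambda>_. D)"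
  let ?Inj = "{v \<in> I \<rightarrow>\<^sub>E V. inj_on v I}"
  define R where "R = (\<lambda>(w :: nat \<times> bool \<Rightarrow> 'v) (ps :: 'i \<Rightarrow> nat \<times> bool). (\<forall>i\<in>I. w (opp (ps i)) = w (ps (\<tau> i))) \<and> inj_on (\<lambda>i. w (ps i)) I)"
  have \<tau>I: "\<tau> i \<in> I" if "i \<in> I" for i using \<tau> that by (auto simp: bij_betw_def)
  have fib: "of_nat (card {w\<in>?W. R w ps}) = of_nat (card ?Inj) * ?K" if ps: "ps \<in> slot_placements m I" for ps
  proof -
    define h where "h = (\<lambda>w :: nat \<times> bool \<Rightarrow> 'v. restrict (\<lambda>i. w (ps i)) I)"
    have ppos: "ps i \<in> pos m" if "i \<in> I" for i using ps that by (auto simp: slot_placements_def)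
    have "card {w\<in>?W. R w ps} = (\<Sum>w\<in>{w\<in>?W. R w ps}. 1)" by simp
    also have "\<dots> = (\<Sum>v\<in>?Inj. \<Sum>w\<in>{w\<in>{w\<in>?W. R w ps}. h w = v}. 1)"
    proof (rule sum.group[symmetric])
      show "h ` {w\<in>?W. R w ps} \<subseteq> ?Inj"
        using ppos by (auto simp: h_def R_def words_def inj_on_def)
    qed (use I V in auto)
    also have "\<dots> = (\<Sum>v\<in>?Inj. card {w\<in>?W. \<forall>i\<in>I. w (ps i) = v i \<and> w (opp (ps i)) = v (\<tau> i)})"
    proof (intro sum.cong refl)
      fix v assume v: "v \<in> ?Inj"
      have "{w\<in>{w\<in>?W. R w ps}. h w = v} = {w\<in>?W. \<forall>i\<in>I. w (ps i) = v i \<and> w (opp (ps i)) = v (\<tau> i)}"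
      proof safe
        fix w i assume "R w ps" "v = h w" "i \<in> I"
        thus "w (ps i) = h w i" "w (opp (ps i)) = h w (\<tau> i)" using \<tau>I by (auto simp: h_def R_def)
      next
        fix w assume w: "\<forall>i\<in>I. w (ps i) = v i \<and> w (opp (ps i)) = v (\<tau> i)"
        show "R w ps" using w \<tau>I v by (auto simp: R_def inj_on_def)
        show "h w = v" using w v by (auto simp: h_def fun_eq_iff PiE_def extensional_def)
      qed
      thus "(\<Sum>w\<in>{w\<in>{w\<in>?W. R w ps}. h w = v}. 1) = card {w\<in>?W. \<forall>i\<in>I. w (ps i) = v i \<and> w (opp (ps i)) = v (\<tau> i)}" by simp
    qed
    finally show ?thesis using card_words_system[OF I \<tau> V ps] by simp
  qed
  have "(\<Sum>w\<in>?W. card (systems w m I \<tau>)) = (\<Sum>w\<in>?W. \<Sum>ps\<in>{ps\<in>slot_placements m I. R w ps}. 1)"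
    by (simp add: systems_def R_def)
  also have "\<dots> = (\<Sum>ps\<in>slot_placements m I. \<Sum>w\<in>{w\<in>?W. R w ps}. 1)"
    using I V by (intro sum.swap_restrict) auto
  finally have "(\<Sum>w\<in>?W. card (systems w m I \<tau>)) = (\<Sum>ps\<in>slot_placements m I. card {w\<in>?W. R w ps})" by simp
  thus ?thesis by (simp add: fib)
qed

definition cycle_families :: "(nat \<times> bool \<Rightarrow> 'v) \<Rightarrow> nat \<Rightarrow> 't set \<Rightarrow> ('t \<Rightarrow> nat) \<Rightarrow> ('t \<Rightarrow> nat set) set" where
  "cycle_families w m T ty = {Cs \<in> T \<rightarrow>\<^sub>E Pow {..<m}. \<forall>t\<in>T. cyc w (Cs t) \<and> card (Cs t) = ty t}"

definition letter_disjoint :: "(nat \<times> bool \<Rightarrow> 'v) \<Rightarrow> 't set \<Rightarrow> ('t \<Rightarrow> nat set) \<Rightarrow> bool" where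
  "letter_disjoint w T Cs \<longleftrightarrow> (\<forall>t\<in>T. \<forall>t'\<in>T. t \<noteq> t' \<longrightarrow> letters w (Cs t) \<inter> letters w (Cs t') = {})"

definition succ_in_block :: "('t \<Rightarrow> nat) \<Rightarrow> 't \<times> nat \<Rightarrow> 't \<times> nat" where
  "succ_in_block ty = (\<lambda>(t, x). (t, Suc x mod ty t))"

lemma bij_succ_in_block:
  assumes "finite T" "\<And>t. t \<in> T \<Longrightarrow> ty t > 0"
  shows "bij_betw (succ_in_block ty) (SIGMA t:T. {..<ty t}) (SIGMA t:T. {..<ty t})"
proof -
  have inj: "a = b" if "a < j" "b < j" "Suc a mod j = Suc b mod j" for a b j
    using that by (cases "Suc a = j"; cases "Suc b = j") auto
  have "inj_on (succ_in_block ty) (SIGMA t:T. {..<ty t})"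
    by (rule inj_onI) (auto simp: succ_in_block_def dest: inj)
  moreover have "succ_in_block ty ` (SIGMA t:T. {..<ty t}) \<subseteq> (SIGMA t:T. {..<ty t})"
    using assms by (auto simp: succ_in_block_def)
  moreover have "finite (SIGMA t:T. {..<ty t})" using assms by auto
  ultimately show ?thesis by (simp add: bij_betw_def endo_inj_surj)
qed

text \<open>A system is a vertex-disjoint family together with a root and an orientation of each
  member, and \<open>card_rooted_cycles\<close> gives \<open>2 * ty t\<close> of these for the
  member \<open>t\<close>.\<close>

lemma card_systems:
  fixes T :: "'t set"
  assumes T: "finite T" "\<And>t. t \<in> T \<Longrightarrow> ty t > 0"
  shows "card (systems w m (SIGMA t:T. {..<ty t}) (succ_in_block ty)) =
    (\<Prod>t\<in>T. 2 * ty t) * card {Cs \<in> cycle_families w m T ty. letter_disjoint w T Cs}"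
proof -
  define I where "I = (SIGMA t:T. {..<ty t})"
  define \<F> where "\<F> = {Cs \<in> cycle_families w m T ty. letter_disjoint w T Cs}"
  define blk where "blk = (\<lambda>(ps :: 't \<times> nat \<Rightarrow> nat \<times> bool) t. restrict (\<lambda>x. ps (t, x)) {..<ty t})"
  define sl where "sl = (\<lambda>ps t. (\<lambda>x. fst (ps (t, x) :: nat \<times> bool)) ` {..<ty t :: nat})"
  define f where "f = (\<lambda>ps. (restrict (sl ps) T, restrict (blk ps) T))"
  define g where "g = (\<lambda>(Cs :: 't \<Rightarrow> nat set, cs :: 't \<Rightarrow> nat \<Rightarrow> nat \<times> bool). restrict (\<lambda>(t, x). cs t x) I)"
  have finF: "finite \<F>"
    by (rule finite_subset[of _ "T \<rightarrow>\<^sub>E Pow {..<m}"]) (auto simp: \<F>_def cycle_families_def intro: finite_PiE T)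
  have blk_rooted: "blk ps t \<in> rooted_cycles w (ty t) (sl ps t)" if ps: "ps \<in> systems w m I (succ_in_block ty)" and t: "t \<in> T" for ps t
    unfolding rooted_cycles_def
  proof (intro CollectI conjI)
    have inj: "inj_on (\<lambda>i. fst (ps i)) I" "inj_on (\<lambda>i. w (ps i)) I" and
      sc: "\<And>i. i \<in> I \<Longrightarrow> w (opp (ps i)) = w (ps (succ_in_block ty i))"
      using ps by (auto simp: systems_def slot_placements_def)
    show "blk ps t \<in> {..<ty t} \<rightarrow>\<^sub>E sl ps t \<times> UNIV" by (auto simp: blk_def sl_def mem_Times_iff)
    show "inj_on (\<lambda>x. fst (blk ps t x)) {..<ty t}"
      using inj(1) t by (auto simp: inj_on_def blk_def I_def)
    show "(\<lambda>x. fst (blk ps t x)) ` {..<ty t} = sl ps t" by (auto simp: blk_def sl_def)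
    show "inj_on (\<lambda>x. w (blk ps t x)) {..<ty t}"
      using inj(2) t by (auto simp: inj_on_def blk_def I_def)
    show "\<forall>x<ty t. w (opp (blk ps t x)) = w (blk ps t (Suc x mod ty t))"
    proof safe
      fix x assume "x < ty t"
      thus "w (opp (blk ps t x)) = w (blk ps t (Suc x mod ty t))"
        using sc[of "(t, x)"] t T(2)[OF t] by (auto simp: blk_def I_def succ_in_block_def)
    qed
  qed
  have letters_sl: "letters w (sl ps t) = (\<lambda>x. w (ps (t, x))) ` {..<ty t}" if "ps \<in> systems w m I (succ_in_block ty)" "t \<in> T" for ps t
    using letters_rooted[OF blk_rooted[OF that] T(2)[OF that(2)]] by (auto simp: blk_def)
  have "bij_betw f (systems w m I (succ_in_block ty)) (SIGMA Cs:\<F>. \<Pi>\<^sub>E t\<in>T. rooted_cycles w (ty t) (Cs t))"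
  proof (rule bij_betw_byWitness[where f' = g])
    show "\<forall>ps\<in>systems w m I (succ_in_block ty). g (f ps) = ps"
      by (auto simp: f_def g_def blk_def systems_def slot_placements_def fun_eq_iff PiE_def extensional_def I_def)
    show "\<forall>z\<in>(SIGMA Cs:\<F>. \<Pi>\<^sub>E t\<in>T. rooted_cycles w (ty t) (Cs t)). f (g z) = z"
    proof
      fix z assume "z \<in> (SIGMA Cs:\<F>. \<Pi>\<^sub>E t\<in>T. rooted_cycles w (ty t) (Cs t))"
      then obtain Cs cs where z: "z = (Cs, cs)" "Cs \<in> \<F>" "cs \<in> (\<Pi>\<^sub>E t\<in>T. rooted_cycles w (ty t) (Cs t))" by auto
      have cs: "cs t \<in> rooted_cycles w (ty t) (Cs t)" if "t \<in> T" for t using z(3) that by auto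
      have "blk (g z) t = cs t" if t: "t \<in> T" for t
        using rooted_cyclesD(6)[OF cs[OF t] T(2)[OF t]] t by (auto simp: blk_def g_def z(1) I_def fun_eq_iff)
      moreover have "sl (g z) t = Cs t" if t: "t \<in> T" for t
        using rooted_cyclesD(3)[OF cs[OF t] T(2)[OF t]] t by (auto simp: sl_def g_def z(1) I_def)
      ultimately have "restrict (sl (g z)) T = Cs" "restrict (blk (g z)) T = cs"
        using z by (auto simp: fun_eq_iff \<F>_def cycle_families_def PiE_def extensional_def)
      thus "f (g z) = z" by (simp add: f_def z(1))
    qed
    show "f ` systems w m I (succ_in_block ty) \<subseteq> (SIGMA Cs:\<F>. \<Pi>\<^sub>E t\<in>T. rooted_cycles w (ty t) (Cs t))"
    proof (rule image_subsetI)
      fix ps assume ps: "ps \<in> systems w m I (succ_in_block ty)"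
      have slm: "sl ps t \<subseteq> {..<m}" if "t \<in> T" for t
      proof -
        have "ps i \<in> pos m" if "i \<in> I" for i using ps that by (auto simp: systems_def slot_placements_def)
        thus ?thesis using \<open>t \<in> T\<close> by (auto simp: sl_def I_def pos_def mem_Times_iff)
      qed
      have cs: "card (sl ps t) = ty t" if "t \<in> T" for t using card_rooted[OF blk_rooted[OF ps that] T(2)[OF that]] .
      have "cyc w (sl ps t)" if "t \<in> T" for t
        unfolding cyc_def cs[OF that] using blk_rooted[OF ps that] T(2)[OF that] by (auto simp: sl_def lessThan_empty_iff)
      moreover have "letter_disjoint w T (restrict (sl ps) T)"
      proof -
        have "inj_on (\<lambda>i. w (ps i)) I" using ps by (auto simp: systems_def)
        thus ?thesis using letters_sl[OF ps] by (auto simp: letter_disjoint_def I_def inj_on_def)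
      qed
      ultimately have "restrict (sl ps) T \<in> \<F>" using slm cs by (auto simp: \<F>_def cycle_families_def)
      thus "f ps \<in> (SIGMA Cs:\<F>. \<Pi>\<^sub>E t\<in>T. rooted_cycles w (ty t) (Cs t))"
        using blk_rooted[OF ps] by (auto simp: f_def)
    qed
    show "g ` (SIGMA Cs:\<F>. \<Pi>\<^sub>E t\<in>T. rooted_cycles w (ty t) (Cs t)) \<subseteq> systems w m I (succ_in_block ty)"
    proof (rule image_subsetI)
      fix z assume "z \<in> (SIGMA Cs:\<F>. \<Pi>\<^sub>E t\<in>T. rooted_cycles w (ty t) (Cs t))"
      then obtain Cs cs where z: "z = (Cs, cs)" "Cs \<in> \<F>" "cs \<in> (\<Pi>\<^sub>E t\<in>T. rooted_cycles w (ty t) (Cs t))" by auto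
      have cs: "cs t \<in> rooted_cycles w (ty t) (Cs t)" if "t \<in> T" for t using z(3) that by auto
      note cD = rooted_cyclesD[OF cs T(2)]
      have gi: "g z (t, x) = cs t x" if "t \<in> T" "x < ty t" for t x using that by (simp add: g_def z(1) I_def)
      have Csm: "Cs t \<subseteq> {..<m}" if "t \<in> T" for t using z(2) that by (auto simp: \<F>_def cycle_families_def)
      have disj: "letters w (Cs t) \<inter> letters w (Cs t') = {}" if "t \<in> T" "t' \<in> T" "t \<noteq> t'" for t t'
        using z(2) that by (auto simp: \<F>_def letter_disjoint_def)
      have lw: "w (cs t x) \<in> letters w (Cs t)" if "t \<in> T" "x < ty t" for t x
        using cD(1)[OF that(1) that(1) that(2)] by (auto simp: letters_def mem_Times_iff intro!: imageI)
      have "g z \<in> I \<rightarrow>\<^sub>E pos m"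
        using cD(1) Csm by (fastforce simp: g_def z(1) I_def pos_def mem_Times_iff)
      moreover have "inj_on (\<lambda>i. w (g z i)) I"
      proof (rule inj_onI)
        fix i k assume i: "i \<in> I" "k \<in> I" "w (g z i) = w (g z k)"
        obtain t x t' x' where ik: "i = (t, x)" "k = (t', x')" "t \<in> T" "x < ty t" "t' \<in> T" "x' < ty t'"
          using i by (auto simp: I_def)
        have eq: "w (cs t x) = w (cs t' x')" using i(3) gi ik by auto
        have "t = t'" using disj[of t t'] lw[OF ik(3,4)] lw[OF ik(5,6)] eq ik by auto
        thus "i = k" using eq cD(5)[of t x x'] ik by auto
      qed
      moreover have "inj_on (\<lambda>i. fst (g z i)) I"
      proof (rule inj_onI)
        fix i k assume i: "i \<in> I" "k \<in> I" "fst (g z i) = fst (g z k)"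
        obtain t x t' x' where ik: "i = (t, x)" "k = (t', x')" "t \<in> T" "x < ty t" "t' \<in> T" "x' < ty t'"
          using i by (auto simp: I_def)
        have eq: "fst (cs t x) = fst (cs t' x')" using i(3) gi ik by auto
        have "fst (cs t x) \<in> Cs t" "fst (cs t x) \<in> Cs t'"
          using cD(1)[OF ik(3,3,4)] cD(1)[OF ik(5,5,6)] eq by auto
        \<comment> \<open>A common slot would bring its letters into both cycles, so disjoint
          letters force disjoint slots.\<close>
        hence "letters w {fst (cs t x)} \<subseteq> letters w (Cs t) \<inter> letters w (Cs t')"
          by (intro Int_greatest letters_mono) auto
        moreover have "letters w {fst (cs t x)} \<noteq> {}" by simp
        ultimately have "t = t'" using disj[of t t'] ik by blast
        thus "i = k" using eq cD(2)[of t x x'] ik by auto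
      qed
      moreover have "\<forall>i\<in>I. w (opp (g z i)) = w (g z (succ_in_block ty i))"
        using cD(4) gi T(2) by (auto simp: I_def succ_in_block_def)
      ultimately show "g z \<in> systems w m I (succ_in_block ty)" by (simp add: systems_def slot_placements_def)
    qed
  qed
  hence "card (systems w m I (succ_in_block ty)) = card (SIGMA Cs:\<F>. \<Pi>\<^sub>E t\<in>T. rooted_cycles w (ty t) (Cs t))"
    by (rule bij_betw_same_card)
  also have "\<dots> = (\<Sum>Cs\<in>\<F>. card (\<Pi>\<^sub>E t\<in>T. rooted_cycles w (ty t) (Cs t)))"
  proof (intro card_SigmaI finF ballI finite_PiE T)
    fix Cs t assume "Cs \<in> \<F>" "t \<in> T"
    hence "card (rooted_cycles w (ty t) (Cs t)) = 2 * ty t" "ty t > 0"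
      using cyc_facts(5)[of w "Cs t"] T(2) by (auto simp: \<F>_def cycle_families_def)
    thus "finite (rooted_cycles w (ty t) (Cs t))" using card_gt_0_iff by force
  qed
  also have "\<dots> = (\<Sum>Cs\<in>\<F>. (\<Prod>t\<in>T. 2 * ty t))"
  proof (intro sum.cong refl)
    fix Cs assume "Cs \<in> \<F>"
    hence "card (rooted_cycles w (ty t) (Cs t)) = 2 * ty t" if "t \<in> T" for t
      using cyc_facts(5)[of w "Cs t"] that by (auto simp: \<F>_def cycle_families_def)
    thus "card (\<Pi>\<^sub>E t\<in>T. rooted_cycles w (ty t) (Cs t)) = (\<Prod>t\<in>T. 2 * ty t)"
      using T(1) by (simp add: card_PiE)
  qed
  finally show ?thesis by (simp add: I_def \<F>_def mult.commute)
qed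

section \<open>Families of distinct cycles and factorial moments\<close>

definition cycle_sets :: "(nat \<times> bool \<Rightarrow> 'v) \<Rightarrow> nat \<Rightarrow> nat \<Rightarrow> nat set set" where
  "cycle_sets w m j = {C. C \<subseteq> {..<m} \<and> cyc w C \<and> card C = j}"

lemma finite_cycle_sets [simp]: "finite (cycle_sets w m j)"
  by (rule finite_subset[of _ "Pow {..<m}"]) (auto simp: cycle_sets_def)

lemma finite_cycle_families: "finite T \<Longrightarrow> finite (cycle_families w m T ty)"
  by (rule finite_subset[of _ "T \<rightarrow>\<^sub>E Pow {..<m}"]) (auto simp: cycle_families_def intro: finite_PiE)

text \<open>The new member has to avoid only the members of its own length, since cycles of other
  lengths are different sets anyway.\<close>

lemma card_inj_families_insert:
  assumes T: "finite T" "t \<notin> T"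
  shows "card {Cs \<in> cycle_families w m (insert t T) ty. inj_on Cs (insert t T)} =
     card {Cs \<in> cycle_families w m T ty. inj_on Cs T} * (card (cycle_sets w m (ty t)) - card {t'\<in>T. ty t' = ty t})"
proof -
  let ?F = "{Cs \<in> cycle_families w m T ty. inj_on Cs T}"
  define f where "f = (\<lambda>Cs :: 'a \<Rightarrow> nat set. (restrict Cs T, Cs t))"
  define g where "g = (\<lambda>(Cs :: 'a \<Rightarrow> nat set, C). Cs(t := C))"
  have "bij_betw f {Cs \<in> cycle_families w m (insert t T) ty. inj_on Cs (insert t T)} (SIGMA Cs:?F. cycle_sets w m (ty t) - Cs ` T)"
  proof (rule bij_betw_byWitness[where f' = g])
    show "\<forall>Cs\<in>{Cs \<in> cycle_families w m (insert t T) ty. inj_on Cs (insert t T)}. g (f Cs) = Cs"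
      using T by (auto simp: f_def g_def cycle_families_def fun_eq_iff PiE_def extensional_def)
    show "\<forall>z\<in>(SIGMA Cs:?F. cycle_sets w m (ty t) - Cs ` T). f (g z) = z"
      using T by (auto simp: f_def g_def cycle_families_def fun_eq_iff PiE_def extensional_def)
    show "f ` {Cs \<in> cycle_families w m (insert t T) ty. inj_on Cs (insert t T)} \<subseteq> (SIGMA Cs:?F. cycle_sets w m (ty t) - Cs ` T)"
    proof (rule image_subsetI)
      fix Cs assume "Cs \<in> {Cs \<in> cycle_families w m (insert t T) ty. inj_on Cs (insert t T)}"
      hence Cs: "Cs \<in> cycle_families w m (insert t T) ty" "inj_on Cs (insert t T)" by auto
      have "restrict Cs T \<in> cycle_families w m T ty" using Cs(1) by (auto simp: cycle_families_def)
      moreover have "inj_on (restrict Cs T) T" using Cs(2) by (simp add: inj_on_restrict_eq)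
      moreover have "Cs t \<in> cycle_sets w m (ty t)" using Cs(1) by (auto simp: cycle_families_def cycle_sets_def)
      moreover have "Cs t \<notin> restrict Cs T ` T" using Cs(2) T(2) by (simp add: image_restrict_eq)
      ultimately show "f Cs \<in> (SIGMA Cs:?F. cycle_sets w m (ty t) - Cs ` T)" by (simp add: f_def)
    qed
    show "g ` (SIGMA Cs:?F. cycle_sets w m (ty t) - Cs ` T) \<subseteq> {Cs \<in> cycle_families w m (insert t T) ty. inj_on Cs (insert t T)}"
    proof (rule image_subsetI)
      fix z assume "z \<in> (SIGMA Cs:?F. cycle_sets w m (ty t) - Cs ` T)"
      then obtain Cs C where z: "z = (Cs, C)" "Cs \<in> cycle_families w m T ty" "inj_on Cs T" "C \<in> cycle_sets w m (ty t)" "C \<notin> Cs ` T"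
        by auto
      have "(Cs(t := C)) ` T = Cs ` T" using T(2) by (intro image_cong) auto
      moreover have "inj_on (Cs(t := C)) T" using z(3) T(2) by (subst inj_on_cong[of T _ Cs]) auto
      ultimately have "inj_on (Cs(t := C)) (insert t T)" using z(5) T(2) by simp
      moreover have "Cs(t := C) \<in> cycle_families w m (insert t T) ty"
        using z(2,4) by (auto simp: cycle_families_def cycle_sets_def PiE_def Pi_def extensional_def)
      ultimately show "g z \<in> {Cs \<in> cycle_families w m (insert t T) ty. inj_on Cs (insert t T)}" by (simp add: g_def z(1))
    qed
  qed
  hence "card {Cs \<in> cycle_families w m (insert t T) ty. inj_on Cs (insert t T)} = card (SIGMA Cs:?F. cycle_sets w m (ty t) - Cs ` T)"
    by (rule bij_betw_same_card)
  also have "\<dots> = (\<Sum>Cs\<in>?F. card (cycle_sets w m (ty t) - Cs ` T))"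
  proof (rule card_SigmaI)
    show "finite ?F" using finite_cycle_families[OF T(1), of w m ty] by (rule rev_finite_subset) auto
  qed auto
  also have "\<dots> = (\<Sum>Cs\<in>?F. card (cycle_sets w m (ty t)) - card {t'\<in>T. ty t' = ty t})"
  proof (intro sum.cong refl)
    fix Cs assume Cs: "Cs \<in> ?F"
    have eq: "cycle_sets w m (ty t) - Cs ` T = cycle_sets w m (ty t) - Cs ` {t'\<in>T. ty t' = ty t}"
      using Cs by (auto simp: cycle_families_def cycle_sets_def)
    have "Cs ` {t'\<in>T. ty t' = ty t} \<subseteq> cycle_sets w m (ty t)"
      using Cs by (auto simp: cycle_families_def cycle_sets_def)
    hence "card (cycle_sets w m (ty t) - Cs ` {t'\<in>T. ty t' = ty t}) = card (cycle_sets w m (ty t)) - card (Cs ` {t'\<in>T. ty t' = ty t})"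
      by (intro card_Diff_subset) (auto simp: T)
    also have "card (Cs ` {t'\<in>T. ty t' = ty t}) = card {t'\<in>T. ty t' = ty t}"
      using Cs by (intro card_image) (auto simp: inj_on_def)
    finally show "card (cycle_sets w m (ty t) - Cs ` T) = card (cycle_sets w m (ty t)) - card {t'\<in>T. ty t' = ty t}"
      unfolding eq .
  qed
  finally show ?thesis by simp
qed

text \<open>The count is a product of falling factorials, one for each length, so that its average
  is a joint factorial moment of the cycle counts.\<close>

lemma card_inj_families:
  assumes "finite T" "finite K" "ty ` T \<subseteq> K"
  shows "card {Cs \<in> cycle_families w m T ty. inj_on Cs T} =
     (\<Prod>j\<in>K. \<Prod>i<card {t\<in>T. ty t = j}. card (cycle_sets w m j) - i)"
  using assms(1,3)
proof (induction T rule: finite_induct)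
  case empty
  thus ?case by (simp add: cycle_families_def)
next
  case (insert t T)
  define X where "X = (\<lambda>j. card (cycle_sets w m j))"
  have tK: "ty t \<in> K" using insert by auto
  have c: "card {t'\<in>insert t T. ty t' = j} = (if j = ty t then Suc (card {t'\<in>T. ty t' = j}) else card {t'\<in>T. ty t' = j})" for j
  proof -
    have "{t'\<in>insert t T. ty t' = j} = (if j = ty t then insert t {t'\<in>T. ty t' = j} else {t'\<in>T. ty t' = j})" by auto
    thus ?thesis using insert by auto
  qed
  have "(\<Prod>j\<in>K. \<Prod>i<card {t'\<in>insert t T. ty t' = j}. X j - i) =
     (\<Prod>i<Suc (card {t'\<in>T. ty t' = ty t}). X (ty t) - i) * (\<Prod>j\<in>K - {ty t}. \<Prod>i<card {t'\<in>T. ty t' = j}. X j - i)"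
    unfolding prod.remove[OF assms(2) tK] c by (intro arg_cong2[where f="(*)"] prod.cong) auto
  also have "\<dots> = (\<Prod>j\<in>K. \<Prod>i<card {t'\<in>T. ty t' = j}. X j - i) * (X (ty t) - card {t'\<in>T. ty t' = ty t})"
    unfolding prod.remove[OF assms(2) tK, of "\<lambda>j. \<Prod>i<card {t'\<in>T. ty t' = j}. X j - i"] by (simp add: mult_ac)
  finally show ?case using insert card_inj_families_insert[OF insert(1,2), of w m ty] by (simp add: X_def)
qed

text \<open>Subtraction of naturals is truncated; for r > x the product contains the factor 0, and
  the binomial coefficient vanishes as well.\<close>

lemma prod_diff_eq_fact_choose: "(\<Prod>i<r. (x::nat) - i) = fact r * (x choose r)"
proof (induction r)
  case (Suc r)
  have "Suc r * (x choose Suc r) = (x - r) * (x choose r)"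
    by (metis binomial_absorb_comp binomial_absorption)
  moreover have "fact (Suc r) * (x choose Suc r) = fact r * (Suc r * (x choose Suc r))"
    by (simp only: fact_Suc mult_ac of_nat_id)
  ultimately show ?case using Suc by (simp only: prod.lessThan_Suc mult_ac)
qed simp

text \<open>Families of distinct cycles that are not vertex disjoint lie on a deficient slot set.\<close>
lemma card_inj_families_le:
  assumes T: "finite T" "\<And>t. t \<in> T \<Longrightarrow> ty t > 0"
  shows "card {Cs \<in> cycle_families w m T ty. letter_disjoint w T Cs} \<le> card {Cs \<in> cycle_families w m T ty. inj_on Cs T}"
    and "card {Cs \<in> cycle_families w m T ty. inj_on Cs T} \<le> card {Cs \<in> cycle_families w m T ty. letter_disjoint w T Cs}
      + (\<Sum>e\<le>(\<Sum>t\<in>T. ty t). (2 ^ e) ^ card T * card {A. A \<subseteq> {..<m} \<and> card A = e \<and> deficient w A})"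
proof -
  let ?D = "{Cs \<in> cycle_families w m T ty. letter_disjoint w T Cs}"
  let ?I = "{Cs \<in> cycle_families w m T ty. inj_on Cs T}"
  note fin = finite_cycle_families[OF T(1), of w m ty]
  have "?D \<subseteq> ?I"
  proof safe
    fix Cs assume Cs: "Cs \<in> cycle_families w m T ty" "letter_disjoint w T Cs"
    show "inj_on Cs T"
    proof (rule inj_onI, rule ccontr)
      fix s t assume st: "s \<in> T" "t \<in> T" "Cs s = Cs t" "s \<noteq> t"
      hence "letters w (Cs s) = {}" using Cs(2) by (fastforce simp: letter_disjoint_def)
      thus False using Cs(1) st cyc_facts(2)[of w "Cs s"] by (auto simp: cycle_families_def)
    qed
  qed
  thus "card ?D \<le> card ?I" using fin by (intro card_mono) auto
  define E where "E = (\<Sum>t\<in>T. ty t)"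
  define def where "def = (\<lambda>e. {A. A \<subseteq> {..<m} \<and> card A = e \<and> deficient w A})"
  have fdef: "finite (def e)" for e by (rule finite_subset[of _ "Pow {..<m}"]) (auto simp: def_def)
  \<comment> \<open>A family that is not disjoint is recovered from the union \<open>A\<close> of
    its members, a deficient set of some size \<open>e\<close> at most \<open>E\<close>, by choosing
    for each member one of the 2^e subsets of \<open>A\<close>.\<close>
  have "?I \<subseteq> ?D \<union> (\<Union>e\<le>E. \<Union>A\<in>def e. T \<rightarrow>\<^sub>E Pow A)"
  proof
    fix Cs assume Cs: "Cs \<in> ?I"
    have cy: "cyc w (Cs t)" "card (Cs t) = ty t" "Cs t \<subseteq> {..<m}" if "t \<in> T" for t
      using Cs that by (auto simp: cycle_families_def)
    show "Cs \<in> ?D \<union> (\<Union>e\<le>E. \<Union>A\<in>def e. T \<rightarrow>\<^sub>E Pow A)"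
    proof (cases "letter_disjoint w T Cs")
      case True thus ?thesis using Cs by auto
    next
      case False
      then obtain s t where st: "s \<in> T" "t \<in> T" "s \<noteq> t" "letters w (Cs s) \<inter> letters w (Cs t) \<noteq> {}"
        by (auto simp: letter_disjoint_def)
      hence "Cs s \<noteq> Cs t" using Cs by (auto simp: inj_on_def)
      hence "deficient w (\<Union>(Cs ` T))"
        using st T(1) cy by (intro deficient_Union[where A="Cs s" and B="Cs t"]) auto
      moreover have "\<Union>(Cs ` T) \<subseteq> {..<m}" using cy by auto
      moreover have "card (\<Union>(Cs ` T)) \<le> E"
        using card_UN_le[OF T(1), of Cs] cy by (simp add: E_def)
      ultimately have "\<Union>(Cs ` T) \<in> def (card (\<Union>(Cs ` T)))" "card (\<Union>(Cs ` T)) \<in> {..E}" by (auto simp: def_def)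
      moreover have "Cs \<in> T \<rightarrow>\<^sub>E Pow (\<Union>(Cs ` T))" using Cs by (auto simp: cycle_families_def PiE_def)
      ultimately show ?thesis by blast
    qed
  qed
  moreover have fA: "finite A" if "A \<in> def e" for A e using that finite_subset by (auto simp: def_def)
  ultimately have "card ?I \<le> card (?D \<union> (\<Union>e\<le>E. \<Union>A\<in>def e. T \<rightarrow>\<^sub>E Pow A))"
    using fin fdef T(1) by (intro card_mono) (auto intro!: finite_PiE)
  also have "\<dots> \<le> card ?D + card (\<Union>e\<le>E. \<Union>A\<in>def e. T \<rightarrow>\<^sub>E Pow A)" by (rule card_Un_le)
  also have "card (\<Union>e\<le>E. \<Union>A\<in>def e. T \<rightarrow>\<^sub>E Pow A) \<le> (\<Sum>e\<le>E. card (\<Union>A\<in>def e. T \<rightarrow>\<^sub>E Pow A))"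
    by (rule card_UN_le) simp
  also have "\<dots> \<le> (\<Sum>e\<le>E. (2 ^ e) ^ card T * card (def e))"
  proof (rule sum_mono)
    fix e
    have "card (\<Union>A\<in>def e. T \<rightarrow>\<^sub>E Pow A) \<le> (\<Sum>A\<in>def e. card (T \<rightarrow>\<^sub>E Pow A))" by (rule card_UN_le[OF fdef])
    also have "\<dots> = (\<Sum>A\<in>def e. (2 ^ e) ^ card T)"
      using T(1) fA by (intro sum.cong) (auto simp: card_funcsetE card_Pow def_def)
    finally show "card (\<Union>A\<in>def e. T \<rightarrow>\<^sub>E Pow A) \<le> (2 ^ e) ^ card T * card (def e)" by (simp add: mult.commute)
  qed
  finally show "card ?I \<le> card ?D + (\<Sum>e\<le>(\<Sum>t\<in>T. ty t). (2 ^ e) ^ card T * card {A. A \<subseteq> {..<m} \<and> card A = e \<and> deficient w A})"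
    by (simp add: E_def def_def)
qed

text \<open>A function with at most \<open>k\<close> values factors through \<open>{..<k}\<close>:
  list the values, then choose for each argument an index into the list.\<close>

lemma card_small_range:
  assumes A: "finite A" and V: "finite V" "V \<noteq> {}"
  shows "card {g \<in> A \<rightarrow>\<^sub>E V. card (g ` A) \<le> k} \<le> card V ^ k * k ^ card A"
proof -
  obtain v0 where v0: "v0 \<in> V" using V by auto
  define F where "F = (\<lambda>(h, \<kappa>). restrict (\<lambda>q. h (\<kappa> q :: nat) :: 'b) A)"
  have "{g \<in> A \<rightarrow>\<^sub>E V. card (g ` A) \<le> k} \<subseteq> F ` (({..<k} \<rightarrow>\<^sub>E V) \<times> (A \<rightarrow>\<^sub>E {..<k}))"
  proof
    fix g assume "g \<in> {g \<in> A \<rightarrow>\<^sub>E V. card (g ` A) \<le> k}"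
    hence g: "g \<in> A \<rightarrow>\<^sub>E V" "card (g ` A) \<le> k" by auto
    obtain f where f: "bij_betw f {..<card (g ` A)} (g ` A)"
      using bij_betw_from_nat_into_finite[of "g ` A"] A by auto
    \<comment> \<open>\<open>v0\<close> pads the list when there are fewer than \<open>k\<close>
      values.\<close>
    define h where "h = restrict (\<lambda>i. if i < card (g ` A) then f i else v0) {..<k}"
    define \<kappa> where "\<kappa> = restrict (\<lambda>q. inv_into {..<card (g ` A)} f (g q)) A"
    have inv: "inv_into {..<card (g ` A)} f (g q) < card (g ` A)" "f (inv_into {..<card (g ` A)} f (g q)) = g q" if "q \<in> A" for q
    proof -
      have "g q \<in> f ` {..<card (g ` A)}" using f that by (auto simp: bij_betw_def)
      thus "inv_into {..<card (g ` A)} f (g q) < card (g ` A)" "f (inv_into {..<card (g ` A)} f (g q)) = g q"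
        using inv_into_into[of "g q" f "{..<card (g ` A)}"] f_inv_into_f[of "g q" f "{..<card (g ` A)}"] by auto
    qed
    have "h \<in> {..<k} \<rightarrow>\<^sub>E V"
    proof -
      have "f i \<in> V" if "i < card (g ` A)" for i
      proof -
        have "f i \<in> g ` A" using bij_betwE[OF f] that by simp
        thus ?thesis using g(1) by auto
      qed
      thus ?thesis using v0 by (auto simp: h_def)
    qed
    moreover have "\<kappa> \<in> A \<rightarrow>\<^sub>E {..<k}" using inv(1) g(2) by (force simp: \<kappa>_def)
    moreover have "F (h, \<kappa>) = g"
    proof
      fix q show "F (h, \<kappa>) q = g q"
        using inv[of q] g by (cases "q \<in> A") (auto simp: F_def h_def \<kappa>_def PiE_def extensional_def)
    qed
    ultimately show "g \<in> F ` (({..<k} \<rightarrow>\<^sub>E V) \<times> (A \<rightarrow>\<^sub>E {..<k}))" by (metis SigmaI image_eqI)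
  qed
  hence "card {g \<in> A \<rightarrow>\<^sub>E V. card (g ` A) \<le> k} \<le> card (({..<k} \<rightarrow>\<^sub>E V) \<times> (A \<rightarrow>\<^sub>E {..<k}))"
    using A V by (intro surj_card_le) (auto intro!: finite_PiE)
  thus ?thesis using A by (simp add: card_cartesian_product card_funcsetE)
qed

lemma fact_ge_power:
  assumes "r \<le> m"
  shows "fact (2 * m - r) * m ^ r \<le> (fact (2 * m) :: nat)"
  using assms
proof (induction r)
  case (Suc r)
  have "2 * m - r = Suc (2 * m - Suc r)" using Suc.prems by linarith
  hence "fact (2 * m - r) = (2 * m - r) * (fact (2 * m - Suc r) :: nat)" by (metis fact_Suc of_nat_id)
  moreover have "m \<le> 2 * m - r" using Suc.prems by linarith
  ultimately have "m * fact (2 * m - Suc r) \<le> (fact (2 * m - r) :: nat)" by (metis mult_le_mono1)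
  hence "m * fact (2 * m - Suc r) * m ^ r \<le> (fact (2 * m - r) :: nat) * m ^ r" by (rule mult_le_mono1)
  also have "\<dots> \<le> fact (2 * m)" using Suc by simp
  finally show ?case by (simp add: mult_ac)
qed simp

lemma fact_eq_prod_diff:
  assumes "k \<le> N"
  shows "fact N = (fact (N - k) :: nat) * (\<Prod>i<k. N - i)"
  unfolding prod_diff_eq_fact_choose using binomial_fact_lemma[OF assms] by (simp add: mult_ac)

lemma tendsto_prod_diff:
  assumes "filterlim f at_top sequentially"
  shows "(\<lambda>n. real (\<Prod>i<k. f n - i) / real (f n) ^ k) \<longlonglongrightarrow> 1"
proof -
  have "(\<lambda>n. \<Prod>i<k. 1 - real i / real (f n)) \<longlonglongrightarrow> (\<Prod>i<k. 1 - 0)"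
  proof (intro tendsto_prod tendsto_diff tendsto_const)
    fix i
    show "(\<lambda>n. real i / real (f n)) \<longlonglongrightarrow> 0"
      by (intro real_tendsto_divide_at_top[OF tendsto_const] filterlim_compose[OF filterlim_real_sequentially assms])
  qed
  moreover have "eventually (\<lambda>n. (\<Prod>i<k. 1 - real i / real (f n)) = real (\<Prod>i<k. f n - i) / real (f n) ^ k) sequentially"
  proof -
    have "eventually (\<lambda>n. f n \<ge> k + 1) sequentially" using assms by (simp add: filterlim_at_top)
    thus ?thesis
    proof eventually_elim
      case (elim n)
      have "(\<Prod>i<k. 1 - real i / real (f n)) = (\<Prod>i<k. real (f n - i) / real (f n))"
        using elim by (intro prod.cong) (auto simp: of_nat_diff field_simps)
      thus ?case by (simp add: prod_dividef)
    qed
  qed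
  ultimately show ?thesis using Lim_transform_eventually by fastforce
qed

section \<open>Cycle counts of random words\<close>

text \<open>Positivity of \<mu> makes \<open>m n\<close> grow linearly in \<open>n\<close>, so that
  n / m stays bounded.\<close>

locale graph_seq = coeff_seq D "\<lambda>n. 2 * m n" x X for D m x X +
  assumes mu_pos: "\<mu> > 0"
begin

definition \<Omega> :: "nat \<Rightarrow> (nat \<times> bool \<Rightarrow> nat) set" where
  "\<Omega> n = words (pos (m n)) {1..n} (\<lambda>_. D)"

definition \<rho> :: "nat \<Rightarrow> real" where
  "\<rho> j = (\<kappa> / \<mu>) ^ j / (2 * real j)"

lemma finite_Omega [simp]: "finite (\<Omega> n)"
  by (simp add: \<Omega>_def)

lemma m_over_n: "(\<lambda>n. real (m n) / real n) \<longlonglongrightarrow> \<mu> / 2"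
  using tendsto_divide[OF tendsto_mu tendsto_const[of 2]] by simp

lemma m_lim: "filterlim m at_top sequentially"
proof -
  have L: "filterlim (\<lambda>n. real (m n) / real n * real n) at_top sequentially"
    using mu_pos by (intro filterlim_tendsto_pos_mult_at_top[OF m_over_n] filterlim_real_sequentially) auto
  have "eventually (\<lambda>n. real (m n) / real n * real n = real (m n)) sequentially"
    using eventually_gt_at_top[of 0] by eventually_elim simp
  from filterlim_cong[OF refl refl this, of at_top] have "filterlim (\<lambda>n. real (m n)) at_top sequentially"
    using L by (simp only:)
  thus ?thesis by (simp add: filterlim_sequentially_iff_filterlim_real)
qed

lemma card_Omega: "of_nat (card (\<Omega> n)) = fact (2 * m n) * coeff n (\<lambda>_. 0)"
proof -
  show ?thesis
    using card_words_pattern[of "{1..n}" "pos (m n)" "{}" "\<lambda>_. undefined" D] by (simp add: \<Omega>_def coeff_def)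
qed

lemma card_Omega_real: "real (card (\<Omega> n)) = fact (2 * m n) * norm (coeff n (\<lambda>_. 0))"
proof -
  have "norm (of_nat (card (\<Omega> n)) :: complex) = fact (2 * m n) * norm (coeff n (\<lambda>_. 0))"
    unfolding card_Omega norm_mult by simp
  thus ?thesis by simp
qed

lemma Omega_nonempty: "eventually (\<lambda>n. card (\<Omega> n) > 0) sequentially"
  using coeff_doubles_limit(2)
proof eventually_elim
  case (elim n)
  hence "real (card (\<Omega> n)) > 0" unfolding card_Omega_real by simp
  thus ?case by simp
qed

text \<open>The factorials contribute (2m - r)! / (2m)!, at most m^(-r), and
  \<open>coeff_bound\<close> contributes the constant. So \<open>r\<close> prescribed positions have
  probability of order at most m^(-r), uniformly in their place and letters.\<close>

lemma pattern_bound: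
  "\<exists>C>0. eventually (\<lambda>n. \<forall>Q g. Q \<subseteq> pos (m n) \<longrightarrow> card Q = r \<longrightarrow> g ` Q \<subseteq> {1..n} \<longrightarrow>
     real (card {w \<in> \<Omega> n. \<forall>q\<in>Q. w q = g q}) * real (m n) ^ r \<le> C * real (card (\<Omega> n))) sequentially"
proof -
  obtain C where C: "C > 0" "eventually (\<lambda>n. \<forall>a. (\<Sum>v=1..n. a v) = r \<longrightarrow> norm (coeff n a) \<le> C * norm (coeff n (\<lambda>_. 0))) sequentially"
    using coeff_bound[of r] by blast
  have "eventually (\<lambda>n. m n \<ge> r) sequentially" using m_lim by (simp add: filterlim_at_top)
  with C(2) have "eventually (\<lambda>n. \<forall>Q g. Q \<subseteq> pos (m n) \<longrightarrow> card Q = r \<longrightarrow> g ` Q \<subseteq> {1..n} \<longrightarrow>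
     real (card {w \<in> \<Omega> n. \<forall>q\<in>Q. w q = g q}) * real (m n) ^ r \<le> C * real (card (\<Omega> n))) sequentially"
  proof eventually_elim
    case (elim n)
    show ?case
    proof (intro allI impI)
      fix Q g assume Q: "Q \<subseteq> pos (m n)" "card Q = r" "g ` Q \<subseteq> {1..n}"
      have fQ: "finite Q" by (rule finite_subset[OF Q(1) finite_pos])
      define a where "a = (\<lambda>v. card {q\<in>Q. g q = v})"
      have sa: "(\<Sum>v=1..n. a v) = r"
      proof -
        have "(\<Sum>v=1..n. \<Sum>q\<in>{q\<in>Q. g q = v}. 1::nat) = (\<Sum>q\<in>Q. 1)"
          using Q(3) fQ by (intro sum.group) auto
        thus ?thesis using Q(2) by (simp add: a_def)
      qed
      have "of_nat (card {w \<in> words (pos (m n)) {1..n} (\<lambda>_. D). \<forall>q\<in>Q. w q = g q}) =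
         fact (card (pos (m n)) - card Q) * fps_nth (\<Prod>v\<in>{1..n}. egf D (card {q\<in>Q. g q = v})) (card (pos (m n)) - card Q)"
        using Q by (intro card_words_pattern) auto
      hence "of_nat (card {w \<in> \<Omega> n. \<forall>q\<in>Q. w q = g q}) = fact (2 * m n - r) * coeff n a"
        using Q(2) sa by (simp add: \<Omega>_def coeff_def a_def)
      hence "norm (of_nat (card {w \<in> \<Omega> n. \<forall>q\<in>Q. w q = g q}) :: complex) = fact (2 * m n - r) * norm (coeff n a)"
        by (simp add: norm_mult)
      hence "real (card {w \<in> \<Omega> n. \<forall>q\<in>Q. w q = g q}) = fact (2 * m n - r) * norm (coeff n a)" by simp
      hence "real (card {w \<in> \<Omega> n. \<forall>q\<in>Q. w q = g q}) * real (m n) ^ r = (fact (2 * m n - r) * real (m n) ^ r) * norm (coeff n a)" by simp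
      also have "\<dots> \<le> fact (2 * m n) * (C * norm (coeff n (\<lambda>_. 0)))"
      proof (rule mult_mono)
        have "real (fact (2 * m n - r) * m n ^ r) \<le> real (fact (2 * m n))"
          using fact_ge_power[OF elim(2)] of_nat_le_iff by blast
        thus "fact (2 * m n - r) * real (m n) ^ r \<le> fact (2 * m n)" by simp
      qed (use elim sa in auto)
      finally show "real (card {w \<in> \<Omega> n. \<forall>q\<in>Q. w q = g q}) * real (m n) ^ r \<le> C * real (card (\<Omega> n))"
        by (simp add: card_Omega_real mult_ac)
    qed
  qed
  thus ?thesis using C(1) by blast
qed

text \<open>There are at most m^e slot sets of size \<open>e\<close> and, with k = e - 1, at most
  n^k k^(2e) ways to label their ends by at most \<open>k\<close> letters; by
  \<open>pattern_bound\<close> each labelling has probability of order at most m^(-2e). As n / m is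
  bounded, the expected number is of order 1 / n.\<close>

lemma avg_deficient:
  "(\<lambda>n. avg (\<Omega> n) (\<lambda>w. real (card {A. A \<subseteq> {..<m n} \<and> card A = e \<and> deficient w A}))) \<longlonglongrightarrow> 0"
proof (cases "e = 0")
  case True
  have "{A. A \<subseteq> {..<m n} \<and> card A = e \<and> deficient w A} = {}" for n and w :: "nat \<times> bool \<Rightarrow> nat"
    using True by (auto simp: deficient_def)
  hence z: "card {A. A \<subseteq> {..<m n} \<and> card A = e \<and> deficient w A} = 0" for n and w :: "nat \<times> bool \<Rightarrow> nat"
    by (simp only: card.empty)
  show ?thesis unfolding z by (simp add: avg_def)
next
  case False
  then obtain k where e: "e = Suc k" by (cases e) auto
  obtain C where C: "C > 0" and ev: "eventually (\<lambda>n. \<forall>Q g. Q \<subseteq> pos (m n) \<longrightarrow> card Q = 2 * e \<longrightarrow> g ` Q \<subseteq> {1..n} \<longrightarrow>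
     real (card {w \<in> \<Omega> n. \<forall>q\<in>Q. w q = g q}) * real (m n) ^ (2 * e) \<le> C * real (card (\<Omega> n))) sequentially"
    using pattern_bound[of "2 * e"] by blast
  have "eventually (\<lambda>n. m n \<ge> 1) sequentially" using m_lim by (simp add: filterlim_at_top)
  hence evm: "eventually (\<lambda>n. m n > 0) sequentially" by eventually_elim simp
  define B where "B = (\<lambda>n. C * real (k ^ (2 * e)) * (real n / real (m n)) ^ e / real n)"
  have "eventually (\<lambda>n. norm (avg (\<Omega> n) (\<lambda>w. real (card {A. A \<subseteq> {..<m n} \<and> card A = e \<and> deficient w A}))) \<le> B n) sequentially"
    using ev evm Omega_nonempty eventually_gt_at_top[of 0]
  proof eventually_elim
    case (elim n)
    define \<A> where "\<A> = {A. A \<subseteq> {..<m n} \<and> card A = e}"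
    define G where "G = (\<lambda>A :: nat set. {g \<in> A \<times> UNIV \<rightarrow>\<^sub>E {1..n}. card (g ` (A \<times> (UNIV :: bool set))) \<le> k})"
    have fin: "finite \<A>" by (rule finite_subset[of _ "Pow {..<m n}"]) (auto simp: \<A>_def)
    have finA: "finite A" "A \<times> (UNIV :: bool set) \<subseteq> pos (m n)" "card (A \<times> (UNIV :: bool set)) = 2 * e" if "A \<in> \<A>" for A
      using that finite_subset[of A "{..<m n}"] by (auto simp: \<A>_def pos_def card_cartesian_product)
    have finG: "finite (G A)" if "A \<in> \<A>" for A
      by (rule finite_subset[of _ "A \<times> UNIV \<rightarrow>\<^sub>E {1..n}"]) (use finA[OF that] in \<open>auto simp: G_def intro!: finite_PiE\<close>)
    have cG: "card (G A) \<le> n ^ k * k ^ (2 * e)" if "A \<in> \<A>" for A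
      using card_small_range[of "A \<times> (UNIV :: bool set)" "{1..n}" k] finA[OF that] elim(4) by (simp add: G_def)
    have one: "real (card {w\<in>\<Omega> n. deficient w A}) \<le> real (n ^ k * k ^ (2 * e)) * (C * real (card (\<Omega> n)) / real (m n) ^ (2 * e))"
      if A: "A \<in> \<A>" for A
    proof -
      have "{w\<in>\<Omega> n. deficient w A} \<subseteq> (\<Union>g\<in>G A. {w\<in>\<Omega> n. \<forall>q\<in>A \<times> UNIV. w q = g q})"
      proof
        fix w assume w: "w \<in> {w\<in>\<Omega> n. deficient w A}"
        have "restrict w (A \<times> UNIV) \<in> G A"
          using w finA[OF A] A by (auto simp: G_def \<Omega>_def words_def deficient_def letters_def \<A>_def e)
        moreover have "\<forall>q\<in>A \<times> UNIV. w q = restrict w (A \<times> UNIV) q" by simp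
        ultimately show "w \<in> (\<Union>g\<in>G A. {w\<in>\<Omega> n. \<forall>q\<in>A \<times> UNIV. w q = g q})" using w by blast
      qed
      hence "card {w\<in>\<Omega> n. deficient w A} \<le> card (\<Union>g\<in>G A. {w\<in>\<Omega> n. \<forall>q\<in>A \<times> UNIV. w q = g q})"
        using finG[OF A] by (intro card_mono) auto
      also have "\<dots> \<le> (\<Sum>g\<in>G A. card {w\<in>\<Omega> n. \<forall>q\<in>A \<times> UNIV. w q = g q})" by (rule card_UN_le[OF finG[OF A]])
      finally have "real (card {w\<in>\<Omega> n. deficient w A}) \<le> (\<Sum>g\<in>G A. real (card {w\<in>\<Omega> n. \<forall>q\<in>A \<times> UNIV. w q = g q}))"
        by (simp flip: of_nat_sum)
      also have "\<dots> \<le> (\<Sum>g\<in>G A. C * real (card (\<Omega> n)) / real (m n) ^ (2 * e))"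
      proof (rule sum_mono)
        fix g assume g: "g \<in> G A"
        hence "g ` (A \<times> UNIV) \<subseteq> {1..n}" by (auto simp: G_def)
        hence "real (card {w \<in> \<Omega> n. \<forall>q\<in>A \<times> UNIV. w q = g q}) * real (m n) ^ (2 * e) \<le> C * real (card (\<Omega> n))"
          using elim(1) finA[OF A] by blast
        thus "real (card {w\<in>\<Omega> n. \<forall>q\<in>A \<times> UNIV. w q = g q}) \<le> C * real (card (\<Omega> n)) / real (m n) ^ (2 * e)"
          using elim(2) by (simp add: pos_le_divide_eq)
      qed
      also have "\<dots> = real (card (G A)) * (C * real (card (\<Omega> n)) / real (m n) ^ (2 * e))" by simp
      also have "\<dots> \<le> real (n ^ k * k ^ (2 * e)) * (C * real (card (\<Omega> n)) / real (m n) ^ (2 * e))"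
        using cG[OF A] C by (intro mult_right_mono) (auto simp only: of_nat_le_iff intro!: divide_nonneg_nonneg mult_nonneg_nonneg, auto)
      finally show ?thesis .
    qed
    have cA: "real (card \<A>) \<le> real (m n) ^ e"
    proof -
      have "card \<A> = m n choose e" using n_subsets[of "{..<m n}" e] by (simp add: \<A>_def)
      also have "\<dots> \<le> m n ^ e" by (cases "e \<le> m n") (auto intro: binomial_le_pow simp: binomial_eq_0)
      finally show ?thesis by (simp flip: of_nat_power)
    qed
    have "(\<Sum>w\<in>\<Omega> n. real (card {A. A \<subseteq> {..<m n} \<and> card A = e \<and> deficient w A})) = (\<Sum>w\<in>\<Omega> n. \<Sum>A\<in>{A\<in>\<A>. deficient w A}. 1)"
      by (intro sum.cong) (auto simp: \<A>_def intro!: arg_cong[where f=card])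
    also have "\<dots> = (\<Sum>A\<in>\<A>. \<Sum>w\<in>{w\<in>\<Omega> n. deficient w A}. 1)"
      using fin by (intro sum.swap_restrict) auto
    also have "\<dots> \<le> (\<Sum>A\<in>\<A>. real (n ^ k * k ^ (2 * e)) * (C * real (card (\<Omega> n)) / real (m n) ^ (2 * e)))"
      using one by (intro sum_mono) simp
    also have "\<dots> = real (card \<A>) * (real (n ^ k * k ^ (2 * e)) * (C * real (card (\<Omega> n)) / real (m n) ^ (2 * e)))" by simp
    also have "\<dots> \<le> real (m n) ^ e * (real (n ^ k * k ^ (2 * e)) * (C * real (card (\<Omega> n)) / real (m n) ^ (2 * e)))"
      using cA C by (intro mult_right_mono) auto
    also have "\<dots> = B n * real (card (\<Omega> n))"
    proof -
      have "real (m n) ^ (2 * e) = real (m n) ^ e * real (m n) ^ e" by (simp add: mult_2 power_add)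
      moreover have "real n ^ e = real n ^ k * real n" by (simp add: e)
      ultimately show ?thesis using elim(2,4) by (simp add: B_def power_divide field_simps)
    qed
    finally have "avg (\<Omega> n) (\<lambda>w. real (card {A. A \<subseteq> {..<m n} \<and> card A = e \<and> deficient w A})) \<le> B n"
      unfolding avg_def using elim(3) by (simp add: divide_le_eq)
    moreover have "avg (\<Omega> n) (\<lambda>w. real (card {A. A \<subseteq> {..<m n} \<and> card A = e \<and> deficient w A})) \<ge> 0"
      by (rule avg_nonneg) simp
    ultimately show ?case by simp
  qed
  moreover have "B \<longlonglongrightarrow> 0"
  proof -
    have "(\<lambda>n. real n / real (m n)) \<longlonglongrightarrow> inverse (\<mu> / 2)"
      using tendsto_inverse[OF m_over_n] mu_pos by simp
    thus ?thesis unfolding B_def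
      by (intro real_tendsto_divide_at_top[OF tendsto_mult[OF tendsto_const tendsto_power]] filterlim_real_sequentially) auto
  qed
  ultimately show ?thesis by (rule Lim_null_comparison)
qed

lemma avg_disjoint_families:
  fixes T :: "'t set"
  assumes T: "finite T" "\<And>t. t \<in> T \<Longrightarrow> ty t > 0"
  shows "(\<lambda>n. avg (\<Omega> n) (\<lambda>w. real (card {Cs \<in> cycle_families w (m n) T ty. letter_disjoint w T Cs}))) \<longlonglongrightarrow> (\<Prod>t\<in>T. \<rho> (ty t))"
proof -
  define I where "I = (SIGMA t:T. {..<ty t})"
  define J where "J = card I"
  have finI: "finite I" using T(1) by (auto simp: I_def)
  have J: "J = (\<Sum>t\<in>T. ty t)" unfolding J_def I_def using T(1) by (subst card_SigmaI) auto
  define P where "P = real (\<Prod>t\<in>T. 2 * ty t)"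
  have P: "P > 0" unfolding P_def using T by (auto intro!: prod_pos)
  have bij: "bij_betw (succ_in_block ty) I I" unfolding I_def by (rule bij_succ_in_block) (use T in auto)
  have ci: "card {s \<in> I \<rightarrow>\<^sub>E V. inj_on s I} = (\<Prod>i<J. card V - i)" if "finite V" for V :: "nat set"
    using card_inj_on_subset_funcset[OF finI that subset_refl] by (simp add: J_def atLeast0LessThan)
  \<comment> \<open>\<open>R n\<close> is the average itself, arranged as a product of convergent
    quotients: slots, letters, factorials, the power of n / (2m) that these leave over, and the
    ratio of coefficients. \<open>P\<close> is the number of choices of roots and
    orientations.\<close>
  define R where "R = (\<lambda>n. real (\<Prod>i<J. m n - i) / real (m n) ^ J * (real (\<Prod>i<J. n - i) / real n ^ J) /
     (real (\<Prod>i<2 * J. 2 * m n - i) / real (2 * m n) ^ (2 * J)) * (1 / (2 * real (m n) / real n)) ^ J * norm (coeff n (doubles J) / coeff n (\<lambda>_. 0)) / P)"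
  have "eventually (\<lambda>n. R n = avg (\<Omega> n) (\<lambda>w. real (card {Cs \<in> cycle_families w (m n) T ty. letter_disjoint w T Cs}))) sequentially"
  proof -
    have "eventually (\<lambda>n. m n \<ge> J + 1) sequentially" using m_lim by (simp add: filterlim_at_top)
    thus ?thesis using eventually_ge_at_top[of "J + 1"] coeff_doubles_limit(2)
    proof eventually_elim
      case (elim n)
      define S where "S = (\<Sum>w\<in>\<Omega> n. card (systems w (m n) I (succ_in_block ty)))"
      have "of_nat S = of_nat (card (slot_placements (m n) I) * card {v \<in> I \<rightarrow>\<^sub>E {1..n}. inj_on v I}) *
        (fact (2 * m n - 2 * J) * fps_nth (egf D 2 ^ J * egf D 0 ^ (card {1..n} - J)) (2 * m n - 2 * J))"
        unfolding S_def \<Omega>_def J_def by (rule sum_card_systems[OF finI bij]) simp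
      also have "fps_nth (egf D 2 ^ J * egf D 0 ^ (card {1..n} - J)) (2 * m n - 2 * J) = coeff n (doubles J)"
        unfolding coeff_def using elim by (subst prod_doubles, simp, subst sum_doubles, simp, simp)
      also have "card {v \<in> I \<rightarrow>\<^sub>E {1..n}. inj_on v I} = (\<Prod>i<J. n - i)" by (subst ci) auto
      also have "card (slot_placements (m n) I) = 2 ^ J * (\<Prod>i<J. m n - i)"
        unfolding card_slot_placements[OF finI] by (subst ci) (auto simp: J_def)
      finally have "norm (of_nat S :: complex) = norm (of_nat (2 ^ J * (\<Prod>i<J. m n - i) * (\<Prod>i<J. n - i)) * (fact (2 * m n - 2 * J) * coeff n (doubles J)))"
        by simp
      hence S: "real S = 2 ^ J * real (\<Prod>i<J. m n - i) * real (\<Prod>i<J. n - i) * fact (2 * m n - 2 * J) * norm (coeff n (doubles J))"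
        by (simp only: norm_mult norm_of_nat norm_fact) (simp del: of_nat_prod)
      have fact: "fact (2 * m n) = (fact (2 * m n - 2 * J) :: real) * real (\<Prod>i<2 * J. 2 * m n - i)"
        using fact_eq_prod_diff[of "2 * J" "2 * m n"] elim by (metis (no_types, lifting) Suc_eq_plus1 Suc_leD mult_le_mono2 of_nat_fact of_nat_mult)
      have "avg (\<Omega> n) (\<lambda>w. real (card {Cs \<in> cycle_families w (m n) T ty. letter_disjoint w T Cs})) = real S / P / real (card (\<Omega> n))"
      proof -
        have "real (card (systems w (m n) I (succ_in_block ty))) = P * real (card {Cs \<in> cycle_families w (m n) T ty. letter_disjoint w T Cs})" for w
          using arg_cong[OF card_systems[of T ty w "m n", OF T(1)], of real] T(2) unfolding I_def P_def by simp
        hence "real S = P * (\<Sum>w\<in>\<Omega> n. real (card {Cs \<in> cycle_families w (m n) T ty. letter_disjoint w T Cs}))"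
          unfolding S_def of_nat_sum sum_distrib_left by (intro sum.cong refl)
        thus ?thesis using P by (simp add: avg_def)
      qed
      also have "\<dots> = R n"
      proof -
        define a b c where "a = real (\<Prod>i<J. m n - i)" and "b = real (\<Prod>i<J. n - i)" and "c = real (\<Prod>i<2 * J. 2 * m n - i)"
        define f where "f = (fact (2 * m n - 2 * J) :: real)"
        define u v where "u = norm (coeff n (doubles J))" and "v = norm (coeff n (\<lambda>_. 0))"
        define M N where "M = real (m n)" and "N = real n"
        have pos: "M > 0" "N > 0" "f > 0" "v > 0" "P > 0" using elim P by (auto simp: M_def N_def f_def v_def)
        have c0: "c > 0" unfolding c_def using elim by (auto intro!: prod_pos)
        have "R n = a / M ^ J * (b / N ^ J) / (c / (2 * M) ^ (2 * J)) * (1 / (2 * M / N)) ^ J * (u / v) / P"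
          by (simp add: R_def a_def b_def c_def u_def v_def M_def N_def norm_divide)
        also have "\<dots> = 2 ^ J * a * b * u / (c * v * P)"
        proof -
          have "(2 * M) ^ (2 * J) = 2 ^ J * M ^ J * (2 * M) ^ J" by (simp only: mult_2[of J] power_add power_mult_distrib)
          moreover have "(1 / (2 * M / N)) ^ J = N ^ J / (2 * M) ^ J" by (simp add: power_divide)
          moreover have "a / A * (b / B) / (c / (2 ^ J * A * E)) * (B / E) * (u / v) / P = 2 ^ J * a * b * u / (c * v * P)"
            if "A > 0" "B > 0" "E > 0" for A B E :: real
            using that pos c0 by (simp add: field_simps)
          ultimately show ?thesis using pos by (simp only: zero_less_power zero_less_mult_iff zero_less_numeral simp_thms)
        qed
        also have "\<dots> = real S / P / real (card (\<Omega> n))"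
          unfolding S card_Omega_real fact a_def[symmetric] b_def[symmetric] c_def[symmetric] f_def[symmetric] u_def[symmetric] v_def[symmetric]
          using pos c0 by (simp add: mult_ac)
        finally show ?thesis by simp
      qed
      finally show ?case by simp
    qed
  qed
  moreover have "R \<longlonglongrightarrow> 1 * 1 / 1 * (1 / \<mu>) ^ J * norm (complex_of_real (\<kappa> ^ J)) / P"
    unfolding R_def using tendsto_mu mu_pos
    by (intro tendsto_divide tendsto_mult tendsto_power tendsto_norm tendsto_const tendsto_prod_diff m_lim N_lim filterlim_ident coeff_doubles_limit(1)) (auto simp: P less_imp_neq[OF P, symmetric])
  moreover have "1 * 1 / 1 * (1 / \<mu>) ^ J * norm (complex_of_real (\<kappa> ^ J)) / P = (\<Prod>t\<in>T. \<rho> (ty t))"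
  proof -
    have "\<kappa> \<ge> 0" unfolding \<kappa>_def using X_pos Dl_X by (intro divide_nonneg_nonneg Em_nonneg) auto
    hence "1 * 1 / 1 * (1 / \<mu>) ^ J * norm (complex_of_real (\<kappa> ^ J)) / P = (\<kappa> / \<mu>) ^ J / P"
      by (simp add: power_divide norm_power del: of_real_power)
    also have "\<dots> = (\<Prod>t\<in>T. (\<kappa> / \<mu>) ^ ty t) / (\<Prod>t\<in>T. 2 * real (ty t))"
      by (simp add: J power_sum P_def)
    also have "\<dots> = (\<Prod>t\<in>T. \<rho> (ty t))" by (simp add: \<rho>_def prod_dividef)
    finally show ?thesis .
  qed
  ultimately show ?thesis using Lim_transform_eventually by fastforce
qed

text \<open>The average is squeezed from below by the disjoint families and from above by these plus
  a multiple of the deficient slot sets, which vanish on average.\<close>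

lemma avg_families:
  fixes T :: "'t set"
  assumes T: "finite T" "\<And>t. t \<in> T \<Longrightarrow> ty t > 0"
  shows "(\<lambda>n. avg (\<Omega> n) (\<lambda>w. real (card {Cs \<in> cycle_families w (m n) T ty. inj_on Cs T}))) \<longlonglongrightarrow> (\<Prod>t\<in>T. \<rho> (ty t))"
proof (rule tendsto_sandwich[OF _ _ avg_disjoint_families])
  let ?d = "\<lambda>n w e. real (card {A. A \<subseteq> {..<m n} \<and> card A = e \<and> deficient w A})"
  let ?dj = "\<lambda>n w. real (card {Cs \<in> cycle_families w (m n) T ty. letter_disjoint w T Cs})"
  show "eventually (\<lambda>n. avg (\<Omega> n) (?dj n) \<le> avg (\<Omega> n) (\<lambda>w. real (card {Cs \<in> cycle_families w (m n) T ty. inj_on Cs T}))) sequentially"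
    by (intro always_eventually allI avg_mono of_nat_mono card_inj_families_le(1) T)
  show "eventually (\<lambda>n. avg (\<Omega> n) (\<lambda>w. real (card {Cs \<in> cycle_families w (m n) T ty. inj_on Cs T})) \<le>
     avg (\<Omega> n) (?dj n) + (\<Sum>e\<le>(\<Sum>t\<in>T. ty t). (2 ^ e) ^ card T * avg (\<Omega> n) (\<lambda>w. ?d n w e))) sequentially"
  proof (intro always_eventually allI)
    fix n
    have "avg (\<Omega> n) (\<lambda>w. real (card {Cs \<in> cycle_families w (m n) T ty. inj_on Cs T})) \<le>
      avg (\<Omega> n) (\<lambda>w. ?dj n w + (\<Sum>e\<le>(\<Sum>t\<in>T. ty t). (2 ^ e) ^ card T * ?d n w e))"
    proof (rule avg_mono)
      fix w
      have "real (card {Cs \<in> cycle_families w (m n) T ty. inj_on Cs T}) \<le> real (card {Cs \<in> cycle_families w (m n) T ty. letter_disjoint w T Cs}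
        + (\<Sum>e\<le>(\<Sum>t\<in>T. ty t). (2 ^ e) ^ card T * card {A. A \<subseteq> {..<m n} \<and> card A = e \<and> deficient w A}))"
        by (intro of_nat_mono card_inj_families_le(2) T)
      thus "real (card {Cs \<in> cycle_families w (m n) T ty. inj_on Cs T}) \<le> ?dj n w + (\<Sum>e\<le>(\<Sum>t\<in>T. ty t). (2 ^ e) ^ card T * ?d n w e)"
        by simp
    qed
    thus "avg (\<Omega> n) (\<lambda>w. real (card {Cs \<in> cycle_families w (m n) T ty. inj_on Cs T})) \<le>
     avg (\<Omega> n) (?dj n) + (\<Sum>e\<le>(\<Sum>t\<in>T. ty t). (2 ^ e) ^ card T * avg (\<Omega> n) (\<lambda>w. ?d n w e))"
      unfolding avg_add avg_sum avg_cmult .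
  qed
  have "(\<lambda>n. avg (\<Omega> n) (?dj n) + (\<Sum>e\<le>(\<Sum>t\<in>T. ty t). (2 ^ e) ^ card T * avg (\<Omega> n) (\<lambda>w. ?d n w e))) \<longlonglongrightarrow>
     (\<Prod>t\<in>T. \<rho> (ty t)) + (\<Sum>e\<le>(\<Sum>t\<in>T. ty t). (2 ^ e) ^ card T * 0)"
    by (intro tendsto_add tendsto_sum tendsto_mult tendsto_const avg_deficient avg_disjoint_families T)
  thus "(\<lambda>n. avg (\<Omega> n) (?dj n) + (\<Sum>e\<le>(\<Sum>t\<in>T. ty t). (2 ^ e) ^ card T * avg (\<Omega> n) (\<lambda>w. ?d n w e))) \<longlonglongrightarrow> (\<Prod>t\<in>T. \<rho> (ty t))"
    by simp
qed (use T in auto)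

lemma cycle_counts_poisson:
  "(\<lambda>n. avg (\<Omega> n) (\<lambda>w. \<Prod>j=1..k. if card (cycle_sets w (m n) j) = t j then 1 else 0)) \<longlonglongrightarrow>
     (\<Prod>j=1..k. \<rho> j ^ t j / fact (t j) * exp (- \<rho> j))"
proof (rule sieve)
  fix r :: "nat \<Rightarrow> nat"
  \<comment> \<open>One index \<open>(j, i)\<close> for each of the \<open>r j\<close> cycles of
    length \<open>j\<close>, with \<open>fst\<close> as the length.\<close>
  define T where "T = (SIGMA j:{1..k}. {..<r j})"
  have T: "finite T" "\<And>t. t \<in> T \<Longrightarrow> fst t > 0" "fst ` T \<subseteq> {1..k}" by (auto simp: T_def)
  have cT: "card {t\<in>T. fst t = j} = r j" if "j \<in> {1..k}" for j
  proof -
    have "{t\<in>T. fst t = j} = {j} \<times> {..<r j}" using that by (auto simp: T_def)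
    thus ?thesis by (simp add: card_cartesian_product)
  qed
  have "card {Cs \<in> cycle_families w (m n) T fst. inj_on Cs T} = (\<Prod>j=1..k. fact (r j) * (card (cycle_sets w (m n) j) choose r j))" for w n
    unfolding card_inj_families[OF T(1) finite_atLeastAtMost T(3)] using cT
    by (intro prod.cong) (auto simp: prod_diff_eq_fact_choose)
  note e = this
  have eq: "real (card {Cs \<in> cycle_families w (m n) T fst. inj_on Cs T}) = (\<Prod>j=1..k. fact (r j)) * (\<Prod>j=1..k. real (card (cycle_sets w (m n) j) choose r j))" for w n
    unfolding e of_nat_prod of_nat_mult of_nat_fact prod.distrib ..
  have "(\<Prod>t\<in>T. \<rho> (fst t)) = (\<Prod>(j, i)\<in>T. \<rho> j)" by (simp add: case_prod_beta)
  also have "\<dots> = (\<Prod>j=1..k. \<Prod>i<r j. \<rho> j)" unfolding T_def by (rule prod.Sigma[symmetric]) auto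
  finally have pr: "(\<Prod>t\<in>T. \<rho> (fst t)) = (\<Prod>j=1..k. \<rho> j ^ r j)" by simp
  have "(\<lambda>n. (\<Prod>j=1..k. fact (r j)) * avg (\<Omega> n) (\<lambda>w. \<Prod>j=1..k. real (card (cycle_sets w (m n) j) choose r j))) \<longlonglongrightarrow> (\<Prod>j=1..k. \<rho> j ^ r j)"
    using avg_families[of T fst, OF T(1)] T(2) unfolding eq avg_cmult pr by blast
  hence "(\<lambda>n. (\<Prod>j=1..k. fact (r j)) * avg (\<Omega> n) (\<lambda>w. \<Prod>j=1..k. real (card (cycle_sets w (m n) j) choose r j)) / (\<Prod>j=1..k. fact (r j))) \<longlonglongrightarrow> (\<Prod>j=1..k. \<rho> j ^ r j) / (\<Prod>j=1..k. fact (r j))"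
    by (intro tendsto_divide tendsto_const) auto
  thus "(\<lambda>n. avg (\<Omega> n) (\<lambda>w. \<Prod>j=1..k. real (card (cycle_sets w (m n) j) choose r j))) \<longlonglongrightarrow> (\<Prod>j=1..k. \<rho> j ^ r j / fact (r j))"
    by (simp add: prod_dividef)
qed simp

end

section \<open>From words to graphs\<close>

definition slot_edge :: "(nat \<times> bool \<Rightarrow> 'v) \<Rightarrow> nat \<Rightarrow> 'v set" where
  "slot_edge w s = {w (s, False), w (s, True)}"

definition simple_word :: "(nat \<times> bool \<Rightarrow> 'v) \<Rightarrow> nat \<Rightarrow> bool" where
  "simple_word w m \<longleftrightarrow> (\<forall>s<m. w (s, False) \<noteq> w (s, True)) \<and> inj_on (slot_edge w) {..<m}"

definition word_graph :: "nat \<Rightarrow> nat \<Rightarrow> (nat \<times> bool \<Rightarrow> nat) \<Rightarrow> nat graph" where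
  "word_graph n m w = ({1..n}, slot_edge w ` {..<m})"

lemma slot_edge_pos: "slot_edge w (fst p) = {w p, w (opp p)}"
  by (cases p; cases "snd p") (auto simp: slot_edge_def opp_def)

lemma letters_eq_Union: "letters w A = \<Union> (slot_edge w ` A)"
proof -
  have "A \<times> UNIV = (\<lambda>s. (s, False)) ` A \<union> (\<lambda>s. (s, True)) ` A" by (auto intro: bool.exhaust)
  thus ?thesis by (auto simp: letters_def slot_edge_def)
qed

lemma cyc_loop:
  assumes "w (s, False) = w (s, True)" shows "cyc w {s}"
proof -
  have "restrict (\<lambda>_. (s, False)) {..<1} \<in> rooted_cycles w (card {s}) {s}"
    using assms by (auto simp: rooted_cycles_def opp_def inj_on_def)
  thus ?thesis by (auto simp: cyc_def)
qed

text \<open>Two loops at one vertex do not form a cycle of length two, whose letters have to be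
  distinct; they are detected by \<open>cyc_loop\<close> instead.\<close>

lemma cyc_double_edge:
  assumes "s \<noteq> t" "slot_edge w s = slot_edge w t" "w (s, False) \<noteq> w (s, True)" shows "cyc w {s, t}"
proof -
  have "w (t, False) = w (s, True) \<and> w (t, True) = w (s, False) \<or> w (t, True) = w (s, True) \<and> w (t, False) = w (s, False)"
    using assms(2) by (auto simp: slot_edge_def doubleton_eq_iff)
  then obtain b where b: "w (t, b) = w (s, True)" "w (t, \<not> b) = w (s, False)" by force
  have l: "{..<2::nat} = {0, 1}" by auto
  have "restrict (\<lambda>x. if x = 0 then (s, False) else (t, b)) {..<2} \<in> rooted_cycles w 2 {s, t}"
    unfolding rooted_cycles_def using assms b by (auto simp: l opp_def less_2_cases_iff)
  moreover have "card {s, t} = 2" using assms(1) by simp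
  ultimately have "rooted_cycles w (card {s, t}) {s, t} \<noteq> {}" by (simp only:) blast
  thus ?thesis by (simp add: cyc_def)
qed

lemma simple_word_iff:
  "simple_word w m \<longleftrightarrow> cycle_sets w m 1 = {} \<and> cycle_sets w m 2 = {}"
proof
  assume sw: "simple_word w m"
  have "C \<notin> cycle_sets w m 1" for C
  proof
    assume C: "C \<in> cycle_sets w m 1"
    then obtain c where c: "c \<in> rooted_cycles w 1 C" "C \<subseteq> {..<m}" by (auto simp: cycle_sets_def cyc_def)
    have "w (opp (c 0)) = w (c 0)" using rooted_cyclesD(4)[OF c(1), of 0] by simp
    moreover have "fst (c 0) < m" using rooted_cyclesD(1)[OF c(1), of 0] c(2) by auto
    moreover have "slot_edge w (fst (c 0)) = {w (c 0), w (opp (c 0))}" by (rule slot_edge_pos)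
    ultimately show False using sw by (auto simp: simple_word_def slot_edge_def doubleton_eq_iff)
  qed
  moreover have "C \<notin> cycle_sets w m 2" for C
  proof
    assume C: "C \<in> cycle_sets w m 2"
    then obtain c where c: "c \<in> rooted_cycles w 2 C" "C \<subseteq> {..<m}" by (auto simp: cycle_sets_def cyc_def)
    have "w (opp (c 0)) = w (c 1)" "w (opp (c 1)) = w (c 0)"
      using rooted_cyclesD(4)[OF c(1), of 0] rooted_cyclesD(4)[OF c(1), of 1] by (auto simp: numeral_2_eq_2)
    hence "slot_edge w (fst (c 0)) = slot_edge w (fst (c 1))" unfolding slot_edge_pos by auto
    moreover have "fst (c 0) < m" "fst (c 1) < m" using rooted_cyclesD(1)[OF c(1), of 0] rooted_cyclesD(1)[OF c(1), of 1] c(2) by auto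
    ultimately have "fst (c 0) = fst (c 1)" using sw by (auto simp: simple_word_def inj_on_def)
    thus False using rooted_cyclesD(2)[OF c(1), of 0 1] by simp
  qed
  ultimately show "cycle_sets w m 1 = {} \<and> cycle_sets w m 2 = {}" by blast
next
  assume *: "cycle_sets w m 1 = {} \<and> cycle_sets w m 2 = {}"
  have nl: "w (s, False) \<noteq> w (s, True)" if "s < m" for s
  proof
    assume "w (s, False) = w (s, True)"
    hence "{s} \<in> cycle_sets w m 1" using cyc_loop that by (auto simp: cycle_sets_def)
    thus False using * by simp
  qed
  moreover have "inj_on (slot_edge w) {..<m}"
  proof (rule inj_onI, rule ccontr)
    fix s t assume st: "s \<in> {..<m}" "t \<in> {..<m}" "slot_edge w s = slot_edge w t" "s \<noteq> t"
    hence "{s, t} \<in> cycle_sets w m 2" using cyc_double_edge[of s t w] nl by (auto simp: cycle_sets_def)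
    thus False using * by simp
  qed
  ultimately show "simple_word w m" by (simp add: simple_word_def)
qed

section \<open>Cycles of the graph and cycles of the word\<close>

lemma cycle_graph_edges: "edges (cycle_graph j) = (\<lambda>x. {x, Suc x mod j}) ` {..<j}"
  by (auto simp: cycle_graph_def)

lemma cycle_set_imp_subgraph:
  assumes w: "w \<in> pos m \<rightarrow>\<^sub>E {1..n}" and sw: "simple_word w m" and C: "C \<in> cycle_sets w m j" and j: "j > 0"
  shows "subgraph (letters w C, slot_edge w ` C) (word_graph n m w) \<and> graph_iso (cycle_graph j) (letters w C, slot_edge w ` C)"
proof
  obtain c where c: "c \<in> rooted_cycles w j C" and Cm: "C \<subseteq> {..<m}" using C by (auto simp: cycle_sets_def cyc_def)
  have fC: "finite C" using Cm finite_subset by auto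
  have "card (slot_edge w s) = 2" if "s \<in> C" for s using that Cm sw by (auto simp: slot_edge_def simple_word_def)
  moreover have "letters w C \<subseteq> {1..n}" using w Cm by (auto simp: letters_def mem_pos_iff PiE_def Pi_def)
  ultimately show "subgraph (letters w C, slot_edge w ` C) (word_graph n m w)"
    using fC Cm by (auto simp: subgraph_def simple_graph_def word_graph_def letters_eq_Union slot_edge_def)
  have "bij_betw (\<lambda>x. w (c x)) {0..<j} (letters w C)"
    using letters_rooted[OF c j] rooted_cyclesD(5)[OF c j] by (auto simp: bij_betw_def inj_on_def atLeast0LessThan)
  moreover have "slot_edge w ` C = (\<lambda>e. (\<lambda>x. w (c x)) ` e) ` edges (cycle_graph j)"
  proof -
    have "slot_edge w ` C = (\<lambda>x. slot_edge w (fst (c x))) ` {..<j}" using rooted_cyclesD(3)[OF c j] by auto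
    also have "\<dots> = (\<lambda>x. {w (c x), w (c (Suc x mod j))}) ` {..<j}"
      using rooted_cyclesD(4)[OF c j] by (intro image_cong) (auto simp: slot_edge_pos)
    finally show ?thesis by (simp add: cycle_graph_edges image_image)
  qed
  ultimately show "graph_iso (cycle_graph j) (letters w C, slot_edge w ` C)"
    unfolding graph_iso_def by (intro exI[of _ "\<lambda>x. w (c x)"]) (auto simp: cycle_graph_def)
qed

text \<open>Otherwise each of \<open>x\<close> and \<open>y\<close> would be the cyclic successor of
  the other, which happens only for \<open>j = 2\<close>.\<close>

lemma cyclic_pair_inj:
  assumes "x < j" "y < j" "j \<ge> 3" "{x, Suc x mod j} = {y, Suc y mod j}"
  shows "x = y"
proof (rule ccontr)
  assume "x \<noteq> y"
  hence "x = Suc y mod j" "y = Suc x mod j" using assms(4) by (auto simp: doubleton_eq_iff)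
  moreover have "Suc z mod j = (if Suc z = j then 0 else Suc z)" if "z < j" for z using that by auto
  ultimately have h: "Suc y = j \<Longrightarrow> x = 0" "Suc y \<noteq> j \<Longrightarrow> x = Suc y" "Suc x = j \<Longrightarrow> y = 0" "Suc x \<noteq> j \<Longrightarrow> y = Suc x"
    using assms(1,2) by metis+
  show False
  proof (cases "Suc x = j")
    case True
    thus ?thesis using h(2,3) assms(3) by linarith
  next
    case False
    thus ?thesis using h(1,2,4) assms(3) by linarith
  qed
qed

text \<open>Each edge of \<open>S\<close> is carried by some slot, entered at the end whose letter
  is \<open>f x\<close>. The slots are distinct because the edges are, by
  \<open>cyclic_pair_inj\<close>.\<close>

lemma subgraph_imp_cycle_set:
  fixes w :: "nat \<times> bool \<Rightarrow> nat"
  assumes sw: "simple_word w m" and j: "j \<ge> 3"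
    and S: "subgraph S (word_graph n m w)" "graph_iso (cycle_graph j) S"
  shows "\<exists>C\<in>cycle_sets w m j. S = (letters w C, slot_edge w ` C)"
proof -
  obtain f where f: "bij_betw f {0..<j} (verts S)" "edges S = (\<lambda>e. f ` e) ` edges (cycle_graph j)"
    using S(2) by (auto simp: graph_iso_def cycle_graph_def)
  have eS: "edges S = (\<lambda>x. {f x, f (Suc x mod j)}) ` {..<j}"
    unfolding f(2) cycle_graph_edges image_image by simp
  have finj: "x = y" if "x < j" "y < j" "f x = f y" for x y using f(1) that by (auto simp: bij_betw_def inj_on_def)
  have lt: "Suc x mod j < j" for x using j by simp
  have ne: "f x \<noteq> f (Suc x mod j)" if "x < j" for x
  proof
    assume "f x = f (Suc x mod j)"
    hence "x = Suc x mod j" using finj[OF that lt] by simp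
    thus False using that j by (cases "Suc x = j") auto
  qed
  have "\<exists>p. fst p < m \<and> w p = f x \<and> w (opp p) = f (Suc x mod j)" if x: "x < j" for x
  proof -
    have "{f x, f (Suc x mod j)} \<in> slot_edge w ` {..<m}"
      using S(1) x unfolding subgraph_def eS word_graph_def by auto
    then obtain s where s: "s < m" "slot_edge w s = {f x, f (Suc x mod j)}" by auto
    hence "w (s, False) = f x \<and> w (s, True) = f (Suc x mod j) \<or> w (s, True) = f x \<and> w (s, False) = f (Suc x mod j)"
      by (auto simp: slot_edge_def doubleton_eq_iff)
    thus ?thesis
    proof
      assume "w (s, False) = f x \<and> w (s, True) = f (Suc x mod j)"
      thus ?thesis using s by (intro exI[of _ "(s, False)"]) (simp add: opp_def)
    next
      assume "w (s, True) = f x \<and> w (s, False) = f (Suc x mod j)"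
      thus ?thesis using s by (intro exI[of _ "(s, True)"]) (simp add: opp_def)
    qed
  qed
  then obtain p where p: "\<And>x. x < j \<Longrightarrow> fst (p x) < m \<and> w (p x) = f x \<and> w (opp (p x)) = f (Suc x mod j)" by metis
  define c where "c = restrict p {..<j}"
  define C where "C = (\<lambda>x. fst (p x)) ` {..<j}"
  have pinj: "x = y" if "x < j" "y < j" "fst (p x) = fst (p y)" for x y
  proof -
    have "{f x, f (Suc x mod j)} = {f y, f (Suc y mod j)}"
      using slot_edge_pos[of w "p x"] slot_edge_pos[of w "p y"] p that by simp
    hence "f ` {x, Suc x mod j} = f ` {y, Suc y mod j}" by simp
    hence "{x, Suc x mod j} = {y, Suc y mod j}"
      using inj_on_image_eq_iff[of f "{0..<j}" "{x, Suc x mod j}" "{y, Suc y mod j}"] f(1) that lt by (auto simp: bij_betw_def)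
    thus ?thesis using cyclic_pair_inj that j by blast
  qed
  have cC: "c \<in> rooted_cycles w j C"
    unfolding rooted_cycles_def
  proof (intro CollectI conjI)
    show "c \<in> {..<j} \<rightarrow>\<^sub>E C \<times> UNIV" by (auto simp: c_def C_def mem_Times_iff)
    show "inj_on (\<lambda>x. fst (c x)) {..<j}" by (rule inj_onI, rule pinj) (auto simp: c_def)
    show "(\<lambda>x. fst (c x)) ` {..<j} = C" by (auto simp: c_def C_def)
    show "\<forall>x<j. w (opp (c x)) = w (c (Suc x mod j))" using p lt by (auto simp: c_def)
    show "inj_on (\<lambda>x. w (c x)) {..<j}" by (rule inj_onI, rule finj) (use p in \<open>auto simp: c_def\<close>)
  qed
  have j0: "j > 0" using j by simp
  have cardC: "card C = j" by (rule card_rooted[OF cC j0])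
  have "C \<in> cycle_sets w m j"
    using p cC cardC j0 by (auto simp: cycle_sets_def cyc_def C_def)
  moreover have "verts S = letters w C"
  proof -
    have "letters w C = f ` {..<j}" unfolding letters_rooted[OF cC j0] using p by (intro image_cong) (auto simp: c_def)
    thus ?thesis using f(1) by (simp add: bij_betw_def atLeast0LessThan)
  qed
  moreover have "edges S = slot_edge w ` C"
    unfolding eS C_def image_image slot_edge_pos using p by (intro image_cong) auto
  ultimately show ?thesis by (intro bexI[of _ C]) (auto simp: prod_eq_iff)
qed

text \<open>A simple word carries each edge on one slot only, so a cycle of the word is recovered
  from the edges of its subgraph.\<close>

lemma subgraph_count_cycle:
  assumes w: "w \<in> pos m \<rightarrow>\<^sub>E {1..n}" and sw: "simple_word w m" and j: "j \<ge> 3"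
  shows "subgraph_count (cycle_graph j) (word_graph n m w) = card (cycle_sets w m j)"
proof -
  have "bij_betw (\<lambda>C. (letters w C, slot_edge w ` C)) (cycle_sets w m j) {S. subgraph S (word_graph n m w) \<and> graph_iso (cycle_graph j) S}"
  proof (rule bij_betw_imageI)
    show "inj_on (\<lambda>C. (letters w C, slot_edge w ` C)) (cycle_sets w m j)"
    proof (rule inj_onI)
      fix C C' assume C: "C \<in> cycle_sets w m j" "C' \<in> cycle_sets w m j" "(letters w C, slot_edge w ` C) = (letters w C', slot_edge w ` C')"
      thus "C = C'" using sw inj_on_image_eq_iff[of "slot_edge w" "{..<m}" C C'] by (auto simp: simple_word_def cycle_sets_def)
    qed
    show "(\<lambda>C. (letters w C, slot_edge w ` C)) ` cycle_sets w m j = {S. subgraph S (word_graph n m w) \<and> graph_iso (cycle_graph j) S}"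
    proof (intro equalityI subsetI)
      fix S assume "S \<in> (\<lambda>C. (letters w C, slot_edge w ` C)) ` cycle_sets w m j"
      then obtain C where C: "C \<in> cycle_sets w m j" "S = (letters w C, slot_edge w ` C)" by (rule imageE)
      show "S \<in> {S. subgraph S (word_graph n m w) \<and> graph_iso (cycle_graph j) S}"
        unfolding C(2) mem_Collect_eq by (rule cycle_set_imp_subgraph[OF w sw C(1)]) (use j in simp)
    next
      fix S assume "S \<in> {S. subgraph S (word_graph n m w) \<and> graph_iso (cycle_graph j) S}"
      hence S: "subgraph S (word_graph n m w)" "graph_iso (cycle_graph j) S" by (simp_all only: mem_Collect_eq)
      show "S \<in> (\<lambda>C. (letters w C, slot_edge w ` C)) ` cycle_sets w m j"
        using subgraph_imp_cycle_set[OF sw j S] by (rule bexE) (rule image_eqI)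
    qed
  qed
  from bij_betw_same_card[OF this] show ?thesis by (simp only: subgraph_count_def)
qed

text \<open>The slots that carry edges of \<open>S\<close> are as many as these edges, and all their
  letters are vertices of \<open>S\<close>.\<close>

lemma subgraph_imp_deficient:
  assumes sw: "simple_word w m" and S: "subgraph S (word_graph n m w)" and lt: "card (verts S) < card (edges S)"
  shows "\<exists>A. A \<subseteq> {..<m} \<and> card A = card (edges S) \<and> deficient w A"
proof -
  define A where "A = {s. s < m \<and> slot_edge w s \<in> edges S}"
  have im: "slot_edge w ` A = edges S" using S by (auto simp: A_def subgraph_def word_graph_def)
  have "inj_on (slot_edge w) A" using sw by (auto simp: simple_word_def A_def inj_on_def)
  hence cA: "card A = card (edges S)" using card_image im by metis
  have "letters w A \<subseteq> verts S" unfolding letters_eq_Union im using S by (auto simp: subgraph_def simple_graph_def)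
  hence "card (letters w A) \<le> card (verts S)" using S by (intro card_mono) (auto simp: subgraph_def simple_graph_def)
  hence "deficient w A" using lt cA by (simp add: deficient_def)
  thus ?thesis using cA by (intro exI[of _ A]) (auto simp: A_def)
qed

text \<open>Without loops, an edge at \<open>v\<close> has exactly one of its ends there; without
  repeated edges, slots and edges correspond.\<close>

lemma word_degree:
  assumes "simple_word w m"
  shows "vertex_degree (word_graph n m w) v = card {p \<in> pos m. w p = v}"
proof -
  have "bij_betw fst {p \<in> pos m. w p = v} {s. s < m \<and> v \<in> slot_edge w s}"
  proof (rule bij_betw_imageI)
    show "inj_on fst {p \<in> pos m. w p = v}"
    proof (rule inj_onI)
      fix p q assume pq: "p \<in> {p \<in> pos m. w p = v}" "q \<in> {p \<in> pos m. w p = v}" "fst p = fst q"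
      show "p = q"
      proof (rule ccontr)
        assume "p \<noteq> q"
        hence "p = opp q" using fst_eq_cases[OF pq(3)] by simp
        hence "slot_edge w (fst q) = {v}" using pq slot_edge_pos[of w q] by auto
        thus False using assms pq by (auto simp: slot_edge_def simple_word_def mem_pos_iff doubleton_eq_iff)
      qed
    qed
    show "fst ` {p \<in> pos m. w p = v} = {s. s < m \<and> v \<in> slot_edge w s}"
    proof
      show "fst ` {p \<in> pos m. w p = v} \<subseteq> {s. s < m \<and> v \<in> slot_edge w s}"
      proof (rule image_subsetI)
        fix p assume "p \<in> {p \<in> pos m. w p = v}"
        thus "fst p \<in> {s. s < m \<and> v \<in> slot_edge w s}" using slot_edge_pos[of w p] by (simp add: mem_pos_iff)
      qed
      show "{s. s < m \<and> v \<in> slot_edge w s} \<subseteq> fst ` {p \<in> pos m. w p = v}"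
        by (force simp: slot_edge_def mem_pos_iff image_iff)
    qed
  qed
  hence c1: "card {p \<in> pos m. w p = v} = card {s. s < m \<and> v \<in> slot_edge w s}" by (rule bij_betw_same_card)
  have "{e \<in> slot_edge w ` {..<m}. v \<in> e} = slot_edge w ` {s. s < m \<and> v \<in> slot_edge w s}" by auto
  moreover have "inj_on (slot_edge w) {s. s < m \<and> v \<in> slot_edge w s}" using assms by (auto simp: simple_word_def inj_on_def)
  ultimately show ?thesis unfolding c1 vertex_degree_def word_graph_def by (simp add: card_image)
qed

lemma word_graph_mem:
  assumes w: "w \<in> words (pos m) {1..n} (\<lambda>_. D)" and sw: "simple_word w m"
  shows "word_graph n m w \<in> nmD_graphs n m D"
proof -
  have "card (slot_edge w ` {..<m}) = m" using sw by (simp add: card_image simple_word_def)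
  moreover have "slot_edge w s \<subseteq> {1..n} \<and> card (slot_edge w s) = 2" if "s < m" for s
    using that w sw by (auto simp: slot_edge_def simple_word_def words_def pos_def)
  ultimately show ?thesis using w word_degree[OF sw, of n]
    by (auto simp: nmD_graphs_def simple_graph_def word_graph_def words_def)
qed

text \<open>A simple word of \<open>G\<close> is an ordering of its edges together with an
  orientation of each. The number is the same for all graphs, which makes the graph of a uniform
  simple word uniform.\<close>

lemma card_word_fibre:
  assumes G: "G \<in> nmD_graphs n m D"
  shows "card {w \<in> words (pos m) {1..n} (\<lambda>_. D). simple_word w m \<and> word_graph n m w = G} = (\<Prod>i<m. m - i) * 2 ^ m"
proof -
  define E where "E = edges G"
  have fE: "finite E" "card E = m" and E2: "\<And>e. e \<in> E \<Longrightarrow> card e = 2" "\<And>e. e \<in> E \<Longrightarrow> e \<subseteq> {1..n}" and Gv: "verts G = {1..n}"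
    and deg: "\<And>v. v \<in> {1..n} \<Longrightarrow> vertex_degree G v \<in> D"
  proof -
    show "card E = m" "\<And>e. e \<in> E \<Longrightarrow> card e = 2" "\<And>e. e \<in> E \<Longrightarrow> e \<subseteq> {1..n}" "verts G = {1..n}"
       "\<And>v. v \<in> {1..n} \<Longrightarrow> vertex_degree G v \<in> D"
      using G by (auto simp: nmD_graphs_def E_def simple_graph_def)
    thus "finite E" by (intro finite_subset[of E "Pow {1..n}"]) auto
  qed
  have mm: "e = {Min e, Max e} \<and> Min e \<noteq> Max e" if "e \<in> E" for e
  proof -
    have "card e = 2" by (rule E2(1)[OF that])
    then obtain a b where "e = {a, b}" "a \<noteq> b" by (auto simp: card_2_iff)
    thus ?thesis by (cases "a < b") auto
  qed
  define Inj where "Inj = {f \<in> {..<m} \<rightarrow>\<^sub>E E. inj_on f {..<m}}"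
  \<comment> \<open>The Boolean records whether the end \<open>True\<close> of the slot carries the
    smaller vertex, which turns orientations into a plain product.\<close>
  define \<phi> where "\<phi> = (\<lambda>w :: nat \<times> bool \<Rightarrow> nat. (restrict (slot_edge w) {..<m}, restrict (\<lambda>s. w (s, True) = Min (slot_edge w s)) {..<m}))"
  define \<psi> where "\<psi> = (\<lambda>(f :: nat \<Rightarrow> nat set, \<beta> :: nat \<Rightarrow> bool). restrict (\<lambda>p. if snd p = \<beta> (fst p) then Min (f (fst p)) else Max (f (fst p))) (pos m))"
  have edge_\<psi>: "slot_edge (\<psi> (f, \<beta>)) s = f s" if "f \<in> Inj" "s < m" for f \<beta> s
  proof -
    have "f s \<in> E" using that by (auto simp: Inj_def)
    hence "f s = {Min (f s), Max (f s)}" using mm by blast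
    thus ?thesis using that(2) by (cases "\<beta> s") (auto simp: slot_edge_def \<psi>_def mem_pos_iff)
  qed
  have "bij_betw \<phi> {w \<in> words (pos m) {1..n} (\<lambda>_. D). simple_word w m \<and> word_graph n m w = G} (Inj \<times> ({..<m} \<rightarrow>\<^sub>E UNIV))"
  proof (rule bij_betw_byWitness[where f' = \<psi>])
    show "\<forall>w\<in>{w \<in> words (pos m) {1..n} (\<lambda>_. D). simple_word w m \<and> word_graph n m w = G}. \<psi> (\<phi> w) = w"
    proof
      fix w assume "w \<in> {w \<in> words (pos m) {1..n} (\<lambda>_. D). simple_word w m \<and> word_graph n m w = G}"
      hence w: "w \<in> pos m \<rightarrow>\<^sub>E {1..n}" "simple_word w m" by (auto simp: words_def)
      show "\<psi> (\<phi> w) = w"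
      proof
        fix p :: "nat \<times> bool"
        show "\<psi> (\<phi> w) p = w p"
        proof (cases "p \<in> pos m")
          case True
          obtain s b where p: "p = (s, b)" by (cases p)
          have s: "s < m" using True by (simp add: p mem_pos_iff)
          have "w (s, False) \<noteq> w (s, True)" using w(2) s by (simp add: simple_word_def)
          hence "w p = (if b = (w (s, True) = Min {w (s, False), w (s, True)}) then Min {w (s, False), w (s, True)} else Max {w (s, False), w (s, True)})"
            unfolding p by (cases b; cases "w (s, False) < w (s, True)") auto
          thus ?thesis using True s by (simp add: \<psi>_def \<phi>_def p slot_edge_def)
        next
          case False
          thus ?thesis using PiE_arb[OF w(1) False] by (simp add: \<psi>_def \<phi>_def)
        qed
      qed
    qed
    show "\<forall>z\<in>Inj \<times> ({..<m} \<rightarrow>\<^sub>E UNIV). \<phi> (\<psi> z) = z"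
    proof
      fix z assume "z \<in> Inj \<times> ({..<m} \<rightarrow>\<^sub>E (UNIV :: bool set))"
      then obtain f \<beta> where z: "z = (f, \<beta>)" "f \<in> Inj" "\<beta> \<in> {..<m} \<rightarrow>\<^sub>E UNIV" by auto
      have 1: "restrict (slot_edge (\<psi> z)) {..<m} = f"
        using edge_\<psi>[OF z(2)] z(2) by (auto simp: z(1) fun_eq_iff Inj_def PiE_def extensional_def)
      have "(\<psi> z (s, True) = Min (slot_edge (\<psi> z) s)) = \<beta> s" if s: "s < m" for s
      proof -
        have "f s \<in> E" using z(2) s by (auto simp: Inj_def)
        hence "Min (f s) \<noteq> Max (f s)" using mm by blast
        thus ?thesis using s unfolding z(1) edge_\<psi>[OF z(2) s] by (simp add: \<psi>_def mem_pos_iff)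
      qed
      hence "restrict (\<lambda>s. \<psi> z (s, True) = Min (slot_edge (\<psi> z) s)) {..<m} = \<beta>"
        using z(3) by (auto simp: fun_eq_iff PiE_def extensional_def)
      thus "\<phi> (\<psi> z) = z" using 1 by (simp add: \<phi>_def z(1))
    qed
    show "\<phi> ` {w \<in> words (pos m) {1..n} (\<lambda>_. D). simple_word w m \<and> word_graph n m w = G} \<subseteq> Inj \<times> ({..<m} \<rightarrow>\<^sub>E UNIV)"
    proof (rule image_subsetI)
      fix w assume "w \<in> {w \<in> words (pos m) {1..n} (\<lambda>_. D). simple_word w m \<and> word_graph n m w = G}"
      hence w: "simple_word w m" "slot_edge w ` {..<m} = E" by (auto simp: word_graph_def E_def)
      show "\<phi> w \<in> Inj \<times> ({..<m} \<rightarrow>\<^sub>E UNIV)" using w by (auto simp: \<phi>_def Inj_def simple_word_def)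
    qed
    show "\<psi> ` (Inj \<times> ({..<m} \<rightarrow>\<^sub>E UNIV)) \<subseteq> {w \<in> words (pos m) {1..n} (\<lambda>_. D). simple_word w m \<and> word_graph n m w = G}"
    proof (rule image_subsetI)
      fix z assume "z \<in> Inj \<times> ({..<m} \<rightarrow>\<^sub>E (UNIV :: bool set))"
      then obtain f \<beta> where z: "z = (f, \<beta>)" "f \<in> Inj" by auto
      have fs: "f s \<in> E" "Min (f s) \<in> {1..n}" "Max (f s) \<in> {1..n}" "Min (f s) \<noteq> Max (f s)" if "s < m" for s
      proof -
        show "f s \<in> E" using z(2) that by (auto simp: Inj_def)
        hence "f s = {Min (f s), Max (f s)}" "Min (f s) \<noteq> Max (f s)" "f s \<subseteq> {1..n}" using mm E2 by blast+
        thus "Min (f s) \<in> {1..n}" "Max (f s) \<in> {1..n}" "Min (f s) \<noteq> Max (f s)" by blast+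
      qed
      have "inj_on f {..<m}" using z(2) by (simp add: Inj_def)
      have sw: "simple_word (\<psi> z) m"
      proof -
        have "inj_on (slot_edge (\<psi> z)) {..<m}"
          using \<open>inj_on f {..<m}\<close> edge_\<psi>[OF z(2)] by (simp add: z(1) inj_on_def)
        moreover have "\<psi> z (s, False) \<noteq> \<psi> z (s, True)" if "s < m" for s
          using fs(4)[OF that] that by (cases "\<beta> s") (auto simp: z(1) \<psi>_def mem_pos_iff)
        ultimately show ?thesis by (simp add: simple_word_def)
      qed
      have "f ` {..<m} = E"
        using fs(1) fE \<open>inj_on f {..<m}\<close> by (intro card_subset_eq) (auto simp: card_image)
      moreover have "slot_edge (\<psi> z) ` {..<m} = f ` {..<m}" unfolding z(1) using edge_\<psi>[OF z(2)] by (intro image_cong) auto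
      ultimately have wg: "word_graph n m (\<psi> z) = G" using Gv by (simp add: word_graph_def E_def prod_eq_iff)
      have "\<psi> z \<in> pos m \<rightarrow>\<^sub>E {1..n}" using fs(2,3) by (auto simp: z(1) \<psi>_def mem_pos_iff)
      moreover have "card {p\<in>pos m. \<psi> z p = v} \<in> D" if "v \<in> {1..n}" for v
        using deg[OF that] word_degree[OF sw, of n v] wg by simp
      ultimately show "\<psi> z \<in> {w \<in> words (pos m) {1..n} (\<lambda>_. D). simple_word w m \<and> word_graph n m w = G}"
        using sw wg by (simp add: words_def)
    qed
  qed
  hence "card {w \<in> words (pos m) {1..n} (\<lambda>_. D). simple_word w m \<and> word_graph n m w = G} = card (Inj \<times> ({..<m} \<rightarrow>\<^sub>E (UNIV :: bool set)))"
    by (rule bij_betw_same_card)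
  moreover have "card Inj = (\<Prod>i<m. m - i)"
    unfolding Inj_def using card_inj_on_subset_funcset[OF _ fE(1) subset_refl, of "{..<m}"] fE(2) by (simp add: atLeast0LessThan)
  ultimately show ?thesis by (simp add: card_cartesian_product card_funcsetE)
qed

lemma finite_nmD_graphs [simp]: "finite (nmD_graphs n m D)"
proof (rule finite_subset)
  show "nmD_graphs n m D \<subseteq> {{1..n}} \<times> Pow (Pow {1..n})"
  proof
    fix G assume "G \<in> nmD_graphs n m D"
    hence "verts G = {1..n}" "\<forall>e\<in>edges G. e \<subseteq> {1..n}" by (auto simp: nmD_graphs_def simple_graph_def)
    thus "G \<in> {{1..n}} \<times> Pow (Pow {1..n})" unfolding mem_Times_iff by blast
  qed
qed simp

lemma card_simple_words:
  "card {w \<in> words (pos m) {1..n} (\<lambda>_. D). simple_word w m \<and> Q (word_graph n m w)} =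
     ((\<Prod>i<m. m - i) * 2 ^ m) * card {G \<in> nmD_graphs n m D. Q G}"
proof -
  let ?W = "{w \<in> words (pos m) {1..n} (\<lambda>_. D). simple_word w m \<and> Q (word_graph n m w)}"
  have "card ?W = (\<Sum>w\<in>?W. 1)" by simp
  also have "\<dots> = (\<Sum>G\<in>{G \<in> nmD_graphs n m D. Q G}. \<Sum>w\<in>{w\<in>?W. word_graph n m w = G}. 1)"
  proof (rule sum.group[symmetric])
    show "word_graph n m ` ?W \<subseteq> {G \<in> nmD_graphs n m D. Q G}"
      by (rule image_subsetI) (simp add: word_graph_mem)
  qed auto
  also have "\<dots> = (\<Sum>G\<in>{G \<in> nmD_graphs n m D. Q G}. (\<Prod>i<m. m - i) * 2 ^ m)"
  proof (intro sum.cong refl)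
    fix G assume G: "G \<in> {G \<in> nmD_graphs n m D. Q G}"
    have "{w\<in>?W. word_graph n m w = G} = {w \<in> words (pos m) {1..n} (\<lambda>_. D). simple_word w m \<and> word_graph n m w = G}"
      using G by auto
    thus "(\<Sum>w\<in>{w\<in>?W. word_graph n m w = G}. 1) = (\<Prod>i<m. m - i) * 2 ^ m"
      using card_word_fibre[of G n m D] G by simp
  qed
  finally show ?thesis by (simp add: mult.commute)
qed

section \<open>Connected graphs with two cycles\<close>

definition adj :: "'a set set \<Rightarrow> ('a \<times> 'a) set" where
  "adj E = {(x, y). {x, y} \<in> E}"

lemma sym_adj: "sym (adj E)"
  by (auto simp: adj_def sym_def insert_commute)

text \<open>Choosing for every vertex other than the root an edge towards the root is injective.\<close>
lemma connected_card_le: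
  assumes fin: "finite E" and r: "r \<in> V" and con: "\<And>v. v \<in> V \<Longrightarrow> (r, v) \<in> (adj E)\<^sup>*"
  shows "card V \<le> card E + 1"
proof -
  \<comment> \<open>\<open>d v\<close> is the distance from the root; the edge chosen at
    \<open>v\<close> leads to a strictly nearer vertex.\<close>
  define d where "d = (\<lambda>v. LEAST n. (r, v) \<in> adj E ^^ n)"
  have d: "(r, v) \<in> adj E ^^ d v" if "v \<in> V" for v
  proof -
    have "\<exists>n. (r, v) \<in> adj E ^^ n" using con[OF that] by (simp add: rtrancl_is_UN_relpow)
    thus ?thesis unfolding d_def by (rule LeastI_ex)
  qed
  have "\<exists>u. {u, v} \<in> E \<and> d u < d v" if v: "v \<in> V - {r}" for v
  proof -
    have "d v \<noteq> 0" using d[of v] v by (metis DiffE insertCI relpow_0_E)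
    then obtain k where k: "d v = Suc k" using not0_implies_Suc by blast
    have "(r, v) \<in> adj E ^^ Suc k" using d[of v] v k by simp
    then obtain u where u: "(r, u) \<in> adj E ^^ k" "(u, v) \<in> adj E" by auto
    have "d u \<le> k" unfolding d_def using u(1) by (rule Least_le)
    thus ?thesis using u(2) k by (auto simp: adj_def)
  qed
  then obtain p where p: "\<And>v. v \<in> V - {r} \<Longrightarrow> {p v, v} \<in> E \<and> d (p v) < d v" by metis
  have "inj_on (\<lambda>v. {p v, v}) (V - {r})"
  proof (rule inj_onI)
    fix u v assume uv: "u \<in> V - {r}" "v \<in> V - {r}" "{p u, u} = {p v, v}"
    show "u = v"
    proof (rule ccontr)
      assume "u \<noteq> v"
      \<comment> \<open>Two vertices that chose the same edge would each be nearer to the root than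
        the other.\<close>
      hence "p u = v" "p v = u" using uv(3) by (auto simp: doubleton_eq_iff)
      thus False using p[OF uv(1)] p[OF uv(2)] by auto
    qed
  qed
  moreover have "(\<lambda>v. {p v, v}) ` (V - {r}) \<subseteq> E" using p by blast
  ultimately have "card (V - {r}) \<le> card E" using fin by (rule card_inj_on_le)
  \<comment> \<open>An infinite \<open>V\<close> has \<open>card V = 0\<close>.\<close>
  moreover have "card V \<le> card (V - {r}) + 1" using r by (cases "finite V") auto
  ultimately show ?thesis by linarith
qed

lemma cycle_edges:
  assumes "graph_iso (cycle_graph j) S"
  obtains f where "bij_betw f {..<j} (verts S)" "edges S = (\<lambda>x. {f x, f (Suc x mod j)}) ` {..<j}"
proof -
  obtain f where f: "bij_betw f {0..<j} (verts S)" "edges S = (\<lambda>e. f ` e) ` edges (cycle_graph j)"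
    using assms by (auto simp: graph_iso_def cycle_graph_def)
  have "edges S = (\<lambda>x. {f x, f (Suc x mod j)}) ` {..<j}"
    unfolding f(2) cycle_graph_edges image_image by simp
  thus ?thesis using that f(1) by (simp add: atLeast0LessThan)
qed

lemma cycle_edge_inj:
  assumes f: "bij_betw f {..<j} V" and j: "j \<ge> 3"
  shows "inj_on (\<lambda>x. {f x, f (Suc x mod j)}) {..<j}"
proof (rule inj_onI)
  fix x y assume xy: "x \<in> {..<j}" "y \<in> {..<j}" "{f x, f (Suc x mod j)} = {f y, f (Suc y mod j)}"
  have lt: "Suc x mod j < j" for x using j by simp
  have "f ` {x, Suc x mod j} = f ` {y, Suc y mod j}" using xy(3) by simp
  hence "{x, Suc x mod j} = {y, Suc y mod j}"
    using inj_on_image_eq_iff[of f "{..<j}" "{x, Suc x mod j}" "{y, Suc y mod j}"] f xy lt by (auto simp: bij_betw_def)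
  thus "x = y" using cyclic_pair_inj xy j by blast
qed

text \<open>The ends of \<open>e\<close> remain joined by the walk around the rest of the cycle, so
  every step along \<open>e\<close> can be replaced.\<close>

lemma remove_cycle_edge:
  assumes S: "graph_iso (cycle_graph j) S" "j \<ge> 3" "edges S \<subseteq> E" and e: "e \<in> edges S"
  shows "(adj E)\<^sup>* = (adj (E - {e}))\<^sup>*"
proof -
  obtain f where f: "bij_betw f {..<j} (verts S)" "edges S = (\<lambda>x. {f x, f (Suc x mod j)}) ` {..<j}"
    using cycle_edges[OF S(1)] by blast
  obtain i where i: "i < j" "e = {f i, f (Suc i mod j)}" using e f(2) by auto
  let ?R = "adj (E - {e})"
  \<comment> \<open>At most \<open>j - 1\<close> steps from the far end of \<open>e\<close> stay off
    \<open>e\<close>, because the \<open>j\<close> edges of the cycle are distinct.\<close>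
  have path: "(f (Suc i mod j), f (Suc (i + t) mod j)) \<in> ?R\<^sup>*" if "t < j" for t
    using that
  proof (induction t)
    case (Suc t)
    define y where "y = Suc (i + t) mod j"
    have y: "y < j" using i by (simp add: y_def)
    have "y \<noteq> i"
    proof
      assume "y = i"
      hence "(i + Suc t) mod j = (i + 0) mod j" using i(1) by (simp add: y_def)
      then obtain q1 q2 where "i + Suc t + j * q1 = i + 0 + j * q2" unfolding nat_mod_eq_iff by blast
      hence "Suc t + j * q1 = 0 + j * q2" by linarith
      hence "Suc t mod j = 0 mod j" unfolding nat_mod_eq_iff by blast
      thus False using Suc.prems by simp
    qed
    hence "{f y, f (Suc y mod j)} \<noteq> e"
      using inj_onD[OF cycle_edge_inj[OF f(1) S(2)], of y i] y i by auto
    hence "(f y, f (Suc y mod j)) \<in> ?R" using y f(2) S(3) by (auto simp: adj_def)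
    moreover have "Suc y mod j = Suc (i + Suc t) mod j" by (simp add: y_def mod_Suc_eq)
    ultimately show ?case using Suc by (simp add: y_def rtrancl_into_rtrancl)
  qed simp
  have "Suc (i + (j - 1)) mod j = i" using i by simp
  hence ret: "(f (Suc i mod j), f i) \<in> ?R\<^sup>*" using path[of "j - 1"] i by simp
  have sym: "sym (?R\<^sup>*)" by (rule sym_rtrancl[OF sym_adj])
  have "adj E \<subseteq> ?R\<^sup>*"
  proof
    fix z assume z: "z \<in> adj E"
    obtain u v where uv: "z = (u, v)" "{u, v} \<in> E" using z by (auto simp: adj_def)
    show "z \<in> ?R\<^sup>*"
    proof (cases "{u, v} = e")
      case True
      hence "(u = f i \<and> v = f (Suc i mod j)) \<or> (v = f i \<and> u = f (Suc i mod j))" using i(2) by (auto simp: doubleton_eq_iff)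
      thus ?thesis using ret symD[OF sym ret] uv(1) by auto
    next
      case False
      thus ?thesis using uv by (auto simp: adj_def)
    qed
  qed
  moreover have "?R \<subseteq> adj E" by (auto simp: adj_def)
  ultimately show ?thesis using rtrancl_subset by blast
qed

text \<open>The cycle \<open>S'\<close> is read as a word, so that \<open>card_letters_proper\<close> applies to the slots of \<open>S\<close>.\<close>
lemma cycle_subset_eq:
  assumes S: "graph_iso (cycle_graph j) S" "j \<ge> 3" and S': "graph_iso (cycle_graph j') S'" "j' \<ge> 3"
    and sub: "edges S \<subseteq> edges S'"
  shows "S = S'"
proof -
  obtain f where f: "bij_betw f {..<j} (verts S)" "edges S = (\<lambda>x. {f x, f (Suc x mod j)}) ` {..<j}"
    using cycle_edges[OF S(1)] by blast
  obtain g where g: "bij_betw g {..<j'} (verts S')" "edges S' = (\<lambda>x. {g x, g (Suc x mod j')}) ` {..<j'}"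
    using cycle_edges[OF S'(1)] by blast
  have U: "verts T = \<Union> (edges T)" if "bij_betw h {..<i} (verts T)" "edges T = (\<lambda>x. {h x, h (Suc x mod i)}) ` {..<i}" "i \<ge> 3" for h i and T :: "'a graph"
  proof -
    have "Suc x mod i < i" for x using that(3) by simp
    thus ?thesis using that(1) unfolding that(2) by (auto simp: bij_betw_def)
  qed
  define w where "w = (\<lambda>p. if snd p then g (Suc (fst p) mod j') else g (fst p))"
  have se: "slot_edge w s = {g s, g (Suc s mod j')}" for s by (simp add: slot_edge_def w_def)
  have lt: "Suc x mod j' < j'" for x using S'(2) by simp
  have c: "restrict (\<lambda>x. (x, False)) {..<j'} \<in> rooted_cycles w j' {..<j'}"
    unfolding rooted_cycles_def using g(1) lt by (auto simp: w_def opp_def bij_betw_def inj_on_def)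
  define B where "B = {s. s < j' \<and> slot_edge w s \<in> edges S}"
  have im: "slot_edge w ` B = edges S" using sub g(2) by (auto simp: B_def se)
  have "inj_on (slot_edge w) {..<j'}" unfolding se using cycle_edge_inj[OF g(1) S'(2)] .
  hence "inj_on (slot_edge w) B" by (rule inj_on_subset) (auto simp: B_def)
  hence "card B = card (edges S)" using card_image im by metis
  also have "card (edges S) = j" unfolding f(2) using card_image[OF cycle_edge_inj[OF f(1) S(2)]] by simp
  finally have cB: "card B = j" .
  have lB: "letters w B = verts S" unfolding letters_eq_Union im using U[OF f S(2)] by simp
  have "card (verts S) = j" using bij_betw_same_card[OF f(1)] by simp
  \<comment> \<open>A proper part of the slots of \<open>S'\<close> would have more letters than
    slots, while \<open>S\<close> has \<open>j\<close> of each.\<close>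
  hence "\<not> B \<subset> {..<j'}"
    using card_letters_proper[OF c, of B] cB lB S(2) S'(2) by force
  moreover have "B \<subseteq> {..<j'}" by (auto simp: B_def)
  ultimately have "B = {..<j'}" by blast
  hence "edges S = edges S'" using im g(2) by (simp add: se)
  thus "S = S'" using U[OF f S(2)] U[OF g S'(2)] by (simp add: prod_eq_iff)
qed

text \<open>\<open>F\<close> contains two different cycles. Deleting an edge of the first that is
  not in the second leaves the second intact, so that one of its edges can be deleted as well.
  Connectedness survives both deletions, and a connected graph has at most one vertex more than
  edges.\<close>

lemma multicyclic_card:
  fixes F :: "'a graph"
  assumes F: "simple_graph F" "connected_graph F" "\<not> is_tree F" "\<not> is_unicycle F"
  shows "card (verts F) < card (edges F)"
proof -
  have fE: "finite (edges F)"
    using F(1) by (intro finite_subset[of "edges F" "Pow (verts F)"]) (auto simp: simple_graph_def)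
  obtain S where S: "subgraph S F" "is_cycle S" using F by (auto simp: is_tree_def)
  then obtain S' where S': "subgraph S' F" "is_cycle S'" "S' \<noteq> S" using F by (auto simp: is_unicycle_def)
  obtain j where j: "j \<ge> 3" "graph_iso (cycle_graph j) S" using S(2) by (auto simp: is_cycle_def)
  obtain j' where j': "j' \<ge> 3" "graph_iso (cycle_graph j') S'" using S'(2) by (auto simp: is_cycle_def)
  have "\<not> edges S \<subseteq> edges S'" using cycle_subset_eq[OF j(2,1) j'(2,1)] S'(3) by auto
  then obtain e where e: "e \<in> edges S" "e \<notin> edges S'" by auto
  have "edges S' \<noteq> {}"
  proof -
    obtain f where "edges S' = (\<lambda>x. {f x, f (Suc x mod j')}) ` {..<j'}" using cycle_edges[OF j'(2)] by blast
    thus ?thesis using j'(1) by (auto simp: lessThan_empty_iff)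
  qed
  then obtain e' where e': "e' \<in> edges S'" by auto
  have sub: "edges S \<subseteq> edges F" "edges S' \<subseteq> edges F - {e}" using S(1) S'(1) e by (auto simp: subgraph_def)
  have eq: "(adj (edges F))\<^sup>* = (adj (edges F - {e} - {e'}))\<^sup>*"
    using remove_cycle_edge[OF j(2,1) sub(1) e(1)] remove_cycle_edge[OF j'(2,1) sub(2) e'] by simp
  obtain r where r: "r \<in> verts F" using F(2) by (auto simp: connected_graph_def)
  have "card (verts F) \<le> card (edges F - {e} - {e'}) + 1"
  proof (rule connected_card_le[OF _ r])
    show "finite (edges F - {e} - {e'})" using fE by simp
    fix v assume "v \<in> verts F"
    hence "(r, v) \<in> (adj (edges F))\<^sup>*" using F(2) r by (simp add: connected_graph_def adj_def)
    thus "(r, v) \<in> (adj (edges F - {e} - {e'}))\<^sup>*" unfolding eq .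
  qed
  moreover have "card (edges F - {e} - {e'}) = card (edges F) - 2" "card (edges F) \<ge> 2"
  proof -
    have ee: "{e, e'} \<subseteq> edges F" "e \<noteq> e'" using sub e(1) e' e(2) by auto
    show "card (edges F) \<ge> 2" using card_mono[OF fE ee(1)] ee(2) by simp
    have "edges F - {e} - {e'} = edges F - {e, e'}" by auto
    thus "card (edges F - {e} - {e'}) = card (edges F) - 2"
      using card_Diff_subset[OF _ ee(1)] ee(2) by simp
  qed
  ultimately show ?thesis by linarith
qed

lemma graph_iso_card:
  assumes "simple_graph F" "graph_iso F S"
  shows "card (verts S) = card (verts F)" "card (edges S) = card (edges F)"
proof -
  obtain f where f: "bij_betw f (verts F) (verts S)" "edges S = (\<lambda>e. f ` e) ` edges F"
    using assms(2) by (auto simp: graph_iso_def)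
  show "card (verts S) = card (verts F)" using bij_betw_same_card[OF f(1)] by simp
  have "inj_on (\<lambda>e. f ` e) (edges F)"
    using f(1) assms(1) inj_on_image_eq_iff[of f "verts F"] by (auto simp: inj_on_def[of _ "edges F"] simple_graph_def bij_betw_def)
  thus "card (edges S) = card (edges F)" unfolding f(2) by (rule card_image)
qed

section \<open>Conclusion\<close>

context graph_seq
begin

definition simple_fraction :: "nat \<Rightarrow> real" where
  "simple_fraction n = avg (\<Omega> n) (\<lambda>w. if simple_word w (m n) then 1 else 0)"

lemma Omega_PiE [simp]: "w \<in> \<Omega> n \<Longrightarrow> w \<in> pos (m n) \<rightarrow>\<^sub>E {1..n}"
  by (simp add: \<Omega>_def words_def)

text \<open>The counts of loops and of double edges have Poisson limits too, and the limit is the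
  probability that both vanish. Being positive, it can serve as a denominator when
  conditioning.\<close>

lemma simple_fraction_lim: "simple_fraction \<longlonglongrightarrow> exp (- \<rho> 1) * exp (- \<rho> 2)"
proof -
  have s: "{1..2::nat} = {1, 2}" by auto
  have "(\<lambda>n. avg (\<Omega> n) (\<lambda>w. \<Prod>j=1..2. if card (cycle_sets w (m n) j) = 0 then 1 else 0)) \<longlonglongrightarrow>
     (\<Prod>j=1..2. \<rho> j ^ 0 / fact 0 * exp (- \<rho> j))"
    using cycle_counts_poisson[where k = 2 and t = "\<lambda>_. 0"] .
  moreover have "avg (\<Omega> n) (\<lambda>w. \<Prod>j=1..2. if card (cycle_sets w (m n) j) = 0 then 1 else 0) = simple_fraction n" for n
    unfolding simple_fraction_def s by (rule avg_cong) (auto simp: simple_word_iff)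
  ultimately show ?thesis unfolding s by simp
qed

lemma avg_indicator: "finite A \<Longrightarrow> avg A (\<lambda>w. if P w then 1 else 0) = real (card {w\<in>A. P w}) / real (card A)"
  unfolding avg_def by (subst sum.inter_filter[symmetric]) auto

lemma simple_fraction_pos: "eventually (\<lambda>n. simple_fraction n > 0) sequentially"
  using simple_fraction_lim by (rule order_tendstoD) simp

text \<open>Every graph has the same number \<open>K\<close> of words, so its probability is a
  conditional probability of words. Positivity of \<open>simple_fraction n\<close> makes the set of
  graphs nonempty, so that \<open>pmf_of_set\<close> is meaningful.\<close>

lemma prob_eq:
  assumes "simple_fraction n > 0"
  shows "measure_pmf.prob (random_nmD_graph n (m n) D) {G. Q G} =
    avg (\<Omega> n) (\<lambda>w. if simple_word w (m n) \<and> Q (word_graph n (m n) w) then 1 else 0) / simple_fraction n"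
proof -
  define K where "K = (\<Prod>i<m n. m n - i) * 2 ^ m n"
  have c: "card {w\<in>\<Omega> n. simple_word w (m n) \<and> Q (word_graph n (m n) w)} = K * card {G \<in> nmD_graphs n (m n) D. Q G}" for Q
    unfolding \<Omega>_def K_def by (rule card_simple_words)
  have c0: "card {w\<in>\<Omega> n. simple_word w (m n)} = K * card (nmD_graphs n (m n) D)"
    using c[of "\<lambda>_. True"] by simp
  have "real (card {w\<in>\<Omega> n. simple_word w (m n)}) / real (card (\<Omega> n)) > 0"
    using assms unfolding simple_fraction_def avg_indicator[OF finite_Omega] .
  hence pos: "card (\<Omega> n) > 0" "K * card (nmD_graphs n (m n) D) > 0"
    unfolding c0 zero_less_divide_iff by (simp_all add: zero_less_mult_iff)
  have cancel: "(a / real (card (\<Omega> n))) / (b / real (card (\<Omega> n))) = a / b" for a b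
    using pos(1) by (auto simp del: card_gt_0_iff card_0_eq)
  have "nmD_graphs n (m n) D \<noteq> {}" using pos(2) by (metis card.empty mult_0_right less_irrefl)
  hence "measure_pmf.prob (random_nmD_graph n (m n) D) {G. Q G} = real (card {G \<in> nmD_graphs n (m n) D. Q G}) / real (card (nmD_graphs n (m n) D))"
    unfolding random_nmD_graph_def by (subst measure_pmf_of_set) (auto simp: Int_def)
  also have "\<dots> = real (K * card {G \<in> nmD_graphs n (m n) D. Q G}) / real (K * card (nmD_graphs n (m n) D))"
    using pos(2) unfolding of_nat_mult by (subst mult_divide_mult_cancel_left) auto
  finally show ?thesis
    unfolding simple_fraction_def avg_indicator[OF finite_Omega] c c0 by (simp only: cancel)
qed

text \<open>By Markov's inequality: a copy of \<open>F\<close> forces at least one deficient set of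
  \<open>card (edges F)\<close> slots, and the expected number of these tends to 0. Passing to
  simple words divides by a quantity with a positive limit.\<close>

lemma subgraph_prob_lim:
  fixes F :: "'a graph"
  assumes F: "simple_graph F" "card (verts F) < card (edges F)"
  shows "(\<lambda>n. measure_pmf.prob (random_nmD_graph n (m n) D) {G. \<exists>S. subgraph S G \<and> graph_iso F S}) \<longlonglongrightarrow> 0"
proof -
  define e where "e = card (edges F)"
  let ?d = "\<lambda>n. avg (\<Omega> n) (\<lambda>w. real (card {A. A \<subseteq> {..<m n} \<and> card A = e \<and> deficient w A}))"
  have "eventually (\<lambda>n. norm (measure_pmf.prob (random_nmD_graph n (m n) D) {G. \<exists>S. subgraph S G \<and> graph_iso F S}) \<le> ?d n / simple_fraction n) sequentially"
    using simple_fraction_pos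
  proof eventually_elim
    case (elim n)
    have "avg (\<Omega> n) (\<lambda>w. if simple_word w (m n) \<and> (\<exists>S. subgraph S (word_graph n (m n) w) \<and> graph_iso F S) then 1 else 0) \<le> ?d n"
    proof (rule avg_mono)
      fix w
      show "(if simple_word w (m n) \<and> (\<exists>S. subgraph S (word_graph n (m n) w) \<and> graph_iso F S) then 1 else 0)
         \<le> real (card {A. A \<subseteq> {..<m n} \<and> card A = e \<and> deficient w A})"
      proof (cases "simple_word w (m n) \<and> (\<exists>S. subgraph S (word_graph n (m n) w) \<and> graph_iso F S)")
        case True
        then obtain S where S: "subgraph S (word_graph n (m n) w)" "graph_iso F S" by blast
        have "\<exists>A. A \<subseteq> {..<m n} \<and> card A = card (edges S) \<and> deficient w A"
          using True S(1) F(2) graph_iso_card[OF F(1) S(2)] by (intro subgraph_imp_deficient) auto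
        hence "{A. A \<subseteq> {..<m n} \<and> card A = e \<and> deficient w A} \<noteq> {}"
          using graph_iso_card[OF F(1) S(2)] by (auto simp: e_def)
        moreover have "finite {A. A \<subseteq> {..<m n} \<and> card A = e \<and> deficient w A}"
          by (rule finite_subset[of _ "Pow {..<m n}"]) auto
        ultimately have "card {A. A \<subseteq> {..<m n} \<and> card A = e \<and> deficient w A} \<ge> 1"
          by (simp add: card_gt_0_iff Suc_le_eq)
        thus ?thesis using True by simp
      qed auto
    qed
    hence "measure_pmf.prob (random_nmD_graph n (m n) D) {G. \<exists>S. subgraph S G \<and> graph_iso F S} \<le> ?d n / simple_fraction n"
      unfolding prob_eq[OF elim] using elim by (intro divide_right_mono) auto
    thus ?case by simp
  qed
  moreover have "(\<lambda>n. ?d n / simple_fraction n) \<longlonglongrightarrow> 0 / (exp (- \<rho> 1) * exp (- \<rho> 2))"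
    by (intro tendsto_divide avg_deficient simple_fraction_lim) simp
  hence "(\<lambda>n. ?d n / simple_fraction n) \<longlonglongrightarrow> 0" unfolding div_0 .
  ultimately show ?thesis by (rule Lim_null_comparison)
qed

text \<open>Prescribing no cycles of length one or two restricts the event to simple words. By
  asymptotic independence the factors of these two lengths are exactly the limit of
  \<open>simple_fraction\<close>, and they cancel.\<close>

lemma cycle_counts_prob_lim:
  assumes k: "k \<ge> 3"
  shows "(\<lambda>n. measure_pmf.prob (random_nmD_graph n (m n) D) {G. \<forall>j\<in>{3..k}. subgraph_count (cycle_graph j) G = t j}) \<longlonglongrightarrow>
     (\<Prod>j=3..k. \<rho> j ^ t j / fact (t j) * exp (- \<rho> j))"
proof -
  define t' where "t' = (\<lambda>j. if j \<ge> 3 then t j else (0::nat))"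
  have split: "{1..k} = {1, 2} \<union> {3..k}" "{1::nat, 2} \<inter> {3..k} = {}" using k by auto
  have ev: "eventually (\<lambda>n. avg (\<Omega> n) (\<lambda>w. \<Prod>j=1..k. if card (cycle_sets w (m n) j) = t' j then 1 else 0) / simple_fraction n =
     measure_pmf.prob (random_nmD_graph n (m n) D) {G. \<forall>j\<in>{3..k}. subgraph_count (cycle_graph j) G = t j}) sequentially"
    using simple_fraction_pos
  proof eventually_elim
    case (elim n)
    have "avg (\<Omega> n) (\<lambda>w. \<Prod>j=1..k. if card (cycle_sets w (m n) j) = t' j then 1 else 0) =
      avg (\<Omega> n) (\<lambda>w. if simple_word w (m n) \<and> (\<forall>j\<in>{3..k}. subgraph_count (cycle_graph j) (word_graph n (m n) w) = t j) then 1 else 0)"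
    proof (rule avg_cong)
      fix w assume w: "w \<in> \<Omega> n"
      have "(\<Prod>j=1..k. if card (cycle_sets w (m n) j) = t' j then 1 else 0) = (if \<forall>j\<in>{1..k}. card (cycle_sets w (m n) j) = t' j then 1 else 0 :: real)"
        by (auto intro: prod.neutral prod_zero)
      also have "(\<forall>j\<in>{1..k}. card (cycle_sets w (m n) j) = t' j) \<longleftrightarrow> simple_word w (m n) \<and> (\<forall>j\<in>{3..k}. card (cycle_sets w (m n) j) = t j)"
        unfolding split(1) simple_word_iff by (auto simp: t'_def)
      also have "\<dots> \<longleftrightarrow> simple_word w (m n) \<and> (\<forall>j\<in>{3..k}. subgraph_count (cycle_graph j) (word_graph n (m n) w) = t j)"
        using subgraph_count_cycle[OF Omega_PiE[OF w]] by auto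
      finally show "(\<Prod>j=1..k. if card (cycle_sets w (m n) j) = t' j then 1 else 0) =
         (if simple_word w (m n) \<and> (\<forall>j\<in>{3..k}. subgraph_count (cycle_graph j) (word_graph n (m n) w) = t j) then 1 else 0 :: real)" .
    qed
    thus ?case by (simp only: prob_eq[OF elim])
  qed
  have "(\<lambda>n. avg (\<Omega> n) (\<lambda>w. \<Prod>j=1..k. if card (cycle_sets w (m n) j) = t' j then 1 else 0) / simple_fraction n) \<longlonglongrightarrow>
     (\<Prod>j=1..k. \<rho> j ^ t' j / fact (t' j) * exp (- \<rho> j)) / (exp (- \<rho> 1) * exp (- \<rho> 2))"
    by (intro tendsto_divide cycle_counts_poisson simple_fraction_lim) simp
  also have "(\<Prod>j=1..k. \<rho> j ^ t' j / fact (t' j) * exp (- \<rho> j)) / (exp (- \<rho> 1) * exp (- \<rho> 2)) = (\<Prod>j=3..k. \<rho> j ^ t j / fact (t j) * exp (- \<rho> j))"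
  proof -
    have "(\<Prod>j=1..k. \<rho> j ^ t' j / fact (t' j) * exp (- \<rho> j)) = (\<Prod>j\<in>{1,2}. \<rho> j ^ t' j / fact (t' j) * exp (- \<rho> j)) * (\<Prod>j=3..k. \<rho> j ^ t' j / fact (t' j) * exp (- \<rho> j))"
      unfolding split(1) by (rule prod.union_disjoint[OF _ _ split(2)]) auto
    also have "(\<Prod>j\<in>{1,2}. \<rho> j ^ t' j / fact (t' j) * exp (- \<rho> j)) = exp (- \<rho> 1) * exp (- \<rho> 2)" by (simp add: t'_def)
    also have "(\<Prod>j=3..k. \<rho> j ^ t' j / fact (t' j) * exp (- \<rho> j)) = (\<Prod>j=3..k. \<rho> j ^ t j / fact (t j) * exp (- \<rho> j))"
      by (intro prod.cong) (auto simp: t'_def)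
    finally show ?thesis by simp
  qed
  finally show ?thesis using ev by (rule Lim_transform_eventually)
qed

end

theorem theorem6:
  fixes D :: "nat set" and m :: "nat \<Rightarrow> nat" and l :: real
  assumes D_two: "\<exists>a\<in>D. \<exists>b\<in>D. a \<noteq> b"
    and D_gcd: "Gcd {d - Inf D | d. d \<in> D} = 1"
    and m_inf: "filterlim m at_top sequentially"
    and m_lim: "(\<lambda>n. 2 * real (m n) / real n) \<longlonglongrightarrow> l"
    and l_gt: "real (Inf D) < l"
    and l_lt: "finite D \<Longrightarrow> l < real (Max D)"
  shows
    "(\<forall>F :: 'a graph. simple_graph F \<and> connected_graph F \<and> \<not> is_tree F \<and> \<not> is_unicycle F \<longrightarrow>
        (\<lambda>n. measure_pmf.prob (random_nmD_graph n (m n) D)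
               {G. \<exists>S. subgraph S G \<and> graph_iso F S}) \<longlonglongrightarrow> 0) \<and>
     (\<forall>k\<ge>3. asymp_indep_poisson (\<lambda>n. random_nmD_graph n (m n) D) {3..k}
        (\<lambda>j G. subgraph_count (cycle_graph j) G)
        (\<lambda>n j. cycle_mean D (2 * real (m n) / real n) j))"
proof -
  define r where "r = (\<lambda>n. 2 * real (m n) / real n)"
  define x where "x = (\<lambda>n. chi D (r n))"
  have r_lim: "r \<longlonglongrightarrow> l" using m_lim by (simp add: r_def)
  obtain X where X: "X > 0" "x \<longlonglongrightarrow> X"
    "eventually (\<lambda>n. x n > 0 \<and> x n * Dl D 1 (x n) = r n * Dl D 0 (x n)) sequentially"
    using chi_tendsto[OF D_two l_gt l_lt r_lim] unfolding x_def by blast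
  interpret C: coeff_seq D "\<lambda>n. 2 * m n" x X
  proof
    show "D \<noteq> {}" using D_two by auto
    show "filterlim (\<lambda>n. 2 * m n) at_top sequentially"
      by (rule filterlim_at_top_mono[OF m_inf]) simp
    show "eventually (\<lambda>n. x n > 0 \<and> Em D 1 (x n) = real (2 * m n) / real n * Dl D 0 (x n)) sequentially"
      using X(3) by eventually_elim (simp add: Em_def r_def)
  qed (use D_gcd X in auto)
  \<comment> \<open>The saddle equation makes the mean of the weights at \<open>X\<close> equal to
    the limit of 2m / n.\<close>
  have mu: "C.\<mu> = l"
    using LIMSEQ_unique[OF C.tendsto_mu] r_lim by (simp add: r_def)
  interpret G: graph_seq D m x X
    by unfold_locales (use mu l_gt in simp)
  \<comment> \<open>The means of the theorem vary with \<open>n\<close> but converge, so the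
    comparison along the sequence reduces to the Poisson laws with the limiting means.\<close>
  have mean_lim: "(\<lambda>n. cycle_mean D (2 * real (m n) / real n) j) \<longlonglongrightarrow> G.\<rho> j" for j
  proof -
    have "cycle_mean D (2 * real (m n) / real n) j = 1 / (2 * real j) * (1 / r n * (Em D 2 (x n) / Dl D 0 (x n))) ^ j" for n
      unfolding cycle_mean_def deriv_deriv_Delta Delta_eq_Dl by (simp add: x_def r_def Em_def)
    moreover have "(\<lambda>n. 1 / (2 * real j) * (1 / r n * (Em D 2 (x n) / Dl D 0 (x n))) ^ j) \<longlonglongrightarrow> 1 / (2 * real j) * (1 / l * C.\<kappa>) ^ j"
      unfolding C.\<kappa>_def using l_gt by (intro tendsto_mult tendsto_power tendsto_divide tendsto_const r_lim C.tendsto_ratio) auto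
    ultimately show ?thesis by (simp add: G.\<rho>_def mu)
  qed
  show ?thesis
  proof (intro conjI allI impI)
    fix F :: "'a graph"
    assume "simple_graph F \<and> connected_graph F \<and> \<not> is_tree F \<and> \<not> is_unicycle F"
    thus "(\<lambda>n. measure_pmf.prob (random_nmD_graph n (m n) D) {G. \<exists>S. subgraph S G \<and> graph_iso F S}) \<longlonglongrightarrow> 0"
      using multicyclic_card[of F] by (intro G.subgraph_prob_lim) auto
  next
    fix k :: nat assume k: "k \<ge> 3"
    show "asymp_indep_poisson (\<lambda>n. random_nmD_graph n (m n) D) {3..k}
        (\<lambda>j G. subgraph_count (cycle_graph j) G) (\<lambda>n j. cycle_mean D (2 * real (m n) / real n) j)"
      unfolding asymp_indep_poisson_def
    proof
      fix t :: "nat \<Rightarrow> nat"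
      have "(\<lambda>n. \<Prod>j=3..k. cycle_mean D (2 * real (m n) / real n) j ^ t j / fact (t j) * exp (- cycle_mean D (2 * real (m n) / real n) j))
         \<longlonglongrightarrow> (\<Prod>j=3..k. G.\<rho> j ^ t j / fact (t j) * exp (- G.\<rho> j))"
        by (intro tendsto_intros mean_lim) auto
      from tendsto_diff[OF G.cycle_counts_prob_lim[OF k, of t] this]
      show "(\<lambda>n. measure_pmf.prob (random_nmD_graph n (m n) D) {G. \<forall>j\<in>{3..k}. subgraph_count (cycle_graph j) G = t j} -
         (\<Prod>j\<in>{3..k}. cycle_mean D (2 * real (m n) / real n) j ^ t j / fact (t j) * exp (- cycle_mean D (2 * real (m n) / real n) j))) \<longlonglongrightarrow> 0"
        by simp
    qed
  qed
qed

end
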